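(* Let $K:\mathbb{N}\to[0,1]$ be an aperiodic discrete probability density on $\mathbb{N}=\{1,2,\ldots\}$, and for $b\ge 0$ let $K_b$, $c(b)$, $\hat{K_b}$, $u_b(n)$ and $u_b(\infty)$ be as defined in the context. Let $b_0\in[0,\infty]$ be the infimum of the values of $b>0$ such that there exists $z\in\mathbb{C}$ satisfying $1<|z|\le \exp(b)$ and $\hat{K_b}(z)=1$ (with $b_0=\infty$ if there is no such $b$). (1) Suppose that for some $\alpha>0$ and some function $L(\cdot)$ slowly varying at infinity $$\overline{K}(N):=\sum_{n>N}K(n)\ \stackrel{N\to\infty}{\sim}\ \frac{L(N)}{\alpha N^{\alpha}}.$$ Then $b_0\in(0,\infty]$; for every (finite) $b\in(0,b_0]$ $$\limsup_{n\to\infty}\frac1n\log\left|u_b(n)-u_b(\infty)\right| = -b,$$ while for every (finite) $b>b_0$ $$\limsup_{n\to\infty}\frac1n\log\left|u_b(n)-u_b(\infty)\right| \ge -b.$$ (2) Suppose that for some $\alpha>0$ and some function $L(\cdot)$ slowly varying at infinity $$K(n)\ \stackrel{n\to\infty}{\sim}\ \frac{L(n)}{n^{1+\alpha}}.$$ Then for every $b\in(0,b_0)$ $$u_b(n)-u_b(\infty)\ \stackrel{n\to\infty}{\sim}\ \frac{K_b(n)}{(c(b)-1)^2},$$ which implies $$\lim_{n\to\infty}\frac1n\log\left(u_b(n)-u_b(\infty)\right) = -b.$$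
   Context: Notation: $a_N\stackrel{N\to\infty}{\sim}b_N$ means $\lim_{N\to\infty}a_N/b_N=1$. A function $L(\cdot)$ defined on the positive semi-axis is slowly varying at infinity if it is positive, measurable and $\lim_{t\to\infty}L(ct)/L(t)=1$ for every $c>0$. A discrete probability density $K$ on $\mathbb{N}=\{1,2,\ldots\}$ satisfies $K(n)\ge 0$ and $\sum_{n\ge1}K(n)=1$; it is aperiodic if $\gcd\{n:\,K(n)>0\}=1$. For $b\ge0$ set $K_b(n):=c(b)K(n)\exp(-bn)$ for $n\in\mathbb{N}$, where $c(b):=1/\sum_{n\ge1}K(n)\exp(-bn)$, so that $K_b$ is a probability density on $\mathbb{N}$. Its $z$-transform is $\hat{K_b}(z):=\sum_{n\ge1}K_b(n)z^n$, which converges absolutely for complex $z$ with $|z|\le\exp(b)$. The renewal process $\tau(b)=\{\tau_0(b),\tau_1(b),\ldots\}$ with inter-arrival law $K_b$ is defined by $\tau_0(b)=0$ and by requiring that $\{\tau_{j+1}(b)-\tau_j(b)\}_{j\ge0}$ be IID random variables with $\mathbf{P}(\tau_1(b)=n)=K_b(n)$. Viewing $\tau(b)$ as a random subset of $\mathbb{N}\cup\{0\}$, the mass renewal function is $u_b(n):=\mathbf{P}(n\in\tau(b))$, $n=0,1,2,\ldots$; equivalently $u_b(0)=1$ and $u_b(n)=\sum_{j=0}^{n-1}u_b(j)K_b(n-j)$ for $n\ge1$. Its limit is $u_b(\infty):=\lim_{n\to\infty}u_b(n)=1/\mathbf{E}[\tau_1(b)]=1/\sum_{n\ge1}nK_b(n)$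 (Renewal Theorem). The convention $\log 0=-\infty$ is used. *)

theory Defs
  imports "HOL-Probability.Probability" "HOL-Library.Landau_Symbols"
begin

(* Densities on {1, 2, ...} are functions on nat that vanish at 0. *)
definition discrete_density :: "(nat \<Rightarrow> real) \<Rightarrow> bool" where
  "discrete_density K \<longleftrightarrow> K 0 = 0 \<and> (\<forall>n. 0 \<le> K n) \<and> K sums 1"

definition aperiodic :: "(nat \<Rightarrow> real) \<Rightarrow> bool" where
  "aperiodic K \<longleftrightarrow> Gcd {n. K n > 0} = 1"

(* Measurability is Lebesgue measurability, as usual for slowly varying functions;
   this includes all Borel functions. *)
definition slowly_varying :: "(real \<Rightarrow> real) \<Rightarrow> bool" where
  "slowly_varying L \<longleftrightarrow>
     (\<forall>t>0. L t > 0) \<and> L \<in> borel_measurable (lebesgue_on {0<..}) \<and>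
     (\<forall>c>0. ((\<lambda>t. L (c * t) / L t) \<longlongrightarrow> 1) at_top)"

definition tail :: "(nat \<Rightarrow> real) \<Rightarrow> nat \<Rightarrow> real" where
  "tail K N = (\<Sum>i. K (N + 1 + i))"

definition tilt_const :: "(nat \<Rightarrow> real) \<Rightarrow> real \<Rightarrow> real" where
  "tilt_const K b = 1 / (\<Sum>n. K n * exp (- b * real n))"

definition tilted :: "(nat \<Rightarrow> real) \<Rightarrow> real \<Rightarrow> nat \<Rightarrow> real" where
  "tilted K b n = tilt_const K b * K n * exp (- b * real n)"

definition ztrans :: "(nat \<Rightarrow> real) \<Rightarrow> complex \<Rightarrow> complex" where
  "ztrans K z = (\<Sum>n. complex_of_real (K n) * z ^ n)"

(* The space of IID sequences of inter-arrival times with law K; embed_pmf turns the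
   density K into a measure. *)
definition renewal_space :: "(nat \<Rightarrow> real) \<Rightarrow> (nat \<Rightarrow> nat) measure" where
  "renewal_space K = (\<Pi>\<^sub>M i\<in>UNIV. measure_pmf (embed_pmf K))"

definition renewal_epoch :: "(nat \<Rightarrow> nat) \<Rightarrow> nat \<Rightarrow> nat" where
  "renewal_epoch \<omega> j = (\<Sum>i<j. \<omega> i)"

definition renewal_mass :: "(nat \<Rightarrow> real) \<Rightarrow> nat \<Rightarrow> real" where
  "renewal_mass K n =
     measure (renewal_space K) {\<omega> \<in> space (renewal_space K). n \<in> range (renewal_epoch \<omega>)}"

definition renewal_limit :: "(nat \<Rightarrow> real) \<Rightarrow> real" where
  "renewal_limit K = lim (renewal_mass K)"

(* The infimum of the empty set of extended reals is \<infinity>. *)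
definition critical_b :: "(nat \<Rightarrow> real) \<Rightarrow> ereal" where
  "critical_b K =
     Inf (ereal ` {b. b > 0 \<and> (\<exists>z. 1 < cmod z \<and> cmod z \<le> exp b \<and> ztrans (tilted K b) z = 1)})"

(* log 0 = -\<infinity>.  On negative arguments the library's ln is ln of the absolute value,
   whereas here the value is -\<infinity>. *)
definition elog :: "real \<Rightarrow> ereal" where
  "elog x = (if x \<le> 0 then - \<infinity> else ereal (ln x))"

lemma discrete_density_nn_integral:
  assumes "discrete_density K"
  shows "(\<integral>\<^sup>+n. ennreal (K n) \<partial>count_space UNIV) = 1"
proof -
  have K: "\<And>n. 0 \<le> K n" "K sums 1"
    using assms by (auto simp: discrete_density_def)
  have "(\<integral>\<^sup>+n. ennreal (K n) \<partial>count_space UNIV) = (\<Sum>n. ennreal (K n))"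
    by (rule nn_integral_count_space_nat)
  also have "\<dots> = ennreal (\<Sum>n. K n)"
    using K by (intro suminf_ennreal2) (auto simp: sums_iff)
  finally show ?thesis using K by (simp add: sums_iff)
qed

lemma pmf_discrete_density:
  assumes "discrete_density K"
  shows "pmf (embed_pmf K) n = K n"
  using assms discrete_density_nn_integral[OF assms]
  by (intro pmf_embed_pmf) (auto simp: discrete_density_def)

lemma discrete_density_tilted:
  assumes K: "discrete_density K" and b: "b \<ge> 0"
  shows "discrete_density (tilted K b)"
proof -
  have nn: "\<And>n. 0 \<le> K n" and K0: "K 0 = 0" and s: "K sums 1"
    using K by (auto simp: discrete_density_def)
  define f where "f = (\<lambda>n. K n * exp (- b * real n))"
  have f_nn: "\<And>n. 0 \<le> f n" using nn by (simp add: f_def)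
  have f_le: "f n \<le> K n" for n
    using nn[of n] b by (auto simp: f_def intro!: mult_left_le)
  have sf: "summable f"
    by (rule summable_comparison_test'[of K 0]) (use s f_le f_nn in \<open>auto simp: sums_iff\<close>)
  have "\<exists>n. K n \<noteq> 0"
  proof (rule ccontr)
    assume "\<not> (\<exists>n. K n \<noteq> 0)"
    then have "K = (\<lambda>n. 0)" by auto
    then have "K sums 0" by simp
    with s show False using sums_unique2 by fastforce
  qed
  then obtain n where "K n \<noteq> 0" by blast
  then have "0 < f n" using nn[of n] by (simp add: f_def)
  then have pos: "0 < suminf f"
    using sf f_nn by (intro suminf_pos2)
  have "(\<lambda>n. f n / suminf f) sums (suminf f / suminf f)"
    using sf by (intro sums_divide) (rule summable_sums)
  moreover have "tilted K b = (\<lambda>n. f n / suminf f)"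
    by (rule ext) (simp add: tilted_def tilt_const_def f_def)
  ultimately show ?thesis
    using pos f_nn K0 by (auto simp: discrete_density_def f_def intro!: divide_nonneg_pos)
qed

lemma renewal_mass_0: "renewal_mass K 0 = 1"
proof -
  interpret prob_space "renewal_space K"
    unfolding renewal_space_def by (intro prob_space_PiM prob_space_measure_pmf)
  have "0 \<in> range (renewal_epoch \<omega>)" for \<omega>
    by (rule range_eqI[of _ _ 0]) (simp add: renewal_epoch_def)
  then show ?thesis
    by (simp add: renewal_mass_def prob_space)
qed

lemma renewal_mass_rec:
  assumes K: "discrete_density K" and n: "n \<ge> 1"
  shows "renewal_mass K n = (\<Sum>j<n. renewal_mass K j * K (n - j))"
proof -
  let ?M = "measure_pmf (embed_pmf K)"
  interpret sequence_space ?M ..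
  define A where "A = (\<lambda>m. {\<omega> \<in> space S. m \<in> range (renewal_epoch \<omega>)})"
  have ep[measurable]: "(\<lambda>\<omega>. renewal_epoch \<omega> j) \<in> measurable S (count_space UNIV)" for j
    unfolding renewal_epoch_def by measurable
  have A_eq: "A m = {\<omega> \<in> space S. \<exists>j. renewal_epoch \<omega> j = m}" for m
    unfolding A_def by auto
  have A_sets[measurable]: "A m \<in> sets S" for m
    unfolding A_eq by measurable
  have mass: "renewal_mass K m = measure S (A m)" for m
    by (simp add: renewal_mass_def A_def renewal_space_def)
  have K_nn: "\<And>n. 0 \<le> K n" and K0: "K 0 = 0"
    using K by (auto simp: discrete_density_def)
  have ep0: "renewal_epoch \<omega> 0 = 0" for \<omega>
    by (simp add: renewal_epoch_def)
  have epS: "renewal_epoch (case_nat s \<omega>) (Suc j) = s + renewal_epoch \<omega> j" for s \<omega> j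
    unfolding renewal_epoch_def by (subst sum.lessThan_Suc_shift) simp
  have step: "(\<exists>j. renewal_epoch (case_nat s \<omega>) j = n) \<longleftrightarrow>
      s \<le> n \<and> (\<exists>j. renewal_epoch \<omega> j = n - s)" (is "?l \<longleftrightarrow> ?r") for s \<omega>
  proof
    assume ?l
    then obtain j where j: "renewal_epoch (case_nat s \<omega>) j = n" by blast
    with n ep0 obtain i where "j = Suc i" by (cases j) auto
    with j epS show ?r by (metis add_diff_cancel_left' le_add1)
  next
    assume ?r
    then obtain j where "s \<le> n" "renewal_epoch \<omega> j = n - s" by blast
    then have "renewal_epoch (case_nat s \<omega>) (Suc j) = n" by (simp add: epS)
    then show ?l by blast
  qed
  have "emeasure S (A n) = emeasure (distr (?M \<Otimes>\<^sub>M S) S (\<lambda>(s, \<omega>). case_nat s \<omega>)) (A n)"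
    by (simp only: PiM_iter)
  also have "\<dots> = emeasure (?M \<Otimes>\<^sub>M S)
      ((\<lambda>(s, \<omega>). case_nat s \<omega>) -` A n \<inter> space (?M \<Otimes>\<^sub>M S))"
    by (intro emeasure_distr) measurable
  also have "\<dots> = (\<integral>\<^sup>+s. emeasure S (Pair s -`
      ((\<lambda>(s, \<omega>). case_nat s \<omega>) -` A n \<inter> space (?M \<Otimes>\<^sub>M S))) \<partial>?M)"
    by (intro emeasure_pair_measure_alt) measurable
  also have "\<dots> = (\<integral>\<^sup>+s. (if s \<le> n then emeasure S (A (n - s)) else 0) \<partial>?M)"
  proof (intro nn_integral_cong)
    fix s
    have "Pair s -` ((\<lambda>(s, \<omega>). case_nat s \<omega>) -` A n \<inter> space (?M \<Otimes>\<^sub>M S)) =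
        (if s \<le> n then A (n - s) else {})"
      by (auto simp: A_eq step space_pair_measure space_PiM)
    then show "emeasure S (Pair s -` ((\<lambda>(s, \<omega>). case_nat s \<omega>) -` A n \<inter> space (?M \<Otimes>\<^sub>M S))) =
        (if s \<le> n then emeasure S (A (n - s)) else 0)" by simp
  qed
  also have "\<dots> = (\<integral>\<^sup>+s. ennreal (K s) * (if s \<le> n then emeasure S (A (n - s)) else 0)
      \<partial>count_space UNIV)"
    by (simp add: nn_integral_measure_pmf pmf_discrete_density[OF K])
  also have "\<dots> = (\<Sum>s\<le>n. ennreal (K s) * emeasure S (A (n - s)))"
    by (subst nn_integral_count_space'[of "{..n}"]) auto
  also have "\<dots> = ennreal (\<Sum>s\<le>n. K s * renewal_mass K (n - s))"
    by (subst sum_ennreal[symmetric])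
       (auto simp: mass emeasure_eq_measure K_nn ennreal_mult)
  finally have "renewal_mass K n = (\<Sum>s\<le>n. K s * renewal_mass K (n - s))"
    by (simp add: mass emeasure_eq_measure K_nn sum_nonneg)
  also have "\<dots> = (\<Sum>j\<le>n. renewal_mass K j * K (n - j))"
    by (rule sum.reindex_bij_witness[of _ "\<lambda>j. n - j" "\<lambda>j. n - j"]) auto
  also have "\<dots> = (\<Sum>j<n. renewal_mass K j * K (n - j))"
    by (simp add: lessThan_Suc_atMost[symmetric] K0)
  finally show ?thesis .
qed

end

theory Submission
  imports Defs "HOL-Complex_Analysis.Complex_Analysis" "HOL-Real_Asymp.Real_Asymp"
begin

text \<open>Rescale the disc of radius \<open>exp b\<close> to the unit disc and write \<open>q n\<close> for \<open>exp (b n)\<close> times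
  the tail of the tilted density.  Its generating function satisfies
  \<open>(1 - exp b w) Q w = 1 - c K w\<close>, and \<open>V = 1 / Q\<close> generates \<open>exp (b n) (u n - u (n - 1))\<close>.
  By aperiodicity a zero of \<open>Q\<close> in the closed disc comes from a solution of \<open>K w = K (exp (- b))\<close> with
  \<open>\<bar>w\<bar> > exp (- b)\<close>.  For small \<open>b\<close> there is none, because the imaginary part of \<open>K w\<close> is positive
  just above the real axis near 1.  At the critical \<open>b\<close> there is none inside the open disc, because
  \<open>K\<close> is an open map and the zero would persist for smaller \<open>b\<close>.  Hence \<open>V\<close> is holomorphic in the unit disc,
  which gives the upper bound.  If \<open>V\<close> were holomorphic in a larger disc, then so would be
  \<open>Q = 1 / V\<close>, and the tail of \<open>K\<close> would decay exponentially; this gives the lower bound.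

  For the sharp asymptotics \<open>Q\<close> has no zero in the closed disc.  Wiener's lemma makes \<open>V\<close> absolutely summable,
  and comparing coefficients in \<open>V' = - Q' V\<^sup>2\<close> yields \<open>v n \<sim> - V(1)\<^sup>2 q n\<close>.\<close>

section \<open>Slowly varying functions\<close>

text \<open>Positivity of \<open>critical_b\<close> is the delicate point. Near 1 the transform of
  \<open>K\<close> has no single expansion: with a finite mean a linear term dominates, with an
  infinite mean a power given by \<alpha> does. So its imaginary part is only bounded below. On the
  scale \<open>t = s + \<theta>\<close> the terms with \<open>n t\<close> up to \<delta> are
  nonnegative, those with \<open>n t\<close> beyond \<open>A\<close> cost a multiple of the tail at
  \<open>A / t\<close>, and in between only ratios of tails occur, which converge by regular
  variation. Compactness covers all ratios of \<open>s\<close> to \<theta>, and every \<alpha> > 0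
  is treated alike.

  Wiener's lemma enters because the unit circle bounds the disc of convergence of \<open>Q\<close>:
  the absence of zeros on it gives no larger radius for \<open>1 / Q\<close>.

  The constant: \<open>Q 1\<close> is \<open>(c - 1) / (exp b - 1)\<close> and \<open>q n\<close> is
  asymptotic to \<open>c K n / (exp b - 1)\<close>, so \<open>v n\<close> is asymptotic to
  \<open>- c (exp b - 1) K n / (c - 1)^2\<close>. Summing the later increments of \<open>u\<close>,
  each step discounted by \<open>exp (- b)\<close>, divides by \<open>exp b - 1\<close> once
  more.\<close>

lemma slowly_varying_sequence:
  fixes x u :: "nat \<Rightarrow> real"
  assumes L: "slowly_varying L" and x: "filterlim x at_top sequentially"
    and u: "\<And>n. u n \<in> {1..2}"
  shows "(\<lambda>n. L (u n * x n) / L (x n)) \<longlonglongrightarrow> 1"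
proof -
  have Lpos: "L t > 0" if "t > 0" for t using L that by (auto simp: slowly_varying_def)
  \<comment> \<open>The guard extends \<open>ln L\<close> from the positive half-line to a Lebesgue
    measurable function on the whole line; only positive arguments matter below.\<close>
  define H where "H = (\<lambda>t. ln (if t \<in> {0<..} then L t else 0))"
  have Heq: "H t = ln (L t)" if "t > 0" for t using that by (simp add: H_def)
  have "(\<lambda>t. if t \<in> {0<..} then L t else 0) \<in> borel_measurable lebesgue"
    using L by (subst borel_measurable_if) (auto simp: slowly_varying_def)
  then have Hm: "H \<in> borel_measurable lebesgue" unfolding H_def by measurable
  have Hlim: "((\<lambda>t. H (c * t) - H t) \<longlongrightarrow> 0) at_top" if c: "c > 0" for c
  proof -
    have "((\<lambda>t. ln (L (c * t) / L t)) \<longlongrightarrow> ln 1) at_top"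
      using L c by (intro tendsto_intros) (auto simp: slowly_varying_def)
    moreover have "eventually (\<lambda>t. ln (L (c * t) / L t) = H (c * t) - H t) at_top"
      using eventually_gt_at_top[of 0]
    proof eventually_elim
      case (elim t)
      then show ?case using c Lpos[of t] Lpos[of "c * t"] by (simp add: Heq ln_div)
    qed
    ultimately show ?thesis by (simp add: tendsto_cong)
  qed
  \<comment> \<open>For each fixed factor \<open>c\<close> the differences tend to 0, so these
    increasing sets exhaust \<open>{1..r}\<close> and eventually carry almost its whole measure.
    This is where the measurability of \<open>L\<close> enters. The sequence \<open>y\<close> is
    general because both \<open>x\<close> and \<open>u n * x n\<close> are inserted.\<close>
  have key: "(\<lambda>n. measure lebesgue {c \<in> {1..r}. \<forall>m\<ge>n. \<bar>H (c * y m) - H (y m)\<bar> < e}) \<longlonglongrightarrow> r - 1"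
    "incseq (\<lambda>n. {c \<in> {1..r}. \<forall>m\<ge>n. \<bar>H (c * y m) - H (y m)\<bar> < e})"
    "{c \<in> {1..r}. \<forall>m\<ge>n. \<bar>H (c * y m) - H (y m)\<bar> < e} \<in> sets lebesgue"
    if y: "filterlim y at_top sequentially" and e: "e > 0" and r: "r \<ge> 1" for y e r n
  proof -
    let ?A = "\<lambda>n. {c \<in> {1..r}. \<forall>m\<ge>n. \<bar>H (c * y m) - H (y m)\<bar> < e}"
    have Am: "?A n \<in> sets lebesgue" for n
    proof -
      have Hs: "(\<lambda>c. H (c * s)) \<in> borel_measurable lebesgue" for s
        using measurable_compose[OF lebesgue_measurable_scaling[of s] Hm] by (simp add: mult.commute)
      have "(\<lambda>c. \<bar>H (c * s) - H s\<bar>) -` {..<e} \<inter> space lebesgue \<in> sets lebesgue" for s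
        by (rule measurable_sets[where A = borel]) (use Hs[of s] in measurable)
      then have "(\<Inter>m\<in>{n..}. (\<lambda>c. \<bar>H (c * y m) - H (y m)\<bar>) -` {..<e}) \<in> sets lebesgue"
        by (intro sets.countable_INT'') (auto simp: vimage_def)
      then have "{1..r} \<inter> (\<Inter>m\<in>{n..}. (\<lambda>c. \<bar>H (c * y m) - H (y m)\<bar>) -` {..<e}) \<in> sets lebesgue"
        by (intro sets.Int) auto
      also have "{1..r} \<inter> (\<Inter>m\<in>{n..}. (\<lambda>c. \<bar>H (c * y m) - H (y m)\<bar>) -` {..<e}) = ?A n" by auto
      finally show ?thesis .
    qed
    then show "?A n \<in> sets lebesgue" .
    show inc: "incseq ?A" by (auto simp: incseq_def)
    have U: "(\<Union>n. ?A n) = {1..r}"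
    proof -
      have "\<exists>n. \<forall>m\<ge>n. \<bar>H (c * y m) - H (y m)\<bar> < e" if "c \<in> {1..r}" for c
      proof -
        have "(\<lambda>m. H (c * y m) - H (y m)) \<longlonglongrightarrow> 0"
          using Hlim[of c] that filterlim_compose[OF _ y] by auto
        from tendstoD[OF this e] show ?thesis by (auto simp: eventually_sequentially dist_real_def)
      qed
      then show ?thesis by auto
    qed
    have "(\<lambda>n. measure lebesgue (?A n)) \<longlonglongrightarrow> measure lebesgue (\<Union>n. ?A n)"
    proof (rule Lim_measure_incseq)
      show "range ?A \<subseteq> sets lebesgue" using Am by blast
      show "emeasure lebesgue (\<Union>n. ?A n) \<noteq> \<infinity>" unfolding U using r by simp
    qed (rule inc)
    also have "measure lebesgue (\<Union>n. ?A n) = r - 1" unfolding U using r by simp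
    finally show "(\<lambda>n. measure lebesgue (?A n)) \<longlonglongrightarrow> r - 1" .
  qed
  define y where "y = (\<lambda>n. u n * x n)"
  have y: "filterlim y at_top sequentially"
  proof (rule filterlim_at_top_mono[OF x])
    show "eventually (\<lambda>n. x n \<le> y n) sequentially"
      using eventually_compose_filterlim[OF eventually_gt_at_top[of 0] x]
      by eventually_elim (use u in \<open>auto simp: y_def\<close>)
  qed
  have "(\<lambda>n. H (y n) - H (x n)) \<longlonglongrightarrow> 0"
  proof (rule tendstoI)
    fix e :: real assume e: "e > 0"
    \<comment> \<open>\<open>V n\<close> and the dilation of \<open>W n\<close> by
      \<open>u n\<close> both lie in \<open>{1..4}\<close>, a set of measure 3, and their measures
      exceed 5/2 and 1/2, so they meet. A common point \<open>w * u n\<close> compares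
      \<open>x n\<close> and \<open>y n = u n * x n\<close> with the same value of \<open>H\<close>,
      the one at \<open>w * y n = w * u n * x n\<close>.\<close>
    define V where "V = (\<lambda>n. {c \<in> {1..4}. \<forall>m\<ge>n. \<bar>H (c * x m) - H (x m)\<bar> < e / 2})"
    define W where "W = (\<lambda>n. {c \<in> {1..2}. \<forall>m\<ge>n. \<bar>H (c * y m) - H (y m)\<bar> < e / 2})"
    have e2: "e / 2 > 0" using e by simp
    have "(\<lambda>n. measure lebesgue (V n)) \<longlonglongrightarrow> 4 - 1"
      unfolding V_def by (rule key(1)[OF x e2]) simp
    then have "eventually (\<lambda>n. measure lebesgue (V n) > 5/2) sequentially"
      by (rule order_tendstoD) simp
    moreover have "(\<lambda>n. measure lebesgue (W n)) \<longlonglongrightarrow> 2 - 1"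
      unfolding W_def by (rule key(1)[OF y e2]) simp
    then have "eventually (\<lambda>n. measure lebesgue (W n) > 1/2) sequentially"
      by (rule order_tendstoD) simp
    ultimately show "eventually (\<lambda>n. dist (H (y n) - H (x n)) 0 < e) sequentially"
    proof eventually_elim
      fix n assume n: "measure lebesgue (V n) > 5/2" "measure lebesgue (W n) > 1/2"
      have un: "1 \<le> u n" "u n \<le> 2" using u[of n] by auto
      define W' where "W' = (\<lambda>c. u n *\<^sub>R c + 0) ` W n"
      have "measure lebesgue W' = \<bar>u n\<bar> * measure lebesgue (W n)"
        unfolding W'_def using measure_lebesgue_affine[of "u n" 0 "W n"] by simp
      also have "\<dots> \<ge> 1 * measure lebesgue (W n)" using un by (intro mult_right_mono) auto
      finally have mW': "measure lebesgue W' > 1/2" using n by simp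
      have "V n \<inter> W' \<noteq> {}"
      proof
        assume disj: "V n \<inter> W' = {}"
        have sub: "V n \<union> W' \<subseteq> {1..4}"
          using un mult_mono[of "u n" 2 _ 2] mult_mono[of 1 "u n" 1] by (auto simp: V_def W_def W'_def)
        have "V n \<in> sets lebesgue" "W n \<in> sets lebesgue"
          unfolding V_def W_def by (rule key(3)[OF x e2], simp, rule key(3)[OF y e2], simp)
        moreover have "W' = (*\<^sub>R) (1 / u n) -` W n \<inter> space lebesgue"
          using un by (auto simp: W'_def image_iff intro!: bexI[of _ "_ / u n"])
        ultimately have sets: "V n \<in> sets lebesgue" "W' \<in> sets lebesgue"
          using measurable_sets[OF lebesgue_measurable_scaling[of "1 / u n"], of "W n"]
          by (simp_all only:)
        have lm4: "{1..4::real} \<in> lmeasurable" by simp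
        have lm: "V n \<in> lmeasurable" "W' \<in> lmeasurable"
          using sub by (auto intro!: fmeasurableI2[OF lm4 _ sets(1)] fmeasurableI2[OF lm4 _ sets(2)])
        have "measure lebesgue (V n) + measure lebesgue W' = measure lebesgue (V n \<union> W')"
          using measure_Un3[OF lm] unfolding disj by simp
        also have "\<dots> \<le> measure lebesgue {1..4::real}"
          by (rule measure_mono_fmeasurable[OF sub sets.Un[OF sets] lm4])
        finally show False using n mW' by simp
      qed
      then obtain w where w: "w \<in> W n" "w * u n \<in> V n" by (auto simp: W'_def mult.commute)
      then have "\<bar>H (w * y n) - H (y n)\<bar> < e / 2" "\<bar>H (w * u n * x n) - H (x n)\<bar> < e / 2"
        by (auto simp: V_def W_def)
      moreover have "w * y n = w * u n * x n" by (simp add: y_def)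
      ultimately show "dist (H (y n) - H (x n)) 0 < e"
        unfolding dist_real_def by (simp only:)
    qed
  qed
  then have "(\<lambda>n. exp (H (y n) - H (x n))) \<longlonglongrightarrow> exp 0" by (intro tendsto_intros)
  moreover have "eventually (\<lambda>n. exp (H (y n) - H (x n)) = L (u n * x n) / L (x n)) sequentially"
    using eventually_compose_filterlim[OF eventually_gt_at_top[of 0] x]
      eventually_compose_filterlim[OF eventually_gt_at_top[of 0] y]
  proof eventually_elim
    case (elim n)
    then show ?case
      using Heq[OF elim(1)] Heq[OF elim(2)] Lpos[OF elim(1)] Lpos[OF elim(2)]
      by (simp only: exp_diff exp_ln) (simp only: y_def)
  qed
  ultimately show ?thesis by (simp add: tendsto_cong)
qed

text \<open>The uniform convergence theorem on \<open>{1..2}\<close>: if it failed for some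
  \<open>e\<close>, offending pairs \<open>t n\<close>, \<open>u n\<close> with \<open>t n\<close>
  tending to infinity would contradict the sequential version, which allows the factor
  \<open>u n\<close> to vary arbitrarily.\<close>

theorem slowly_varying_uniform:
  assumes L: "slowly_varying L" and e: "e > 0"
  obtains T where "T > 0" "\<And>t u. t \<ge> T \<Longrightarrow> u \<in> {1..2} \<Longrightarrow> \<bar>L (u * t) / L t - 1\<bar> < e"
proof -
  have "\<exists>T>0. \<forall>t\<ge>T. \<forall>u\<in>{1..2}. \<bar>L (u * t) / L t - 1\<bar> < e"
  proof (rule ccontr)
    assume neg: "\<not> ?thesis"
    have "\<exists>t u. t \<ge> real n + 1 \<and> u \<in> {1..2} \<and> \<not> \<bar>L (u * t) / L t - 1\<bar> < e" for n
      using neg by (metis add_pos_nonneg add.commute of_nat_0_le_iff zero_less_one)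
    then obtain t u where tu: "\<And>n. t n \<ge> real n + 1" "\<And>n. u n \<in> {1..2}"
      "\<And>n. \<not> \<bar>L (u n * t n) / L (t n) - 1\<bar> < e" by metis
    have "filterlim t at_top sequentially"
      by (rule filterlim_at_top_mono[OF filterlim_real_sequentially])
         (auto intro!: always_eventually order.trans[OF _ tu(1)])
    from tendstoD[OF slowly_varying_sequence[where u = u, OF L this tu(2)] e] show False
      using tu(3) by (auto simp: dist_real_def dest: eventually_happens)
  qed
  then show thesis using that by blast
qed

text \<open>The sharp asymptotics use the regular variation of \<open>K\<close> only through these
  three facts: eventual positivity, neighbouring values of ratio near 1, and control of
  \<open>K\<close> across a factor of two in the index.\<close>

lemma regularly_varying_step:
  assumes L: "slowly_varying L" and K: "K \<sim>[at_top] (\<lambda>n. L (real n) / real n powr \<gamma>)"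
  shows "eventually (\<lambda>n. K n > 0) at_top"
    and "(\<lambda>n. K (Suc n) / K n) \<longlonglongrightarrow> 1"
    and "\<gamma> \<ge> 0 \<Longrightarrow> \<exists>C>0. \<exists>N. \<forall>n\<ge>N. \<forall>m. n \<le> m \<longrightarrow> m \<le> 2 * n \<longrightarrow> K n \<le> C * K m"
proof -
  have Lpos: "L t > 0" if "t > 0" for t using L that by (auto simp: slowly_varying_def)
  define f where "f = (\<lambda>n. L (real n) / real n powr \<gamma>)"
  have fpos: "f n > 0" if "n > 0" for n using Lpos that by (auto simp: f_def)
  have fne: "eventually (\<lambda>n. K n \<noteq> 0 \<or> f n \<noteq> 0) at_top"
    using eventually_gt_at_top[of 0]
  proof eventually_elim
    case (elim n)
    then show ?case using fpos[of n] by simp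
  qed
  have ratio: "(\<lambda>n. K n / f n) \<longlonglongrightarrow> 1"
    using K[folded f_def] fne by (rule asymp_equivD_strong)
  have ev: "eventually (\<lambda>n. K n / f n > 1/2) at_top" "eventually (\<lambda>n. K n / f n < 2) at_top"
    by (rule order_tendstoD[OF ratio], simp)+
  show Kpos: "eventually (\<lambda>n. K n > 0) at_top"
    using ev(1) eventually_gt_at_top[of 0]
  proof eventually_elim
    case (elim n)
    then have "K n / f n > 0" by linarith
    then show "K n > 0" using fpos[of n] elim by (simp add: zero_less_divide_iff)
  qed
  \<comment> \<open>The quotient \<open>(n + 2) / (n + 1)\<close> lies in \<open>{1..2}\<close> for
    every \<open>n\<close>, including 0, as the sequential lemma demands;
    \<open>LIMSEQ_imp_Suc\<close> undoes the shift.\<close>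
  have "(\<lambda>n. L (((real n + 2) / (real n + 1)) * (real n + 1)) / L (real n + 1)) \<longlonglongrightarrow> 1"
    by (rule slowly_varying_sequence[OF L])
       (real_asymp, simp add: field_simps)
  moreover have "((real n + 2) / (real n + 1)) * (real n + 1) = real (Suc n) + 1" for n
    by (simp add: field_simps)
  moreover have "real (Suc n) + 1 = real (Suc (Suc n))" "real n + 1 = real (Suc n)" for n by simp_all
  ultimately have "(\<lambda>n. L (real (Suc (Suc n))) / L (real (Suc n))) \<longlonglongrightarrow> 1" by (simp only:)
  then have L1: "(\<lambda>n. L (real (Suc n)) / L (real n)) \<longlonglongrightarrow> 1"
    by (rule LIMSEQ_imp_Suc)
  have "(\<lambda>n. real n / real (Suc n)) \<longlonglongrightarrow> 1" by (rule LIMSEQ_n_over_Suc_n)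
  then have p1: "(\<lambda>n. (real n / real (Suc n)) powr \<gamma>) \<longlonglongrightarrow> 1 powr \<gamma>"
    by (intro tendsto_intros) auto
  have f1: "(\<lambda>n. L (real (Suc n)) / L (real n) * (real n / real (Suc n)) powr \<gamma>) \<longlonglongrightarrow> 1"
    using tendsto_mult[OF L1 p1] by simp
  have r1: "(\<lambda>n. K (Suc n) / f (Suc n) / (K n / f n)) \<longlonglongrightarrow> 1"
    using tendsto_divide[OF LIMSEQ_Suc[OF ratio] ratio] by simp
  have "(\<lambda>n. K (Suc n) / f (Suc n) / (K n / f n) * (L (real (Suc n)) / L (real n) * (real n / real (Suc n)) powr \<gamma>)) \<longlonglongrightarrow> 1"
    using tendsto_mult[OF r1 f1] by simp
  moreover have "eventually (\<lambda>n. K (Suc n) / f (Suc n) / (K n / f n) * (L (real (Suc n)) / L (real n) * (real n / real (Suc n)) powr \<gamma>) = K (Suc n) / K n) sequentially"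
    using Kpos eventually_gt_at_top[of 0]
  proof eventually_elim
    case (elim n)
    have "L (real (Suc n)) / L (real n) * (real n / real (Suc n)) powr \<gamma> = f (Suc n) / f n"
      using elim by (simp add: f_def powr_divide field_simps)
    then show ?case
      using elim fpos[of n] fpos[of "Suc n"] by (simp only:) (simp add: field_simps)
  qed
  ultimately show "(\<lambda>n. K (Suc n) / K n) \<longlonglongrightarrow> 1" by (simp add: tendsto_cong)
  assume \<gamma>: "\<gamma> \<ge> 0"
  obtain T where T: "T > 0" "\<And>t u. t \<ge> T \<Longrightarrow> u \<in> {1..2} \<Longrightarrow> \<bar>L (u * t) / L t - 1\<bar> < 1/2"
    using slowly_varying_uniform[OF L, of "1/2"] by auto
  have "eventually (\<lambda>n. real n \<ge> T \<and> n > 0 \<and> K n / f n > 1/2 \<and> K n / f n < 2) at_top"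
    using ev eventually_gt_at_top[of 0] eventually_compose_filterlim[OF eventually_ge_at_top[of T] filterlim_real_sequentially]
    by eventually_elim auto
  then obtain N where N: "\<And>n. n \<ge> N \<Longrightarrow> real n \<ge> T \<and> n > 0 \<and> K n / f n > 1/2 \<and> K n / f n < 2"
    by (auto simp: eventually_sequentially)
  \<comment> \<open>The 8 collects three factors 2: from \<open>K n\<close> to its asymptotic form,
    from \<open>L n\<close> to \<open>L m\<close>, and from the asymptotic form back to
    \<open>K m\<close>.\<close>
  have "K n \<le> 8 * 2 powr \<gamma> * K m" if n: "n \<ge> N" "n \<le> m" "m \<le> 2 * n" for n m
  proof -
    note Nn = N[OF n(1)]
    have Nm: "m > 0" "K m / f m > 1/2" using N[of m] n by auto
    have eqm: "real m / real n * real n = real m" using Nn by simp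
    have "\<bar>L (real m / real n * real n) / L (real n) - 1\<bar> < 1/2"
      using Nn n by (intro T) (auto simp: field_simps)
    then have "L (real m) / L (real n) > 1/2" unfolding eqm by linarith
    then have Lm: "L (real n) \<le> 2 * L (real m)" using Lpos[of "real n"] Nn by (auto simp: field_simps)
    have "real m powr \<gamma> \<le> (2 * real n) powr \<gamma>" using n \<gamma> by (intro powr_mono2) auto
    then have pm: "real m powr \<gamma> \<le> 2 powr \<gamma> * real n powr \<gamma>" by (simp add: powr_mult)
    have "K n \<le> 2 * f n" using Nn fpos[of n] by (auto simp: field_simps)
    also have "f n \<le> 2 * L (real m) / real n powr \<gamma>"
      unfolding f_def using Lm by (intro divide_right_mono) auto
    also have "\<dots> \<le> 2 * 2 powr \<gamma> * f m"
    proof -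
      have "L (real m) * real m powr \<gamma> \<le> L (real m) * (2 powr \<gamma> * real n powr \<gamma>)"
        using pm Lpos[of "real m"] Nm by (intro mult_left_mono) auto
      then show ?thesis using Nn Nm by (simp add: f_def field_simps)
    qed
    also have "f m \<le> 2 * K m" using Nm fpos[of m] by (auto simp: field_simps)
    finally show ?thesis by simp
  qed
  then show "\<exists>C>0. \<exists>N. \<forall>n\<ge>N. \<forall>m. n \<le> m \<longrightarrow> m \<le> 2 * n \<longrightarrow> K n \<le> C * K m"
    by (intro exI[of _ "8 * 2 powr \<gamma>"] exI[of _ N]) auto
qed

text \<open>Rounding multiplies \<open>t\<close> by a factor that changes with \<open>t\<close>, so
  slow variation for fixed factors does not apply. Uniform convergence at the rounded point does,
  since \<open>t\<close> divided by its integer part lies in \<open>{1..2}\<close> for large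
  \<open>t\<close>. Real arguments are wanted because the tail is later evaluated at
  \<open>x / t\<close> with real \<open>x\<close> and \<open>t\<close> tending to 0.\<close>

lemma regularly_varying_floor:
  assumes L: "slowly_varying L" and \<alpha>: "\<alpha> > 0"
    and G: "G \<sim>[at_top] (\<lambda>N. L (real N) / (\<alpha> * real N powr \<alpha>))"
  shows "eventually (\<lambda>t. G (nat \<lfloor>t::real\<rfloor>) > 0) at_top"
    and "c > 0 \<Longrightarrow> ((\<lambda>t. G (nat \<lfloor>c * t\<rfloor>) / G (nat \<lfloor>t\<rfloor>)) \<longlongrightarrow> c powr - \<alpha>) at_top"
proof -
  have Lpos: "L t > 0" if "t > 0" for t using L that by (auto simp: slowly_varying_def)
  define f where "f = (\<lambda>t::real. L t / (\<alpha> * t powr \<alpha>))"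
  have G: "G \<sim>[at_top] (\<lambda>N. f (real N))" using G by (simp add: f_def)
  have fpos: "f t > 0" if "t > 0" for t using Lpos that \<alpha> by (auto simp: f_def)
  have fl: "filterlim (\<lambda>t::real. nat \<lfloor>t\<rfloor>) at_top at_top"
    by (intro filterlim_compose[OF filterlim_nat_sequentially] filterlim_floor_sequentially)
  have fne: "eventually (\<lambda>n. G n \<noteq> 0 \<or> f (real n) \<noteq> 0) at_top"
    using eventually_gt_at_top[of 0]
  proof eventually_elim
    case (elim n)
    then show ?case using fpos[of "real n"] by simp
  qed
  have ratio: "(\<lambda>n. G n / f (real n)) \<longlonglongrightarrow> 1"
    using G fne by (rule asymp_equivD_strong)
  have ev: "eventually (\<lambda>n. G n / f (real n) > 0) at_top"
    by (rule order_tendstoD[OF ratio]) simp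
  have "eventually (\<lambda>n. G n > 0) at_top"
    using ev eventually_gt_at_top[of 0]
  proof eventually_elim
    case (elim n)
    then show "G n > 0" using fpos[of "real n"] by (simp add: zero_less_divide_iff)
  qed
  then show Gpos: "eventually (\<lambda>t. G (nat \<lfloor>t::real\<rfloor>) > 0) at_top"
    by (rule eventually_compose_filterlim[OF _ fl])
  have fr: "((\<lambda>t. f (real (nat \<lfloor>t\<rfloor>)) / f t) \<longlongrightarrow> 1) at_top"
  proof -
    have "((\<lambda>t. real (nat \<lfloor>t\<rfloor>) / t) \<longlongrightarrow> 1) at_top"
    proof (rule tendsto_sandwich)
      show "((\<lambda>t::real. 1 - 1 / t) \<longlongrightarrow> 1) at_top" by real_asymp
      show "eventually (\<lambda>t::real. 1 - 1 / t \<le> real (nat \<lfloor>t\<rfloor>) / t) at_top"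
        using eventually_gt_at_top[of 1]
      proof eventually_elim
        case (elim t)
        have "(t - 1) / t \<le> real (nat \<lfloor>t\<rfloor>) / t" using elim by (intro divide_right_mono) linarith+
        then show ?case using elim by (simp add: diff_divide_distrib)
      qed
      show "eventually (\<lambda>t::real. real (nat \<lfloor>t\<rfloor>) / t \<le> 1) at_top"
        using eventually_gt_at_top[of 1] by eventually_elim (simp add: field_simps)
    qed auto
    then have "((\<lambda>t. (real (nat \<lfloor>t\<rfloor>) / t) powr - \<alpha>) \<longlongrightarrow> 1 powr - \<alpha>) at_top"
      by (intro tendsto_intros) auto
    moreover have "((\<lambda>t. L t / L (real (nat \<lfloor>t\<rfloor>))) \<longlongrightarrow> 1) at_top"
    proof (rule tendstoI)
      fix e :: real assume "e > 0"
      then obtain T where T: "T > 0" "\<And>t u. t \<ge> T \<Longrightarrow> u \<in> {1..2} \<Longrightarrow> \<bar>L (u * t) / L t - 1\<bar> < e"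
        using slowly_varying_uniform[OF L] by metis
      show "eventually (\<lambda>t. dist (L t / L (real (nat \<lfloor>t\<rfloor>))) 1 < e) at_top"
        using eventually_ge_at_top[of "T + 2"]
      proof eventually_elim
        case (elim t)
        have b: "real (nat \<lfloor>t\<rfloor>) \<ge> T" "real (nat \<lfloor>t\<rfloor>) > 0" "real (nat \<lfloor>t\<rfloor>) \<le> t" "t \<le> 2 * real (nat \<lfloor>t\<rfloor>)"
          using elim T(1) by linarith+
        then have "t / real (nat \<lfloor>t\<rfloor>) \<in> {1..2}" by (simp add: field_simps)
        from T(2)[OF b(1) this] b show ?case by (simp add: dist_real_def)
      qed
    qed
    then have "((\<lambda>t. inverse (L t / L (real (nat \<lfloor>t\<rfloor>)))) \<longlongrightarrow> inverse 1) at_top"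
      by (intro tendsto_intros) auto
    ultimately have "((\<lambda>t. inverse (L t / L (real (nat \<lfloor>t\<rfloor>))) * (real (nat \<lfloor>t\<rfloor>) / t) powr - \<alpha>) \<longlongrightarrow> inverse 1 * 1 powr - \<alpha>) at_top"
      by (intro tendsto_mult)
    moreover have "eventually (\<lambda>t. inverse (L t / L (real (nat \<lfloor>t\<rfloor>))) * (real (nat \<lfloor>t\<rfloor>) / t) powr - \<alpha> = f (real (nat \<lfloor>t\<rfloor>)) / f t) at_top"
      using eventually_ge_at_top[of 1]
    proof eventually_elim
      case (elim t)
      then have "real (nat \<lfloor>t\<rfloor>) > 0" by linarith
      then show ?case using elim \<alpha> by (simp add: f_def powr_divide powr_minus field_simps)
    qed
    ultimately show ?thesis by (simp add: tendsto_cong)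
  qed
  define \<rho> where "\<rho> = (\<lambda>t. G (nat \<lfloor>t\<rfloor>) / f t)"
  have \<rho>: "(\<rho> \<longlongrightarrow> 1) at_top"
  proof -
    have "((\<lambda>t. G (nat \<lfloor>t\<rfloor>) / f (real (nat \<lfloor>t\<rfloor>)) * (f (real (nat \<lfloor>t\<rfloor>)) / f t)) \<longlongrightarrow> 1 * 1) at_top"
      by (intro tendsto_mult fr filterlim_compose[OF ratio fl])
    moreover have "eventually (\<lambda>t. G (nat \<lfloor>t\<rfloor>) / f (real (nat \<lfloor>t\<rfloor>)) * (f (real (nat \<lfloor>t\<rfloor>)) / f t) = \<rho> t) at_top"
      using eventually_ge_at_top[of 1]
    proof eventually_elim
      case (elim t)
      then have "real (nat \<lfloor>t\<rfloor>) > 0" by linarith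
      from fpos[OF this] show ?case by (simp add: \<rho>_def)
    qed
    ultimately show ?thesis by (simp add: tendsto_cong)
  qed
  assume c: "c > 0"
  have ct: "filterlim (\<lambda>t. c * t) at_top at_top"
    by (rule filterlim_tendsto_pos_mult_at_top[OF tendsto_const c filterlim_ident])
  have "((\<lambda>t. \<rho> (c * t) / \<rho> t * (L (c * t) / L t) * c powr - \<alpha>) \<longlongrightarrow> 1 / 1 * 1 * c powr - \<alpha>) at_top"
    using L c by (intro tendsto_intros filterlim_compose[OF \<rho> ct] \<rho>) (auto simp: slowly_varying_def)
  moreover have "eventually (\<lambda>t. \<rho> (c * t) / \<rho> t * (L (c * t) / L t) * c powr - \<alpha> = G (nat \<lfloor>c * t\<rfloor>) / G (nat \<lfloor>t\<rfloor>)) at_top"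
    using Gpos eventually_gt_at_top[of 0]
  proof eventually_elim
    case (elim t)
    have ft: "f t > 0" "f (c * t) > 0" using elim c by (auto intro!: fpos)
    have "L (c * t) / L t * c powr - \<alpha> = f (c * t) / f t"
      using elim c \<alpha> by (simp add: f_def powr_mult powr_minus field_simps)
    then have "\<rho> (c * t) / \<rho> t * (L (c * t) / L t) * c powr - \<alpha> = \<rho> (c * t) / \<rho> t * (f (c * t) / f t)"
      by (simp only: mult.assoc)
    also have "\<dots> = G (nat \<lfloor>c * t\<rfloor>) / G (nat \<lfloor>t\<rfloor>)"
      using ft elim by (simp add: \<rho>_def field_simps)
    finally show ?case .
  qed
  ultimately show "((\<lambda>t. G (nat \<lfloor>c * t\<rfloor>) / G (nat \<lfloor>t\<rfloor>)) \<longlongrightarrow> c powr - \<alpha>) at_top"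
    by (simp add: tendsto_cong)
qed

section \<open>Wiener's lemma for power series\<close>

lemma norm_fps_mult_sums:
  fixes f g :: "complex fps"
  assumes "summable (\<lambda>n. norm (fps_nth f n))" "summable (\<lambda>n. norm (fps_nth g n))"
  shows "summable (\<lambda>n. norm (fps_nth (f * g) n))"
    and "(\<Sum>n. norm (fps_nth (f * g) n)) \<le> (\<Sum>n. norm (fps_nth f n)) * (\<Sum>n. norm (fps_nth g n))"
proof -
  let ?a = "\<lambda>n. norm (fps_nth f n)" and ?b = "\<lambda>n. norm (fps_nth g n)"
  have s: "(\<lambda>k. \<Sum>i\<le>k. ?a i * ?b (k - i)) sums ((\<Sum>k. ?a k) * (\<Sum>k. ?b k))"
    using assms by (intro Cauchy_product_sums) auto
  have le: "norm (fps_nth (f * g) n) \<le> (\<Sum>i\<le>n. ?a i * ?b (n - i))" for n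
    unfolding fps_mult_nth atLeast0AtMost
    by (rule order.trans[OF norm_sum]) (simp add: norm_mult)
  show sm: "summable (\<lambda>n. norm (fps_nth (f * g) n))"
    by (rule summable_comparison_test'[OF sums_summable[OF s], of 0]) (use le in auto)
  show "(\<Sum>n. norm (fps_nth (f * g) n)) \<le> (\<Sum>n. norm (fps_nth f n)) * (\<Sum>n. norm (fps_nth g n))"
    using suminf_le[OF le sm sums_summable[OF s]] sums_unique[OF s] by simp
qed

lemma norm_fps_power_sums:
  fixes f :: "complex fps"
  assumes "summable (\<lambda>n. norm (fps_nth f n))"
  shows "summable (\<lambda>n. norm (fps_nth (f ^ k) n)) \<and>
         (\<Sum>n. norm (fps_nth (f ^ k) n)) \<le> (\<Sum>n. norm (fps_nth f n)) ^ k"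
proof (induction k)
  case 0
  have "(\<lambda>n. norm (fps_nth (1 :: complex fps) n)) sums 1"
    using sums_single[of 0 "\<lambda>n. 1 :: real"] by (simp add: if_distrib cong: if_cong)
  then show ?case by (auto simp: sums_iff)
next
  case (Suc k)
  then have "summable (\<lambda>n. norm (fps_nth (f ^ Suc k) n))"
    by (auto intro!: norm_fps_mult_sums assms)
  moreover have "(\<Sum>n. norm (fps_nth (f ^ Suc k) n)) \<le>
      (\<Sum>n. norm (fps_nth f n)) * (\<Sum>n. norm (fps_nth (f ^ k) n))"
    using Suc by (auto intro!: norm_fps_mult_sums assms)
  moreover have "\<dots> \<le> (\<Sum>n. norm (fps_nth f n)) ^ Suc k"
    using Suc by (auto intro!: mult_left_mono suminf_nonneg assms)
  ultimately show ?case by linarith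
qed

lemma norm_fps_add_summable:
  fixes f g :: "complex fps"
  assumes "summable (\<lambda>n. norm (fps_nth f n))" "summable (\<lambda>n. norm (fps_nth g n))"
  shows "summable (\<lambda>n. norm (fps_nth (f + g) n))"
  by (rule summable_comparison_test'[OF summable_add[OF assms], of 0]) (auto intro: norm_triangle_ineq)

lemma norm_fps_sum_summable:
  fixes f :: "'i \<Rightarrow> complex fps"
  assumes "\<And>i. i \<in> A \<Longrightarrow> summable (\<lambda>n. norm (fps_nth (f i) n))"
  shows "summable (\<lambda>n. norm (fps_nth (sum f A) n))"
  using assms
  by (induction A rule: infinite_finite_induct) (auto intro!: norm_fps_add_summable simp del: fps_add_nth)

lemma abs_summable_fps_eval:
  fixes f :: "complex fps"
  assumes "summable (\<lambda>n. norm (fps_nth f n))" "norm z \<le> 1"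
  shows "summable (\<lambda>n. norm (fps_nth f n * z ^ n))"
  by (rule summable_comparison_test'[OF assms(1), of 0])
     (use assms(2) in \<open>auto simp: norm_mult norm_power power_le_one intro!: mult_left_le\<close>)

lemma eval_fps_mult_closed_disc:
  fixes f g :: "complex fps"
  assumes "summable (\<lambda>n. norm (fps_nth f n))" "summable (\<lambda>n. norm (fps_nth g n))" "norm z \<le> 1"
  shows "eval_fps (f * g) z = eval_fps f z * eval_fps g z"
proof -
  have "fps_nth (f * g) n * z ^ n = (\<Sum>i\<le>n. (fps_nth f i * z ^ i) * (fps_nth g (n - i) * z ^ (n - i)))" for n
  proof -
    have "(\<Sum>i\<le>n. (fps_nth f i * z ^ i) * (fps_nth g (n - i) * z ^ (n - i))) =
          (\<Sum>i\<le>n. fps_nth f i * fps_nth g (n - i) * z ^ n)"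
      by (intro sum.cong) (auto simp: algebra_simps simp flip: power_add)
    then show ?thesis by (simp add: fps_mult_nth atLeast0AtMost sum_distrib_right)
  qed
  then show ?thesis unfolding eval_fps_def
    by (simp add: Cauchy_product abs_summable_fps_eval assms)
qed

lemma continuous_on_eval_fps_closed_disc:
  fixes f :: "complex fps"
  assumes "summable (\<lambda>n. norm (fps_nth f n))"
  shows "continuous_on (cball 0 1) (eval_fps f)"
proof -
  have "uniform_limit (cball 0 1) (\<lambda>n z. \<Sum>i<n. fps_nth f i * z ^ i) (eval_fps f) sequentially"
    unfolding eval_fps_def
    by (rule Weierstrass_m_test[OF _ assms])
       (auto simp: norm_mult norm_power power_le_one intro!: mult_left_le)
  then show ?thesis
    by (rule uniform_limit_theorem[rotated]) (auto intro!: always_eventually continuous_intros)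
qed

lemma norm_eval_fps_closed_disc_le:
  fixes f :: "complex fps"
  assumes "summable (\<lambda>n. norm (fps_nth f n))" "norm z \<le> 1"
  shows "norm (eval_fps f z) \<le> (\<Sum>n. norm (fps_nth f n))"
proof -
  have "norm (eval_fps f z) \<le> (\<Sum>n. norm (fps_nth f n * z ^ n))"
    unfolding eval_fps_def by (rule summable_norm[OF abs_summable_fps_eval[OF assms]])
  also have "\<dots> \<le> (\<Sum>n. norm (fps_nth f n))"
    using assms(2)
    by (intro suminf_le abs_summable_fps_eval assms)
       (auto simp: norm_mult norm_power power_le_one intro!: mult_left_le)
  finally show ?thesis .
qed

section \<open>Slightly larger discs, Cauchy estimates and inverses\<close>

lemma open_superset_cball_enlarge:
  fixes U :: "complex set"
  assumes "open U" "cball 0 1 \<subseteq> U"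
  obtains R where "R > 1" "cball 0 R \<subseteq> U"
proof -
  obtain e where e: "e > 0" "{x. infdist x (cball 0 1) \<le> e} \<subseteq> U"
    using compact_in_open_separated[of "cball 0 1 :: complex set" U] assms by auto
  show thesis
  proof
    show "1 + e > 1" using e by simp
    show "cball 0 (1 + e) \<subseteq> U"
    proof
      fix z :: complex assume "z \<in> cball 0 (1 + e)"
      then have z: "norm z \<le> 1 + e" by simp
      show "z \<in> U"
      proof (cases "norm z \<le> 1")
        case False
        then have nz: "z \<noteq> 0" by auto
        have "z - sgn z = of_real (norm z - 1) * sgn z"
          using nz by (auto simp: sgn_eq field_simps)
        then have "norm (z - sgn z) = \<bar>norm z - 1\<bar>"
          using nz by (simp add: norm_mult norm_sgn) (metis norm_of_real of_real_1 of_real_diff)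
        then have "dist z (sgn z) \<le> e" using z e False by (simp add: dist_norm)
        moreover have "infdist z (cball 0 1) \<le> dist z (sgn z)"
          by (rule infdist_le) (simp add: norm_sgn)
        ultimately show ?thesis using e(2) by auto
      qed (use assms in auto)
    qed
  qed
qed

lemma norm_fps_nth_le_Cauchy:
  fixes f :: "complex fps"
  assumes "0 < R" "ereal R < fps_conv_radius f" "\<And>z. norm z = R \<Longrightarrow> norm (eval_fps f z) \<le> B"
  shows "norm (fps_nth f n) \<le> B / R ^ n"
proof -
  have "norm ((deriv ^^ n) (eval_fps f) 0) \<le> fact n * B / R ^ n"
  proof (rule Cauchy_inequality)
    have *: "ereal (norm z) < fps_conv_radius f" if "norm z \<le> R" for z :: complex
      using that assms(2) by (meson ereal_less_eq(3) order_le_less_trans)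
    show "eval_fps f holomorphic_on ball 0 R"
      by (rule holomorphic_on_eval_fps) (auto simp: in_eball_iff intro!: *)
    show "continuous_on (cball 0 R) (eval_fps f)"
      by (rule continuous_on_subset[OF continuous_on_eval_fps]) (auto simp: in_eball_iff intro!: *)
  qed (use assms in auto)
  moreover have "fps_nth f n = (deriv ^^ n) (eval_fps f) 0 / fact n"
  proof -
    have "0 < fps_conv_radius f" using assms by (metis ereal_less(2) less_trans)
    then have "eval_fps f has_fps_expansion f" by (simp add: has_fps_expansion_def)
    then show ?thesis by (rule fps_nth_fps_expansion)
  qed
  ultimately show ?thesis by (simp add: norm_divide pos_divide_le_eq mult_ac)
qed

lemma fps_conv_radius_inverse_ge:
  fixes f :: "complex fps"
  assumes "0 < r" "r \<le> fps_conv_radius f" "\<And>z. ereal (norm z) < r \<Longrightarrow> eval_fps f z \<noteq> 0"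
  shows "fps_conv_radius (inverse f) \<ge> r"
proof (rule holomorphic_on_imp_fps_conv_radius_ge)
  have "fps_nth f 0 \<noteq> 0" using assms(3)[of 0] assms(1) by (simp add: eval_fps_at_0 zero_ereal_def)
  then show "(\<lambda>z. inverse (eval_fps f z)) has_fps_expansion inverse f"
    using assms by (intro has_fps_expansion_inverse) (auto simp: has_fps_expansion_def)
  show "(\<lambda>z. inverse (eval_fps f z)) holomorphic_on eball 0 r"
    using assms by (intro holomorphic_intros) (auto simp: in_eball_iff)
qed

text \<open>A self-bounding inequality takes the place of the geometric series:
  \<open>g = 1 + t * g\<close> gives \<open>G N \<le> 1 + G N / 2\<close> for the partial sums of
  the norms, and since \<open>G N\<close> is a finite number, \<open>G N \<le> 2\<close>.\<close>

lemma summable_norm_inverse_one_minus: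
  fixes t :: "complex fps"
  assumes sm: "summable (\<lambda>n. norm (fps_nth t n))" and le: "(\<Sum>n. norm (fps_nth t n)) \<le> 1/2"
  shows "summable (\<lambda>n. norm (fps_nth (inverse (1 - t)) n))" and "fps_nth (1 - t) 0 \<noteq> 0"
proof -
  have "norm (fps_nth t 0) \<le> 1/2"
    using sum_le_suminf[OF sm, of "{0}"] le by auto
  then show nz: "fps_nth (1 - t) 0 \<noteq> 0" by auto
  define g where "g = inverse (1 - t)"
  have "(1 - t) * g = 1" unfolding g_def using inverse_mult_eq_1'[OF nz] .
  then have g: "g = 1 + t * g" by (simp add: algebra_simps)
  define G where "G = (\<lambda>N. \<Sum>n<N. norm (fps_nth g n))"
  have mono: "G i \<le> G j" if "i \<le> j" for i j
    unfolding G_def using that by (intro sum_mono2) auto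
  have rec: "G N \<le> 1 + 1/2 * G N" for N
  proof -
    have "G N \<le> (\<Sum>n<N. norm (fps_nth (1 :: complex fps) n) + norm (fps_nth (t * g) n))"
      unfolding G_def by (subst g) (auto intro!: sum_mono norm_triangle_ineq)
    also have "\<dots> = (\<Sum>n<N. norm (fps_nth (1 :: complex fps) n)) + (\<Sum>n<N. norm (fps_nth (t * g) n))"
      by (simp add: sum.distrib)
    also have "(\<Sum>n<N. norm (fps_nth (1 :: complex fps) n)) \<le> 1"
      by (induction N) (auto split: if_splits)
    also have "(\<Sum>n<N. norm (fps_nth (t * g) n)) \<le> (\<Sum>n<N. \<Sum>i\<le>n. norm (fps_nth t i) * norm (fps_nth g (n - i)))"
      unfolding fps_mult_nth atLeast0AtMost
      by (intro sum_mono order.trans[OF norm_sum]) (simp add: norm_mult)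
    also have "\<dots> = (\<Sum>i<N. \<Sum>n\<in>{i..<N}. norm (fps_nth t i) * norm (fps_nth g (n - i)))"
      by (simp add: sum.Sigma) (rule sum.reindex_bij_witness[of _ "\<lambda>(i,n). (n,i)" "\<lambda>(i,n). (n,i)"]; auto)
    also have "\<dots> = (\<Sum>i<N. norm (fps_nth t i) * G (N - i))"
      unfolding G_def sum_distrib_left
      by (intro sum.cong refl sum.reindex_bij_witness[of _ "\<lambda>n. n + i" "\<lambda>n. n - i" for i]) auto
    also have "\<dots> \<le> (\<Sum>i<N. norm (fps_nth t i) * G N)"
      by (intro sum_mono mult_left_mono mono) auto
    also have "\<dots> = (\<Sum>i<N. norm (fps_nth t i)) * G N" by (simp add: sum_distrib_right)
    also have "\<dots> \<le> 1/2 * G N"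
      using order.trans[OF sum_le_suminf[OF sm, of "{..<N}"] le]
      by (intro mult_right_mono) (auto simp: G_def intro!: sum_nonneg)
    finally show ?thesis by simp
  qed
  have "G N \<le> 2" for N using rec[of N] by linarith
  then show "summable (\<lambda>n. norm (fps_nth (inverse (1 - t)) n))"
    unfolding g_def[symmetric] by (intro summableI_nonneg_bounded[of _ 2]) (auto simp: G_def)
qed

text \<open>In the spirit of Newman's proof of Wiener's theorem: \<open>f = P + r\<close> with a
  polynomial truncation \<open>P\<close> and a remainder small in the norm given by the sum of
  absolute coefficients. The reciprocal of \<open>P\<close> is holomorphic beyond the closed disc,
  so Cauchy estimates bound the norms of all its powers by powers of a supremum, up to one constant.
  Writing \<open>f = P * (1 - S)\<close>, the norm of \<open>S ^ k\<close> decays geometrically even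
  when that of \<open>S\<close> exceeds 1.\<close>

theorem Wiener_fps_inverse:
  fixes f :: "complex fps"
  assumes sf: "summable (\<lambda>n. norm (fps_nth f n))"
      and nz: "\<And>z. norm z \<le> 1 \<Longrightarrow> eval_fps f z \<noteq> 0"
  shows "summable (\<lambda>n. norm (fps_nth (inverse f) n))"
proof -
  obtain z0 where z0: "z0 \<in> cball 0 1" "\<And>z. z \<in> cball 0 1 \<Longrightarrow> norm (eval_fps f z0) \<le> norm (eval_fps f z)"
    using continuous_attains_inf[of "cball 0 1" "\<lambda>z. norm (eval_fps f z)"]
      continuous_on_norm[OF continuous_on_eval_fps_closed_disc[OF sf]] by auto
  define m where "m = norm (eval_fps f z0)"
  have m0: "m > 0" using nz z0(1) by (auto simp: m_def)
  have m: "m \<le> norm (eval_fps f z)" if "norm z \<le> 1" for z using z0(2)[of z] that by (auto simp: m_def)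
  \<comment> \<open>A remainder of norm at most \<open>m / 4\<close> leaves the modulus of
    \<open>P\<close> above \<open>m / 2\<close> on the disc, and \<open>m / 4 * (2 / m)\<close> is
    the ratio 1/2 in \<open>S_le\<close>.\<close>
  obtain N where N: "norm (\<Sum>i. norm (fps_nth f (i + N))) < m / 4"
    using suminf_exist_split[OF _ sf, of "m/4"] m0 by auto
  define P where "P = fps_cutoff N f"
  define r where "r = f - P"
  have r_nth: "fps_nth r n = (if n < N then 0 else fps_nth f n)" for n by (simp add: r_def P_def)
  have sr: "summable (\<lambda>n. norm (fps_nth r n))"
    by (rule summable_comparison_test'[OF sf, of 0]) (auto simp: r_nth)
  have "(\<Sum>n. norm (fps_nth r n)) = (\<Sum>i. norm (fps_nth f (i + N)))"
    using suminf_split_initial_segment[OF sr, of N] by (simp add: r_nth)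
  then have r_le: "(\<Sum>n. norm (fps_nth r n)) \<le> m / 4" using N by simp
  have sP: "summable (\<lambda>n. norm (fps_nth P n))"
    by (rule summable_comparison_test'[OF sf, of 0]) (auto simp: P_def)
  have "fps_conv_radius P = conv_radius (\<lambda>_. 0 :: complex)"
    unfolding fps_conv_radius_def
    by (intro conv_radius_cong eventually_mono[OF eventually_ge_at_top[of N]]) (auto simp: P_def)
  then have Prad: "fps_conv_radius P = \<infinity>" by simp
  have contP: "continuous_on UNIV (eval_fps P)"
    using continuous_on_eval_fps[of P] by (simp add: Prad)
  have Pm: "norm (eval_fps P z) > m / 2" if "norm z \<le> 1" for z
  proof -
    have "eval_fps f z = eval_fps P z + eval_fps r z"
      unfolding eval_fps_def r_def
      using summable_norm_cancel[OF abs_summable_fps_eval[OF sP that]]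
        summable_norm_cancel[OF abs_summable_fps_eval[OF sr that]]
      by (subst suminf_add) (auto simp: r_def algebra_simps)
    moreover have "norm (eval_fps r z) \<le> m / 4"
      using norm_eval_fps_closed_disc_le[OF sr that] r_le by linarith
    ultimately show ?thesis
      using m[OF that] m0 norm_triangle_ineq[of "eval_fps P z" "eval_fps r z"] by auto
  qed
  have "open {z. norm (eval_fps P z) > m / 2}"
    using contP by (intro open_Collect_less) (auto intro!: continuous_intros)
  moreover have "cball 0 1 \<subseteq> {z. norm (eval_fps P z) > m / 2}" using Pm by auto
  ultimately obtain R where R: "R > 1" "cball 0 R \<subseteq> {z. norm (eval_fps P z) > m / 2}"
    by (rule open_superset_cball_enlarge)
  define I where "I = inverse P"
  have Ige: "fps_conv_radius I \<ge> ereal R" unfolding I_def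
  proof (rule fps_conv_radius_inverse_ge)
    fix z :: complex assume "ereal (norm z) < ereal R"
    then have "z \<in> cball 0 R" by simp
    then have "norm (eval_fps P z) > m / 2" using R(2) by blast
    then show "eval_fps P z \<noteq> 0" using m0 by auto
  qed (use R Prad in auto)
  have P0: "fps_nth P 0 \<noteq> 0" using Pm[of 0] m0 by (auto simp: eval_fps_at_0)
  have IP: "P * I = 1" unfolding I_def by (rule inverse_mult_eq_1'[OF P0])
  define R1 where "R1 = (1 + R) / 2"
  have R1: "1 < R1" "R1 < R" using R by (auto simp: R1_def)
  \<comment> \<open>On a radius above 1 Cauchy's estimate sees the power \<open>k\<close> only
    through \<open>(2 / m) ^ k\<close>, and the sum over \<open>n\<close> contributes one constant
    for all \<open>k\<close>. Submultiplicativity of the norm would produce the \<open>k\<close>-th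
    power of that constant instead.\<close>
  have I_bd: "norm (fps_nth (I ^ k) n) \<le> (2 / m) ^ k * (1 / R1) ^ n" for k n
  proof -
    have "norm (fps_nth (I ^ k) n) \<le> (2 / m) ^ k / R1 ^ n"
    proof (rule norm_fps_nth_le_Cauchy)
      have radI: "fps_conv_radius I > ereal R1" using Ige R1 by (metis less_ereal.simps(1) order_less_le_trans)
      show "ereal R1 < fps_conv_radius (I ^ k)"
        using radI fps_conv_radius_power[of I k] by auto
      fix z :: complex assume z: "norm z = R1"
      then have zI: "ereal (norm z) < fps_conv_radius I" using radI by simp
      have "eval_fps P z * eval_fps I z = 1"
        using eval_fps_mult[of z P I] zI IP Prad by simp
      then have "eval_fps I z = 1 / eval_fps P z" by (metis mult_zero_left nonzero_mult_div_cancel_left zero_neq_one)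
      moreover have "z \<in> cball 0 R" using z R1 by simp
      then have "norm (eval_fps P z) > m / 2" using R(2) by blast
      ultimately have "norm (eval_fps I z) \<le> 1 / (m / 2)"
        using m0 frac_le[of 1 1 "m / 2" "norm (eval_fps P z)"] by (simp add: norm_divide)
      then have "norm (eval_fps I z) \<le> 2 / m" by simp
      then show "norm (eval_fps (I ^ k) z) \<le> (2 / m) ^ k"
        using eval_fps_power[OF zI, of k] by (simp add: norm_power power_mono)
    qed (use R1 in auto)
    then show ?thesis by (simp add: power_divide)
  qed
  define C where "C = 1 / (1 - 1 / R1)"
  have geo: "(\<lambda>n. (2 / m) ^ k * (1 / R1) ^ n) sums ((2 / m) ^ k * C)" for k
    unfolding C_def using R1 by (intro sums_mult geometric_sums) auto
  have sI: "summable (\<lambda>n. norm (fps_nth (I ^ k) n))" for k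
    by (rule summable_comparison_test'[OF sums_summable[OF geo[of k]], of 0]) (use I_bd in auto)
  have I_le: "(\<Sum>n. norm (fps_nth (I ^ k) n)) \<le> (2 / m) ^ k * C" for k
    using suminf_le[OF I_bd sI sums_summable[OF geo]] sums_unique[OF geo, of k] by simp
  define S where "S = (- r) * I"
  have sr': "summable (\<lambda>n. norm (fps_nth (- r) n))" using sr by simp
  have sS: "summable (\<lambda>n. norm (fps_nth (S ^ k) n))"
    and S_le: "(\<Sum>n. norm (fps_nth (S ^ k) n)) \<le> C * (1/2) ^ k" for k
  proof -
    note 1 = norm_fps_power_sums[OF sr', of k]
    have eq: "S ^ k = (- r) ^ k * I ^ k" by (simp only: S_def power_mult_distrib)
    show "summable (\<lambda>n. norm (fps_nth (S ^ k) n))"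
      unfolding eq using 1 sI by (intro norm_fps_mult_sums) auto
    have "(\<Sum>n. norm (fps_nth (S ^ k) n)) \<le>
        (\<Sum>n. norm (fps_nth ((- r) ^ k) n)) * (\<Sum>n. norm (fps_nth (I ^ k) n))"
      unfolding eq using 1 sI by (intro norm_fps_mult_sums) auto
    also have "\<dots> \<le> (m / 4) ^ k * ((2 / m) ^ k * C)"
    proof (rule mult_mono)
      have "(\<Sum>n. norm (fps_nth (- r) n)) ^ k \<le> (m / 4) ^ k"
        using r_le sr by (intro power_mono) (auto intro!: suminf_nonneg)
      then show "(\<Sum>n. norm (fps_nth ((- r) ^ k) n)) \<le> (m / 4) ^ k" using 1 by linarith
    qed (use I_le sI m0 in \<open>auto intro!: suminf_nonneg\<close>)
    also have "\<dots> = C * (m / 4 * (2 / m)) ^ k" by (simp only: power_mult_distrib mult_ac)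
    also have "m / 4 * (2 / m) = 1/2" using m0 by simp
    finally show "(\<Sum>n. norm (fps_nth (S ^ k) n)) \<le> C * (1/2) ^ k" .
  qed
  have "(\<lambda>k. C * (1/2) ^ k) \<longlonglongrightarrow> C * 0"
    by (intro tendsto_intros LIMSEQ_power_zero) auto
  then have "eventually (\<lambda>k. C * (1/2) ^ k < 1/2) sequentially"
    by (rule order_tendstoD) auto
  then obtain k where k: "C * (1/2) ^ k < 1/2" by (auto simp: eventually_sequentially)
  have T: "summable (\<lambda>n. norm (fps_nth (inverse (1 - S ^ k)) n))" "fps_nth (1 - S ^ k) 0 \<noteq> 0"
    using summable_norm_inverse_one_minus[OF sS[of k]] S_le[of k] k by auto
  \<comment> \<open>A single power with norm below 1/2 suffices: \<open>1 - S\<close> divides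
    \<open>1 - S ^ k\<close>, so its inverse is a finite sum times an inverse that is already under
    control.\<close>
  have eq1: "(1 - S) * (\<Sum>i<k. S ^ i) = 1 - S ^ k"
    by (simp add: one_diff_power_eq)
  have f_eq: "f = P * (1 - S)"
    using IP by (simp add: S_def r_def algebra_simps)
  have "fps_nth (\<Sum>i<k. S ^ i) 0 \<noteq> 0"
    using T(2) unfolding eq1[symmetric] by (auto simp: fps_mult_nth_0)
  then have "inverse (1 - S) = (\<Sum>i<k. S ^ i) * inverse (1 - S ^ k)"
    unfolding eq1[symmetric] fps_inverse_mult
    by (metis inverse_mult_eq_1' mult.left_commute mult.right_neutral)
  then have "inverse f = I * ((\<Sum>i<k. S ^ i) * inverse (1 - S ^ k))"
    by (simp add: f_eq fps_inverse_mult I_def)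
  moreover have "summable (\<lambda>n. norm (fps_nth (I * ((\<Sum>i<k. S ^ i) * inverse (1 - S ^ k))) n))"
    using sI[of 1] T sS by (intro norm_fps_mult_sums norm_fps_sum_summable) auto
  ultimately show ?thesis by simp
qed

section \<open>Integrals of damped sines\<close>

lemma tail_eq_sum_diff:
  assumes K: "discrete_density K" and ab: "a \<le> b"
  shows "(\<Sum>n\<in>{a<..b}. K n) = tail K a - tail K b"
proof -
  have "summable (\<lambda>i. K (a + 1 + i))"
    using K summable_ignore_initial_segment[of K "a + 1"] by (auto simp: discrete_density_def sums_iff add_ac)
  from suminf_split_initial_segment[OF this, of "b - a"]
  have "tail K a = tail K b + (\<Sum>i<b - a. K (a + 1 + i))"
    using ab by (simp add: tail_def add_ac)
  moreover have "(\<Sum>i<b - a. K (a + 1 + i)) = (\<Sum>n\<in>{a<..b}. K n)"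
    by (rule sum.reindex_bij_witness[of _ "\<lambda>n. n - (a + 1)" "\<lambda>i. a + 1 + i"]) auto
  ultimately show ?thesis by simp
qed

text \<open>With \<open>t = s + \<theta>\<close>, \<open>p = s / t\<close> and
  \<open>q = \<theta> / t\<close>, the factor \<open>exp (- s n) sin (n \<theta>)\<close> is
  \<open>q\<close> times this kernel at \<open>n t\<close>. Division by \<open>q\<close> keeps the
  kernel from degenerating when \<theta> is small compared with \<open>s\<close>; the value chosen
  at \<open>q = 0\<close> is the limit for \<open>q\<close> tending to 0.\<close>

definition damped_sine :: "real \<Rightarrow> real \<Rightarrow> real \<Rightarrow> real" where
  "damped_sine p q x = exp (- p * x) * (if q = 0 then x else sin (q * x) / q)"

definition damped_sine' :: "real \<Rightarrow> real \<Rightarrow> real \<Rightarrow> real" where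
  "damped_sine' p q x = exp (- p * x) * cos (q * x) - p * damped_sine p q x"

lemma DERIV_damped_sine: "(damped_sine p q has_real_derivative damped_sine' p q x) (at x within A)"
  unfolding damped_sine_def damped_sine'_def
  by (cases "q = 0") (auto intro!: derivative_eq_intros simp: field_simps)

lemma continuous_on_damped_sine [continuous_intros]:
  "continuous_on A (damped_sine p q)"
  by (rule DERIV_continuous_on[OF DERIV_damped_sine])

lemma continuous_on_damped_sine' [continuous_intros]:
  "continuous_on A (damped_sine' p q)"
  unfolding damped_sine'_def by (intro continuous_intros)

lemma abs_damped_sine_le:
  assumes "0 \<le> p" "0 \<le> q" "0 \<le> x"
  shows "\<bar>damped_sine p q x\<bar> \<le> exp (- p * x) * x"
proof -
  have "\<bar>sin (q * x) / q\<bar> \<le> x" if "q \<noteq> 0"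
    using abs_sin_x_le_abs_x[of "q * x"] assms that by (simp add: abs_mult field_simps)
  then show ?thesis using assms by (auto simp: damped_sine_def abs_mult)
qed

lemma abs_damped_sine_le_x:
  assumes "0 \<le> p" "0 \<le> q" "0 \<le> x"
  shows "\<bar>damped_sine p q x\<bar> \<le> x"
proof -
  have "exp (- p * x) * x \<le> 1 * x" using assms by (intro mult_right_mono) auto
  then show ?thesis using abs_damped_sine_le[OF assms] by linarith
qed

text \<open>One of \<open>p\<close> and \<open>q\<close> is at least 1/2. Either the quotient of the
  sine is bounded by \<open>1 / q\<close>, or the exponential controls the factor \<open>x\<close>,
  because \<open>x exp (- x / 2) \<le> 2\<close>. A bound uniform in the ratio of \<open>p\<close>
  to \<open>q\<close> limits the cost of the far terms of the sum.\<close>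

lemma abs_damped_sine_le_2:
  assumes "0 \<le> p" "0 \<le> q" "p + q = 1" "0 \<le> x"
  shows "\<bar>damped_sine p q x\<bar> \<le> 2"
proof (cases "q \<ge> 1/2")
  case True
  have "\<bar>sin (q * x) / q\<bar> \<le> 1 / (1/2)"
    unfolding abs_divide using True by (intro frac_le) auto
  moreover have "exp (- p * x) \<le> 1" using assms by simp
  ultimately have "exp (- p * x) * \<bar>sin (q * x) / q\<bar> \<le> 1 * 2"
    by (intro mult_mono) auto
  then show ?thesis using True by (simp add: damped_sine_def abs_mult)
next
  case False
  have "exp (- p * x) * x \<le> exp (- (x / 2)) * x"
    using False assms mult_right_mono[of "1/2" p x] by (intro mult_right_mono) auto
  also have "\<dots> \<le> 2"
    using exp_ge_add_one_self[of "x / 2"] by (simp add: exp_minus field_simps)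
  finally show ?thesis using abs_damped_sine_le[OF assms(1,2,4)] by linarith
qed

lemma damped_sine_nonneg:
  assumes "0 \<le> q" "q \<le> 1" "0 \<le> x" "x \<le> 1"
  shows "0 \<le> damped_sine p q x"
proof -
  have "q * x \<le> 1 * 1" using assms by (intro mult_mono) auto
  then have "0 \<le> sin (q * x)" using assms pi_ge_two by (intro sin_ge_zero) auto
  then show ?thesis using assms by (simp add: damped_sine_def)
qed

lemma tendsto_damped_sine:
  assumes "p \<longlonglongrightarrow> p0" "q \<longlonglongrightarrow> q0" "\<And>n::nat. q n \<noteq> 0"
  shows "(\<lambda>n. damped_sine (p n) (q n) x) \<longlonglongrightarrow> damped_sine p0 q0 x"
proof -
  have "(\<lambda>n. sin (q n * x) / q n) \<longlonglongrightarrow> (if q0 = 0 then x else sin (q0 * x) / q0)"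
  proof (cases "q0 = 0")
    case True
    have "((\<lambda>h. sin (h * x) / h) \<longlongrightarrow> x) (at 0)"
    proof -
      have "((\<lambda>h. sin (h * x)) has_real_derivative x) (at 0)"
        by (auto intro!: derivative_eq_intros)
      then show ?thesis by (simp add: DERIV_def)
    qed
    moreover have "filterlim q (at 0) sequentially"
      using assms True by (auto simp: filterlim_at)
    ultimately show ?thesis using True filterlim_compose by fastforce
  qed (auto intro!: tendsto_intros assms)
  from tendsto_mult[OF _ this, of "\<lambda>n. exp (- p n * x)" "exp (- p0 * x)"] show ?thesis
    using assms unfolding damped_sine_def by (simp add: tendsto_exp tendsto_minus tendsto_mult_right)
qed

lemma tendsto_damped_sine':
  assumes "p \<longlonglongrightarrow> p0" "q \<longlonglongrightarrow> q0" "\<And>n::nat. q n \<noteq> 0"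
  shows "(\<lambda>n. damped_sine' (p n) (q n) x) \<longlonglongrightarrow> damped_sine' p0 q0 x"
  unfolding damped_sine'_def by (intro tendsto_intros tendsto_damped_sine assms)

lemma integral_sine_period:
  fixes q :: real
  assumes q: "q > 0" and ab: "a \<le> b"
  shows "((\<lambda>x. sin (q * x)) has_integral (cos (q * a) - cos (q * b)) / q) {a..b}"
proof -
  have "((\<lambda>x. sin (q * x)) has_integral (- cos (q * b) / q) - (- cos (q * a) / q)) {a..b}"
    using ab q by (intro fundamental_theorem_of_calculus)
      (auto intro!: derivative_eq_intros simp flip: has_real_derivative_iff_has_vector_derivative)
  then show ?thesis by (simp add: diff_divide_distrib)
qed

text \<open>Replacing the weight by its value at the zero of the sine in the middle of a period
  can only decrease the integral, since the difference has the sign of the sine.\<close>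

lemma antimono_times_sine_ge:
  fixes h :: "real \<Rightarrow> real"
  assumes q: "q > 0" and h: "\<And>x y. a \<le> x \<Longrightarrow> x \<le> y \<Longrightarrow> y \<le> a + 2 * (pi / q) \<Longrightarrow> 0 < x \<Longrightarrow> h y \<le> h x"
    and a: "a = 2 * real j * (pi / q)" and x: "a \<le> x" "x \<le> a + 2 * (pi / q)" "0 < x"
  shows "h (a + pi / q) * sin (q * x) \<le> h x * sin (q * x)"
proof -
  have a0: "a \<ge> 0" using a q by simp
  have P: "pi / q > 0" using q by simp
  have sq: "sin (q * x) = sin (q * (x - a))"
  proof -
    have "q * x = q * (x - a) + 2 * pi * of_int (int j)" using q by (simp add: a field_simps)
    then show ?thesis by (simp only: sin_add sin_int_2pin cos_int_2pin)
  qed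
  show ?thesis
  proof (cases "x \<le> a + pi / q")
    case True
    then have "q * (x - a) \<le> pi" using q by (simp add: field_simps)
    then have "0 \<le> sin (q * x)" unfolding sq using q x by (intro sin_ge_zero) auto
    moreover have "h (a + pi / q) \<le> h x" using True x P by (intro h) auto
    ultimately show ?thesis by (intro mult_right_mono) auto
  next
    case False
    then have "pi \<le> q * (x - a)" "q * (x - a) \<le> 2 * pi" using q x by (auto simp: field_simps)
    then have "sin (q * x) \<le> 0" unfolding sq using sin_le_zero[of "q * (x - a)"]
      by (cases "q * (x - a) = 2 * pi") auto
    moreover have "h x \<le> h (a + pi / q)" using False x P a0 by (intro h) auto
    ultimately show ?thesis by (intro mult_right_mono_neg) auto
  qed
qed

text \<open>The terms beyond \<open>A\<close> in \<open>sum_damped_sine_ge\<close> cost twice a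
  tail, in the scaling limit \<open>2 * A powr - \<alpha>\<close>, and the integral has to beat this
  cost. It stays above a fixed \<eta> > 0 along a sequence of values of \<open>A\<close> tending to
  infinity, while the cost tends to 0. For \<open>q = 0\<close> the kernel is nonnegative. For
  \<open>q > 0\<close> the weight in front of the sine decreases, so every full period contributes a
  nonnegative amount and the first one a positive amount.\<close>

lemma integral_damped_sine_large:
  assumes \<alpha>: "\<alpha> > 0" and pq: "0 \<le> p" "0 \<le> q" "p + q = 1"
  obtains \<delta> A where "0 < \<delta>" "\<delta> \<le> 1" "1 \<le> A"
    "2 * A powr - \<alpha> < integral {\<delta>..A} (\<lambda>x. \<alpha> * damped_sine p q x * x powr (- \<alpha> - 1))"
proof -
  let ?f = "\<lambda>x. \<alpha> * damped_sine p q x * x powr (- \<alpha> - 1)"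
  have cont: "continuous_on {a..b} ?f" if "a > 0" for a b
    using that by (intro continuous_intros) auto
  then have int: "?f integrable_on {a..b}" if "a > 0" for a b
    using that by (intro integrable_continuous_real)
  have powr0: "(\<lambda>n. 2 * x n powr - \<alpha>) \<longlonglongrightarrow> 0" if "filterlim x at_top sequentially" for x :: "nat \<Rightarrow> real"
  proof -
    have "((\<lambda>x. 2 * x powr - \<alpha>) \<longlongrightarrow> 2 * 0) at_top"
      using \<alpha> by (intro tendsto_mult tendsto_const tendsto_neg_powr filterlim_ident) auto
    from filterlim_compose[OF this that] show ?thesis by simp
  qed
  show thesis
  proof (cases "q = 0")
    case True
    then have p: "p = 1" using pq by simp
    have ge: "?f x \<ge> \<alpha> * exp (- 1)" if "x \<in> {1/2..1}" for x
    proof -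
      have "?f x = \<alpha> * (exp (- x) * (x * x powr (- \<alpha> - 1)))"
        using True p by (simp add: damped_sine_def)
      also have "x * x powr (- \<alpha> - 1) = x powr - \<alpha>"
        using that powr_add[of x 1 "- \<alpha> - 1"] by simp
      finally have "?f x = \<alpha> * (exp (- x) * x powr - \<alpha>)" .
      moreover have "1 powr - \<alpha> \<le> x powr - \<alpha>" using that \<alpha> by (intro powr_mono2') auto
      then have "exp (- 1) * 1 \<le> exp (- x) * x powr - \<alpha>" using that by (intro mult_mono) auto
      ultimately show ?thesis using \<alpha> by simp
    qed
    define \<eta> where "\<eta> = \<alpha> * exp (- 1) / 2"
    have \<eta>: "\<eta> > 0" using \<alpha> by (simp add: \<eta>_def)
    have "integral {1/2..1::real} (\<lambda>x. \<alpha> * exp (- 1)) \<le> integral {1/2..1} ?f"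
      using ge by (intro integral_le int) auto
    then have 1: "\<eta> \<le> integral {1/2..1} ?f" by (simp add: \<eta>_def)
    have 2: "\<eta> \<le> integral {1/2..A} ?f" if "A \<ge> 1" for A
    proof -
      have "integral {1/2..1} ?f + integral {1..A} ?f = integral {1/2..A} ?f"
        using that by (intro Henstock_Kurzweil_Integration.integral_combine int) auto
      moreover have "integral {1..A} ?f \<ge> 0"
        using \<alpha> True by (intro integral_nonneg int) (auto simp: damped_sine_def)
      ultimately show ?thesis using 1 by linarith
    qed
    have "eventually (\<lambda>n. 2 * real n powr - \<alpha> < \<eta>) sequentially"
      using order_tendstoD(2)[OF powr0[OF filterlim_real_sequentially] \<eta>] .
    then have "eventually (\<lambda>n. 2 * real n powr - \<alpha> < \<eta> \<and> n \<ge> 1) sequentially"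
      using eventually_ge_at_top[of 1] by eventually_elim auto
    then obtain n where n: "2 * real n powr - \<alpha> < \<eta>" "n \<ge> 1" by (auto dest: eventually_happens)
    show thesis by (rule that[of "1/2" "real n"]) (use n 2[of "real n"] in auto)
  next
    case False
    then have q: "q > 0" "q \<le> 1" using pq by auto
    \<comment> \<open>Half a period. Since \<open>q \<le> 1\<close>, it is at least
      \<open>pi\<close>, so the interval from 1/2 to 1 lies inside the first half-wave.\<close>
    define P where "P = pi / q"
    have "pi * q \<le> pi * 1" using q by (intro mult_left_mono) auto
    then have P: "P \<ge> pi" "P > 2" "q * P = pi"
      using q pi_gt3 by (auto simp: P_def field_simps)
    define h where "h = (\<lambda>x. \<alpha> * (exp (- p * x) / q) * x powr (- \<alpha> - 1))"
    have f_eq: "?f x = h x * sin (q * x)" for x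
      using q by (simp add: h_def damped_sine_def)
    have hpos: "h x > 0" if "x > 0" for x using that \<alpha> q by (simp add: h_def)
    have hle: "h y \<le> h x" if "0 < x" "x \<le> y" for x y
    proof -
      have "exp (- p * y) * y powr (- \<alpha> - 1) \<le> exp (- p * x) * x powr (- \<alpha> - 1)"
        using that pq \<alpha> by (intro mult_mono powr_mono2') (auto intro!: mult_left_mono)
      then show ?thesis using \<alpha> q by (simp add: h_def field_simps)
    qed
    have hless: "h P < h 1"
    proof -
      have "exp (- p * P) * P powr (- \<alpha> - 1) \<le> exp (- p * 1) * P powr (- \<alpha> - 1)"
        using P pq mult_left_mono[of 1 P p] by (intro mult_right_mono) auto
      also have "\<dots> < exp (- p * 1) * 1 powr (- \<alpha> - 1)"
        using P \<alpha> by (intro mult_strict_left_mono powr_less_mono2_neg) auto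
      finally show ?thesis using \<alpha> q by (simp add: h_def field_simps)
    qed
    have h_int: "?f x \<ge> h (2 * real j * P + P) * sin (q * x)"
      if "2 * real j * P \<le> x" "x \<le> 2 * real j * P + 2 * P" "0 < x" for x j
      unfolding f_eq using antimono_times_sine_ge[of q "2 * real j * P" h j x] that q hle
      by (auto simp: P_def)
    \<comment> \<open>A lower bound between 1/2 and 1 for the integrand minus its constant-weight
      comparison \<open>h P * sin (q * x)\<close>. That interval has length 1/2 and contributes
      \<open>c / 2\<close>, which is twice the \<eta> chosen next.\<close>
    define c where "c = (h 1 - h P) * sin (q * (1/2))"
    have c: "c > 0" unfolding c_def using hless q pi_gt3 by (intro mult_pos_pos sin_gt_zero) auto
    define \<eta> where "\<eta> = c / 4"
    have \<eta>: "\<eta> > 0" using c by (simp add: \<eta>_def)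
    \<comment> \<open>Starting at \<delta> instead of 0 spoils the cancellation of the
      constant-weight sine over the first period by at most \<open>h P * \<delta>\<close>. This
      choice caps the loss at \<eta>, so one \<eta> of the gain survives.\<close>
    define \<delta> where "\<delta> = min (1/2) (\<eta> / h P)"
    have \<delta>: "0 < \<delta>" "\<delta> \<le> 1/2" "h P * \<delta> \<le> \<eta>"
      using \<eta> hpos[of P] P by (auto simp: \<delta>_def min_def field_simps)
    have base: "integral {\<delta>..2 * P} ?f \<ge> \<eta>"
    proof -
      let ?g = "\<lambda>x. ?f x - h P * sin (q * x)"
      have gi: "?g integrable_on {a..b}" if "a > 0" for a b
        using that int by (intro integrable_diff integrable_continuous_real continuous_intros) auto
      have gnn: "?g x \<ge> 0" if "0 < x" "x \<le> 2 * P" for x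
        using h_int[of 0 x] that by simp
      have gc: "?g x \<ge> c" if "x \<in> {1/2..1}" for x
      proof -
        have "h x - h P \<ge> h 1 - h P" using hle[of x 1] that by auto
        moreover have "q * x \<le> 1 * 1" using that q by (intro mult_mono) auto
        then have "sin (q * x) \<ge> sin (q * (1/2))"
          using that q pi_gt3 by (intro sin_monotone_2pi_le) (auto intro!: mult_left_mono)
        moreover have "sin (q * (1/2)) > 0" using q pi_gt3 by (intro sin_gt_zero) auto
        ultimately have "(h 1 - h P) * sin (q * (1/2)) \<le> (h x - h P) * sin (q * x)"
          using hless by (intro mult_mono) auto
        then show ?thesis unfolding f_eq c_def by (simp only: left_diff_distrib)
      qed
      have "integral {1/2..1::real} (\<lambda>x. c) \<le> integral {1/2..1} ?g"
        using gc by (intro integral_le gi) auto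
      then have "c / 2 \<le> integral {1/2..1} ?g" by simp
      also have "\<dots> \<le> integral {\<delta>..2 * P} ?g"
        using \<delta> P gnn by (intro integral_subset_le gi) auto
      also have "\<dots> = integral {\<delta>..2 * P} ?f - integral {\<delta>..2 * P} (\<lambda>x. h P * sin (q * x))"
        using \<delta> by (intro Henstock_Kurzweil_Integration.integral_diff int integrable_continuous_real continuous_intros) auto
      also have "integral {\<delta>..2 * P} (\<lambda>x. h P * sin (q * x)) = h P * ((cos (q * \<delta>) - cos (q * (2 * P))) / q)"
        using \<delta> P q by (intro integral_unique has_integral_mult_right integral_sine_period) auto
      also have "cos (q * (2 * P)) = 1"
      proof -
        have "q * (2 * P) = 2 * pi" using P by simp
        then show ?thesis by (simp only: cos_two_pi)
      qed
      finally have "c / 2 + h P * ((cos (q * \<delta>) - 1) / q) \<le> integral {\<delta>..2 * P} ?f" by simp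
      moreover have "(cos (q * \<delta>) - 1) / q \<ge> - \<delta>"
      proof -
        have "(sin (q * \<delta> / 2))\<^sup>2 \<le> (q * \<delta> / 2)\<^sup>2"
          using abs_sin_x_le_abs_x[of "q * \<delta> / 2"] by (simp only: abs_le_square_iff)
        then have "1 - cos (q * \<delta>) \<le> (q * \<delta>)\<^sup>2 / 2"
          using cos_double_sin[of "q * \<delta> / 2"] by (simp add: power_divide)
        also have "(q * \<delta>)\<^sup>2 / 2 \<le> (q * \<delta>) * 1"
        proof -
          have "q * \<delta> \<le> 1 * 1" using q \<delta> by (intro mult_mono) auto
          then have "(q * \<delta>) * (q * \<delta>) \<le> (q * \<delta>) * 1" using q \<delta> by (intro mult_left_mono) auto
          then show ?thesis using q \<delta> by (simp add: power2_eq_square)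
        qed
        finally show ?thesis using q by (simp add: field_simps)
      qed
      then have "h P * ((cos (q * \<delta>) - 1) / q) \<ge> h P * (- \<delta>)"
        using hpos[of P] P by (intro mult_left_mono) auto
      ultimately show ?thesis using \<delta> by (simp add: \<eta>_def)
    qed
    \<comment> \<open>The upper limits are multiples of the full period \<open>2 * P\<close>, so
      each further block is compared with a sine of zero integral.\<close>
    have all: "integral {\<delta>..2 * P * real (Suc m)} ?f \<ge> \<eta>" for m
    proof (induction m)
      case 0
      then show ?case using base by simp
    next
      case (Suc m)
      have le: "2 * P * real (Suc m) \<le> 2 * P * real (Suc (Suc m))" using P by (intro mult_left_mono) auto
      have "2 * P * 1 \<le> 2 * P * real (Suc m)" using P by (intro mult_left_mono) auto
      then have d: "\<delta> \<le> 2 * P * real (Suc m)" "2 * P * real (Suc m) > 0" using \<delta> P by linarith+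
      let ?a = "2 * real (Suc m) * P"
      have "integral {?a..?a + 2 * P} (\<lambda>x. h (?a + P) * sin (q * x)) = h (?a + P) * ((cos (q * ?a) - cos (q * (?a + 2 * P))) / q)"
        using P q by (intro integral_unique has_integral_mult_right integral_sine_period) auto
      also have "cos (q * (?a + 2 * P)) = cos (q * ?a)"
      proof -
        have "q * (?a + 2 * P) = q * ?a + 2 * pi" using P(3) by (simp add: algebra_simps)
        then show ?thesis by (simp only: cos_add) simp
      qed
      finally have "0 = integral {?a..?a + 2 * P} (\<lambda>x. h (?a + P) * sin (q * x))" by simp
      also have "\<dots> \<le> integral {?a..?a + 2 * P} ?f"
      proof (rule integral_le)
        have a: "?a > 0" using P by simp
        show "?f integrable_on {?a..?a + 2 * P}" by (rule int[OF a])
        show "(\<lambda>x. h (?a + P) * sin (q * x)) integrable_on {?a..?a + 2 * P}"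
          by (intro integrable_continuous_real continuous_intros)
        fix x assume "x \<in> {?a..?a + 2 * P}"
        then have "?a \<le> x" "x \<le> ?a + 2 * P" by simp_all
        moreover from this a have "0 < x" by linarith
        ultimately show "h (?a + P) * sin (q * x) \<le> ?f x" by (rule h_int)
      qed
      finally have "0 \<le> integral {2 * P * real (Suc m)..2 * P * real (Suc (Suc m))} ?f"
        by (simp add: algebra_simps)
      moreover have "integral {\<delta>..2 * P * real (Suc m)} ?f + integral {2 * P * real (Suc m)..2 * P * real (Suc (Suc m))} ?f =
          integral {\<delta>..2 * P * real (Suc (Suc m))} ?f"
        using \<delta> le d by (intro Henstock_Kurzweil_Integration.integral_combine int) auto
      ultimately show ?case using Suc by linarith
    qed
    have "filterlim (\<lambda>m. 2 * P * real (Suc m)) at_top sequentially"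
      using P by (intro filterlim_tendsto_pos_mult_at_top[OF tendsto_const]
        filterlim_compose[OF filterlim_real_sequentially filterlim_Suc]) auto
    from order_tendstoD(2)[OF powr0[OF this] \<eta>]
    obtain m where m: "2 * (2 * P * real (Suc m)) powr - \<alpha> < \<eta>" by (auto dest: eventually_happens)
    have "2 * P * 1 \<le> 2 * P * real (Suc m)" using P by (intro mult_left_mono) auto
    then have "1 \<le> 2 * P * real (Suc m)" using P by linarith
    then show thesis using \<delta> m all[of m] by (intro that[of \<delta> "2 * P * real (Suc m)"]) linarith+
  qed
qed


text \<open>Abel summation. Up to the cut at \<delta> the terms are nonnegative because
  \<open>n t \<le> 1\<close> there; beyond the cut at \<open>A\<close> each term is at least
  \<open>- 2 * K n\<close>. In between the kernel at \<open>n t\<close> is its value at \<delta>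
  plus the integral of its derivative, and exchanging sum and integral turns the masses
  \<open>K n\<close> into differences of tails, whose ratios are governed by regular
  variation.\<close>

lemma sum_damped_sine_ge:
  fixes K :: "nat \<Rightarrow> real"
  assumes K: "discrete_density K" and pq: "0 \<le> p" "0 \<le> q" "p + q = 1" and t: "t > 0"
    and \<delta>: "0 < \<delta>" "\<delta> \<le> 1" "\<delta> \<le> A"
  shows "damped_sine p q \<delta> * (tail K (nat \<lfloor>\<delta> / t\<rfloor>) - tail K (nat \<lfloor>A / t\<rfloor>)) +
      integral {\<delta>..A} (\<lambda>x. damped_sine' p q x * (tail K (nat \<lfloor>x / t\<rfloor>) - tail K (nat \<lfloor>A / t\<rfloor>)))
      - 2 * tail K (nat \<lfloor>A / t\<rfloor>) \<le> (\<Sum>n. K n * damped_sine p q (real n * t))"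
    and "(\<lambda>x. damped_sine' p q x * (tail K (nat \<lfloor>x / t\<rfloor>) - tail K (nat \<lfloor>A / t\<rfloor>))) integrable_on {\<delta>..A}"
    and "summable (\<lambda>n. K n * damped_sine p q (real n * t))"
proof -
  let ?\<phi> = "damped_sine p q" and ?\<phi>' = "damped_sine' p q"
  have Knn: "\<And>n. 0 \<le> K n" and Ks: "summable K" using K by (auto simp: discrete_density_def sums_iff)
  define a where "a = nat \<lfloor>\<delta> / t\<rfloor>"
  define b where "b = nat \<lfloor>A / t\<rfloor>"
  have ab: "a \<le> b" unfolding a_def b_def using \<delta> t by (intro nat_mono floor_mono divide_right_mono) auto
  \<comment> \<open>Strictness matters: the tail at the rounded point \<open>x / t\<close> counts
    exactly the \<open>n\<close> with \<open>n t > x\<close>.\<close>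
  have less_iff: "nat \<lfloor>x / t\<rfloor> < n \<longleftrightarrow> x < real n * t" if "x > 0" for x n
  proof -
    have "nat \<lfloor>x / t\<rfloor> < n \<longleftrightarrow> \<lfloor>x / t\<rfloor> < int n" using that t by (simp add: nat_less_iff)
    also have "\<dots> \<longleftrightarrow> x / t < real n" by (simp add: floor_less_iff)
    also have "\<dots> \<longleftrightarrow> x < real n * t" using t by (simp add: field_simps)
    finally show ?thesis .
  qed
  have bd: "\<bar>K n * ?\<phi> (real n * t)\<bar> \<le> 2 * K n" for n
    using mult_left_mono[OF abs_damped_sine_le_2[OF pq, of "real n * t"] Knn[of n]] t Knn[of n]
    by (simp add: abs_mult mult.commute)
  show sm: "summable (\<lambda>n. K n * ?\<phi> (real n * t))"
    by (rule summable_comparison_test'[OF summable_mult[OF Ks, of 2], of 0]) (use bd in auto)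
  have Kt: "summable (\<lambda>i. K (b + 1 + i))"
    using summable_ignore_initial_segment[OF Ks, of "b + 1"] by (simp add: add_ac)
  have smt': "summable (\<lambda>i. K (i + (b + 1)) * ?\<phi> (real (i + (b + 1)) * t))"
    using summable_ignore_initial_segment[OF sm, of "b + 1"] .
  have "(\<Sum>i. - (2 * K (b + 1 + i))) \<le> (\<Sum>i. K (i + (b + 1)) * ?\<phi> (real (i + (b + 1)) * t))"
  proof (rule suminf_le[OF _ summable_minus[OF summable_mult[OF Kt]] smt'])
    fix i show "- (2 * K (b + 1 + i)) \<le> K (i + (b + 1)) * ?\<phi> (real (i + (b + 1)) * t)"
      using bd[of "i + (b + 1)"] by (simp add: add_ac abs_le_iff)
  qed
  also have "(\<Sum>i. - (2 * K (b + 1 + i))) = - (2 * tail K b)"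
    unfolding tail_def using Kt by (simp add: suminf_minus suminf_mult)
  finally have far: "- (2 * tail K b) \<le> (\<Sum>i. K (i + (b + 1)) * ?\<phi> (real (i + (b + 1)) * t))" .
  have near: "0 \<le> (\<Sum>n\<le>a. K n * ?\<phi> (real n * t))"
  proof (intro sum_nonneg mult_nonneg_nonneg Knn damped_sine_nonneg)
    fix n assume "n \<in> {..a}"
    then have "\<not> nat \<lfloor>\<delta> / t\<rfloor> < n" by (simp add: a_def)
    then show "real n * t \<le> 1" using less_iff[of \<delta> n] \<delta> by simp
  qed (use pq t in auto)
  have mid: "((\<lambda>x. ?\<phi>' x * (tail K (nat \<lfloor>x / t\<rfloor>) - tail K b)) has_integral
      (\<Sum>n\<in>{a<..b}. K n * (?\<phi> (real n * t) - ?\<phi> \<delta>))) {\<delta>..A}"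
  proof -
    have "((\<lambda>x. K n * (if x < real n * t then ?\<phi>' x else 0)) has_integral K n * (?\<phi> (real n * t) - ?\<phi> \<delta>)) {\<delta>..A}"
      if n: "n \<in> {a<..b}" for n
    proof (rule has_integral_mult_right)
      have lo: "\<delta> < real n * t" using n less_iff[of \<delta> n] \<delta> by (simp add: a_def)
      have hi: "real n * t \<le> A" using n less_iff[of A n] \<delta> by (simp add: b_def)
      have "(?\<phi>' has_integral ?\<phi> (real n * t) - ?\<phi> \<delta>) {\<delta>..real n * t}"
        using lo by (intro fundamental_theorem_of_calculus)
          (auto intro: DERIV_damped_sine simp flip: has_real_derivative_iff_has_vector_derivative)
      then have "((\<lambda>x. if x \<in> {\<delta>..real n * t} then ?\<phi>' x else 0) has_integral ?\<phi> (real n * t) - ?\<phi> \<delta>) {\<delta>..A}"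
        using hi by (subst has_integral_restrict) auto
      then show "((\<lambda>x. if x < real n * t then ?\<phi>' x else 0) has_integral ?\<phi> (real n * t) - ?\<phi> \<delta>) {\<delta>..A}"
        by (rule has_integral_spike_finite[of "{real n * t}", rotated 2]) auto
    qed
    then have "((\<lambda>x. \<Sum>n\<in>{a<..b}. K n * (if x < real n * t then ?\<phi>' x else 0)) has_integral
        (\<Sum>n\<in>{a<..b}. K n * (?\<phi> (real n * t) - ?\<phi> \<delta>))) {\<delta>..A}"
      by (intro has_integral_sum) auto
    moreover have "(\<Sum>n\<in>{a<..b}. K n * (if x < real n * t then ?\<phi>' x else 0)) =
        ?\<phi>' x * (tail K (nat \<lfloor>x / t\<rfloor>) - tail K b)" if x: "x \<in> {\<delta>..A}" for x
    proof -
      have lx: "x < real n * t \<longleftrightarrow> nat \<lfloor>x / t\<rfloor> < n" for n using less_iff[of x n] x \<delta> by simp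
      have "(\<Sum>n\<in>{a<..b}. K n * (if x < real n * t then ?\<phi>' x else 0)) =
          (\<Sum>n\<in>{nat \<lfloor>x / t\<rfloor><..b}. K n * ?\<phi>' x)"
        unfolding lx
      proof (rule sum.mono_neutral_cong_right)
        have "a \<le> nat \<lfloor>x / t\<rfloor>"
          unfolding a_def using x t by (intro nat_mono floor_mono divide_right_mono) auto
        then show "{nat \<lfloor>x / t\<rfloor><..b} \<subseteq> {a<..b}" by auto
      qed auto
      also have "\<dots> = ?\<phi>' x * (\<Sum>n\<in>{nat \<lfloor>x / t\<rfloor><..b}. K n)"
        by (simp add: sum_distrib_left mult.commute)
      also have "(\<Sum>n\<in>{nat \<lfloor>x / t\<rfloor><..b}. K n) = tail K (nat \<lfloor>x / t\<rfloor>) - tail K b"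
        unfolding b_def using x t by (intro tail_eq_sum_diff[OF K] nat_mono floor_mono divide_right_mono) auto
      finally show ?thesis .
    qed
    ultimately show ?thesis by (rule has_integral_eq[rotated])
  qed
  then show "(\<lambda>x. ?\<phi>' x * (tail K (nat \<lfloor>x / t\<rfloor>) - tail K (nat \<lfloor>A / t\<rfloor>))) integrable_on {\<delta>..A}"
    by (auto simp: b_def)
  have "(\<Sum>n. K n * ?\<phi> (real n * t)) = (\<Sum>i. K (i + (b + 1)) * ?\<phi> (real (i + (b + 1)) * t)) +
      (\<Sum>n<b + 1. K n * ?\<phi> (real n * t))"
    by (rule suminf_split_initial_segment[OF sm])
  also have "(\<Sum>n<b + 1. K n * ?\<phi> (real n * t)) = (\<Sum>n\<le>a. K n * ?\<phi> (real n * t)) + (\<Sum>n\<in>{a<..b}. K n * ?\<phi> (real n * t))"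
  proof -
    have "{..<b + 1} = {..a} \<union> {a<..b}" using ab by auto
    moreover have "(\<Sum>n\<in>{..a} \<union> {a<..b}. K n * ?\<phi> (real n * t)) =
        (\<Sum>n\<le>a. K n * ?\<phi> (real n * t)) + (\<Sum>n\<in>{a<..b}. K n * ?\<phi> (real n * t))"
      by (rule sum.union_disjoint) auto
    ultimately show ?thesis by (simp only:)
  qed
  also have "(\<Sum>n\<in>{a<..b}. K n * ?\<phi> (real n * t)) =
      ?\<phi> \<delta> * (\<Sum>n\<in>{a<..b}. K n) + (\<Sum>n\<in>{a<..b}. K n * (?\<phi> (real n * t) - ?\<phi> \<delta>))"
    unfolding sum_distrib_left sum.distrib[symmetric] by (intro sum.cong) (auto simp: algebra_simps)
  also have "(\<Sum>n\<in>{a<..b}. K n) = tail K a - tail K b" by (rule tail_eq_sum_diff[OF K ab])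
  also have "(\<Sum>n\<in>{a<..b}. K n * (?\<phi> (real n * t) - ?\<phi> \<delta>)) =
      integral {\<delta>..A} (\<lambda>x. ?\<phi>' x * (tail K (nat \<lfloor>x / t\<rfloor>) - tail K b))"
    using mid by (simp add: integral_unique)
  finally show "?\<phi> \<delta> * (tail K (nat \<lfloor>\<delta> / t\<rfloor>) - tail K (nat \<lfloor>A / t\<rfloor>)) +
      integral {\<delta>..A} (\<lambda>x. ?\<phi>' x * (tail K (nat \<lfloor>x / t\<rfloor>) - tail K (nat \<lfloor>A / t\<rfloor>)))
      - 2 * tail K (nat \<lfloor>A / t\<rfloor>) \<le> (\<Sum>n. K n * ?\<phi> (real n * t))"
    using near far by (simp add: a_def b_def)
qed

text \<open>The weight is normalised to vanish at \<open>A\<close>, so only the boundary term at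
  \<delta> survives. The left-hand side is the scaling limit of the bound in
  \<open>sum_damped_sine_ge\<close> without its far term.\<close>

lemma integral_damped_sine_by_parts:
  assumes "0 < \<delta>" "\<delta> \<le> A"
  shows "damped_sine p q \<delta> * (\<delta> powr - \<alpha> - A powr - \<alpha>) +
      integral {\<delta>..A} (\<lambda>x. damped_sine' p q x * (x powr - \<alpha> - A powr - \<alpha>)) =
      integral {\<delta>..A} (\<lambda>x. \<alpha> * damped_sine p q x * x powr (- \<alpha> - 1))"
proof -
  let ?F = "\<lambda>x. damped_sine p q x * (x powr - \<alpha> - A powr - \<alpha>)"
  have "((\<lambda>x. damped_sine' p q x * (x powr - \<alpha> - A powr - \<alpha>) - \<alpha> * damped_sine p q x * x powr (- \<alpha> - 1))
      has_integral ?F A - ?F \<delta>) {\<delta>..A}"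
    using assms
    by (intro fundamental_theorem_of_calculus)
      (auto intro!: derivative_eq_intros DERIV_damped_sine has_real_derivative_powr simp: algebra_simps
        simp flip: has_real_derivative_iff_has_vector_derivative)
  then have "integral {\<delta>..A} (\<lambda>x. damped_sine' p q x * (x powr - \<alpha> - A powr - \<alpha>) - \<alpha> * damped_sine p q x * x powr (- \<alpha> - 1)) = - ?F \<delta>"
    by (simp add: integral_unique)
  moreover have "integral {\<delta>..A} (\<lambda>x. damped_sine' p q x * (x powr - \<alpha> - A powr - \<alpha>) - \<alpha> * damped_sine p q x * x powr (- \<alpha> - 1)) =
      integral {\<delta>..A} (\<lambda>x. damped_sine' p q x * (x powr - \<alpha> - A powr - \<alpha>)) -
      integral {\<delta>..A} (\<lambda>x. \<alpha> * damped_sine p q x * x powr (- \<alpha> - 1))"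
    using assms by (intro Henstock_Kurzweil_Integration.integral_diff integrable_continuous_real continuous_intros) auto
  ultimately show ?thesis by simp
qed

text \<open>On the scale \<open>t = s + \<theta>\<close> the measure \<open>K\<close> looks like \<open>\<alpha> x\<^sup>-\<^sup>\<alpha>\<^sup>-\<^sup>1 dx\<close>, against
  which a damped sine has a positive integral.\<close>

lemma ztrans_imaginary_part_pos:
  assumes K: "discrete_density K" and \<alpha>: "\<alpha> > 0"
    and pos: "eventually (\<lambda>t. tail K (nat \<lfloor>t::real\<rfloor>) > 0) at_top"
    and lim: "\<And>c. c > 0 \<Longrightarrow> ((\<lambda>t. tail K (nat \<lfloor>c * t\<rfloor>) / tail K (nat \<lfloor>t\<rfloor>)) \<longlongrightarrow> c powr - \<alpha>) at_top"
  obtains \<epsilon> where "\<epsilon> > 0"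
    "\<And>s \<theta>. 0 \<le> s \<Longrightarrow> s < \<epsilon> \<Longrightarrow> 0 < \<theta> \<Longrightarrow> \<theta> < \<epsilon> \<Longrightarrow> 0 < (\<Sum>n. K n * (exp (- s * real n) * sin (real n * \<theta>)))"
proof -
  have "\<exists>\<epsilon>>0. \<forall>s \<theta>. 0 \<le> s \<longrightarrow> s < \<epsilon> \<longrightarrow> 0 < \<theta> \<longrightarrow> \<theta> < \<epsilon> \<longrightarrow> 0 < (\<Sum>n. K n * (exp (- s * real n) * sin (real n * \<theta>)))"
  proof (rule ccontr)
    assume neg: "\<not> ?thesis"
    define Q where "Q = (\<lambda>\<epsilon> (s, \<theta>). 0 \<le> s \<and> s < \<epsilon> \<and> 0 < \<theta> \<and> \<theta> < \<epsilon> \<and>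
        (\<Sum>n. K n * (exp (- s * real n) * sin (real n * \<theta>))) \<le> 0)"
    have "\<forall>k. \<exists>z. Q (1 / real (Suc k)) z"
    proof
      fix k
      have "1 / real (Suc k) > 0" by simp
      with neg obtain s \<theta> where "0 \<le> s" "s < 1 / real (Suc k)" "0 < \<theta>" "\<theta> < 1 / real (Suc k)"
        "\<not> 0 < (\<Sum>n. K n * (exp (- s * real n) * sin (real n * \<theta>)))" by blast
      then have "Q (1 / real (Suc k)) (s, \<theta>)" by (simp only: Q_def prod.case not_less simp_thms)
      then show "\<exists>z. Q (1 / real (Suc k)) z" by (rule exI)
    qed
    from choice[OF this] obtain z where z: "\<forall>k. Q (1 / real (Suc k)) (z k)" ..
    define s \<theta> where "s = (\<lambda>k. fst (z k))" and "\<theta> = (\<lambda>k. snd (z k))"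
    have Q: "Q (1 / real (Suc k)) (s k, \<theta> k)" for k using spec[OF z, of k] by (simp only: s_def \<theta>_def prod.collapse)
    have s: "\<And>k. 0 \<le> s k" "\<And>k. s k < 1 / real (Suc k)"
      and \<theta>: "\<And>k. 0 < \<theta> k" "\<And>k. \<theta> k < 1 / real (Suc k)"
      and le: "\<And>k. (\<Sum>n. K n * (exp (- s k * real n) * sin (real n * \<theta> k))) \<le> 0"
      using Q unfolding Q_def prod.case by blast+
    define t0 where "t0 = (\<lambda>k. s k + \<theta> k)"
    define p0 where "p0 = (\<lambda>k. s k / t0 k)"
    have t0: "t0 k > 0" for k using s(1)[of k] \<theta>(1)[of k] by (simp add: t0_def)
    have p0: "p0 k \<in> {0..1}" for k using s(1)[of k] \<theta>(1)[of k] t0[of k] by (simp add: p0_def t0_def)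
    \<comment> \<open>The ratio of \<open>s\<close> to \<theta> is arbitrary. Along a subsequence
      \<open>p\<close> converges, possibly to 1, in which case the limiting kernel is the one with
      \<open>q = 0\<close>.\<close>
    obtain pl r where r: "strict_mono r" "(p0 \<circ> r) \<longlonglongrightarrow> pl" and pl: "pl \<in> {0..1}"
      using p0 compact_Icc[of 0 "1::real"] unfolding compact_def by metis
    define p q t where "p = (\<lambda>k. p0 (r k))" and "q = (\<lambda>k. 1 - p k)" and "t = (\<lambda>k. t0 (r k))"
    have t: "t k > 0" for k by (simp add: t_def t0)
    have q_eq: "q k = \<theta> (r k) / t k" for k
      using t[of k] by (simp add: q_def p_def p0_def t_def t0_def field_simps)
    have q: "q k > 0" for k using t[of k] \<theta>(1)[of "r k"] by (simp add: q_eq)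
    have pq: "0 \<le> p k" "0 \<le> q k" "p k + q k = 1" for k
      using p0[of "r k"] q[of k] by (auto simp: p_def q_def)
    have plim: "p \<longlonglongrightarrow> pl" using r by (simp add: p_def comp_def)
    have qlim: "q \<longlonglongrightarrow> 1 - pl" unfolding q_def by (intro tendsto_intros plim)
    have le0: "(\<Sum>n. K n * damped_sine (p k) (q k) (real n * t k)) \<le> 0" for k
    proof -
      have "p k * t k = s (r k)" "q k * t k = \<theta> (r k)"
        using t[of k] by (auto simp: q_eq) (simp add: p_def p0_def t_def t0_def)
      then have e: "- p k * (real n * t k) = - s (r k) * real n" "q k * (real n * t k) = real n * \<theta> (r k)" for n
        by (metis mult.assoc mult.commute mult_minus_left)+
      have "K n * damped_sine (p k) (q k) (real n * t k) = 1 / q k * (K n * (exp (- s (r k) * real n) * sin (real n * \<theta> (r k))))" for n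
        unfolding damped_sine_def e using q[of k] by simp
      then have "(\<lambda>n. K n * damped_sine (p k) (q k) (real n * t k)) = (\<lambda>n. 1 / q k * (K n * (exp (- s (r k) * real n) * sin (real n * \<theta> (r k)))))"
        by blast
      moreover have "summable (\<lambda>n. K n * (exp (- s (r k) * real n) * sin (real n * \<theta> (r k))))"
      proof (rule summable_comparison_test'[of K 0])
        show "summable K" using K by (auto simp: discrete_density_def sums_iff)
        fix n
        have "exp (- s (r k) * real n) * \<bar>sin (real n * \<theta> (r k))\<bar> \<le> 1 * 1"
          using s(1)[of "r k"] by (intro mult_mono) auto
        then show "norm (K n * (exp (- s (r k) * real n) * sin (real n * \<theta> (r k)))) \<le> K n"
          using K mult_left_mono[of "exp (- s (r k) * real n) * \<bar>sin (real n * \<theta> (r k))\<bar>" 1 "K n"]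
          by (auto simp: discrete_density_def abs_mult)
      qed
      ultimately have "(\<Sum>n. K n * damped_sine (p k) (q k) (real n * t k)) =
          1 / q k * (\<Sum>n. K n * (exp (- s (r k) * real n) * sin (real n * \<theta> (r k))))"
        by (simp only: suminf_mult)
      then show ?thesis using le[of "r k"] q[of k] by (simp add: divide_nonpos_pos)
    qed
    have tlim: "t \<longlonglongrightarrow> 0"
    proof -
      have "t0 \<longlonglongrightarrow> 0"
      proof (rule tendsto_sandwich[of "\<lambda>_. 0" t0 _ "\<lambda>k. 2 * (1 / real (Suc k))"])
        show "(\<lambda>k. 2 * (1 / real (Suc k))) \<longlonglongrightarrow> 0"
          using tendsto_mult[OF tendsto_const LIMSEQ_inverse_real_of_nat, of "2::real"] by (simp add: inverse_eq_divide)
        show "eventually (\<lambda>k. t0 k \<le> 2 * (1 / real (Suc k))) sequentially"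
        proof (rule always_eventually, rule allI)
          fix k show "t0 k \<le> 2 * (1 / real (Suc k))"
            using s(2)[of k] \<theta>(2)[of k] unfolding t0_def by linarith
        qed
      qed (use t0 in \<open>simp_all add: less_imp_le\<close>)
      from LIMSEQ_subseq_LIMSEQ[OF this r(1)] show ?thesis by (simp add: t_def comp_def)
    qed
    have tinv: "filterlim (\<lambda>k. 1 / t k) at_top sequentially"
    proof -
      have "t k \<noteq> 0" for k using t[of k] by simp
      then have "filterlim t (at_right 0) sequentially"
        using tlim t by (simp add: filterlim_at)
      from filterlim_compose[OF filterlim_inverse_at_top_right this] show ?thesis
        by (simp add: inverse_eq_divide)
    qed
    \<comment> \<open>Tails measured in units of the tail at the scale \<open>1 / t k\<close>. The
      pointwise limit is the tail of the measure with density
      \<open>\<alpha> * x powr (- \<alpha> - 1)\<close>.\<close>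
    define g where "g = (\<lambda>k x. tail K (nat \<lfloor>x / t k\<rfloor>) / tail K (nat \<lfloor>1 / t k\<rfloor>))"
    have g: "(\<lambda>k. g k x) \<longlonglongrightarrow> x powr - \<alpha>" if "x > 0" for x
      using filterlim_compose[OF lim[OF that] tinv] by (simp add: g_def)
    have tail_nn: "tail K n \<ge> 0" for n
      unfolding tail_def using K summable_ignore_initial_segment[of K "n + 1"]
      by (intro suminf_nonneg) (auto simp: discrete_density_def sums_iff add_ac)
    have tail_mono: "tail K n \<le> tail K m" if "m \<le> n" for m n
      using tail_eq_sum_diff[OF K that] sum_nonneg[of "{m<..n}" K] K by (auto simp: discrete_density_def)
    have gpos: "eventually (\<lambda>k. tail K (nat \<lfloor>1 / t k\<rfloor>) > 0) sequentially"
      by (rule eventually_compose_filterlim[OF pos tinv])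
    obtain \<delta> A where \<delta>: "0 < \<delta>" "\<delta> \<le> 1" "1 \<le> A"
      and big: "2 * A powr - \<alpha> < integral {\<delta>..A} (\<lambda>x. \<alpha> * damped_sine pl (1 - pl) x * x powr (- \<alpha> - 1))"
      using integral_damped_sine_large[OF \<alpha>, of pl "1 - pl"] pl by auto
    have \<delta>A: "\<delta> \<le> A" using \<delta> by simp
    have "eventually (\<lambda>k. g k \<delta> < \<delta> powr - \<alpha> + 1) sequentially"
      using order_tendstoD(2)[OF g[OF \<delta>(1)]] by simp
    then have "eventually (\<lambda>k. g k \<delta> < \<delta> powr - \<alpha> + 1 \<and> tail K (nat \<lfloor>1 / t k\<rfloor>) > 0) sequentially"
      using gpos by eventually_elim auto
    then obtain k0 where k0: "\<And>k. k \<ge> k0 \<Longrightarrow> g k \<delta> < \<delta> powr - \<alpha> + 1 \<and> tail K (nat \<lfloor>1 / t k\<rfloor>) > 0"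
      by (auto simp: eventually_sequentially)
    \<comment> \<open>The shift by \<open>k0\<close> makes the dominating bound valid for every
      index.\<close>
    define f where "f = (\<lambda>k x. damped_sine' (p (k + k0)) (q (k + k0)) x * (g (k + k0) x - g (k + k0) A))"
    have f_eq: "f k x = damped_sine' (p (k + k0)) (q (k + k0)) x * (tail K (nat \<lfloor>x / t (k + k0)\<rfloor>) - tail K (nat \<lfloor>A / t (k + k0)\<rfloor>)) / tail K (nat \<lfloor>1 / t (k + k0)\<rfloor>)" for k x
      by (simp only: f_def g_def diff_divide_distrib times_divide_eq_right right_diff_distrib)
    have f_int: "f k integrable_on {\<delta>..A}" for k
      unfolding f_eq by (intro integrable_on_divide sum_damped_sine_ge(2)[OF K pq t \<delta>(1,2) \<delta>A])
    have "(\<lambda>k. integral {\<delta>..A} (f k)) \<longlonglongrightarrow> integral {\<delta>..A} (\<lambda>x. damped_sine' pl (1 - pl) x * (x powr - \<alpha> - A powr - \<alpha>))"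
    proof (rule dominated_convergence(2)[OF f_int])
      show "(\<lambda>x. (1 + A) * (\<delta> powr - \<alpha> + 1)) integrable_on {\<delta>..A}" by (rule integrable_const_ivl)
      fix x assume x: "x \<in> {\<delta>..A}"
      then have x0: "x > 0" using \<delta> by simp
      \<comment> \<open>The derivative of the kernel is at most \<open>1 + A\<close> in modulus, and
        since tails decrease, \<open>g\<close> is largest at \<delta>.\<close>
      show "norm (f k x) \<le> (1 + A) * (\<delta> powr - \<alpha> + 1)" for k
      proof -
        let ?k = "k + k0"
        have "\<bar>damped_sine' (p ?k) (q ?k) x\<bar> \<le> \<bar>exp (- p ?k * x) * cos (q ?k * x)\<bar> + \<bar>p ?k * damped_sine (p ?k) (q ?k) x\<bar>"
          unfolding damped_sine'_def by (rule abs_triangle_ineq4)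
        also have "\<bar>exp (- p ?k * x) * cos (q ?k * x)\<bar> \<le> 1 * 1"
          unfolding abs_mult using pq(1)[of ?k] x0 by (intro mult_mono) auto
        also have "\<bar>p ?k * damped_sine (p ?k) (q ?k) x\<bar> \<le> 1 * A"
          unfolding abs_mult using pq[of ?k] x x0 \<delta> abs_damped_sine_le_x[OF pq(1)[of ?k] pq(2)[of ?k], of x]
          by (intro mult_mono) auto
        finally have 1: "\<bar>damped_sine' (p ?k) (q ?k) x\<bar> \<le> 1 + A" by simp
        have T: "tail K (nat \<lfloor>1 / t ?k\<rfloor>) > 0" using k0[of ?k] by simp
        have "g ?k A \<le> g ?k x"
          unfolding g_def using T x t[of ?k]
          by (intro divide_right_mono tail_mono nat_mono floor_mono) (auto intro!: divide_right_mono)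
        moreover have "g ?k x \<le> g ?k \<delta>"
          unfolding g_def using T x t[of ?k]
          by (intro divide_right_mono tail_mono nat_mono floor_mono) (auto intro!: divide_right_mono)
        moreover have "g ?k A \<ge> 0" unfolding g_def using tail_nn by auto
        moreover have "g ?k \<delta> < \<delta> powr - \<alpha> + 1" using k0[of ?k] by simp
        ultimately have 2: "\<bar>g ?k x - g ?k A\<bar> \<le> \<delta> powr - \<alpha> + 1" by simp
        show ?thesis unfolding f_def real_norm_def abs_mult using 1 2 \<delta> by (intro mult_mono) auto
      qed
      show "(\<lambda>k. f k x) \<longlonglongrightarrow> damped_sine' pl (1 - pl) x * (x powr - \<alpha> - A powr - \<alpha>)"
        unfolding f_def
      proof (intro tendsto_mult tendsto_diff)
        show "(\<lambda>k. damped_sine' (p (k + k0)) (q (k + k0)) x) \<longlonglongrightarrow> damped_sine' pl (1 - pl) x"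
          using q by (intro LIMSEQ_ignore_initial_segment[OF tendsto_damped_sine'[OF plim qlim]]) (metis less_irrefl)
        show "(\<lambda>k. g (k + k0) x) \<longlonglongrightarrow> x powr - \<alpha>" by (rule LIMSEQ_ignore_initial_segment[OF g[OF x0]])
        show "(\<lambda>k. g (k + k0) A) \<longlonglongrightarrow> A powr - \<alpha>" using \<delta> by (intro LIMSEQ_ignore_initial_segment[OF g]) simp
      qed
    qed
    moreover have "(\<lambda>k. damped_sine (p (k + k0)) (q (k + k0)) \<delta> * (g (k + k0) \<delta> - g (k + k0) A)) \<longlonglongrightarrow>
        damped_sine pl (1 - pl) \<delta> * (\<delta> powr - \<alpha> - A powr - \<alpha>)"
    proof (intro tendsto_mult tendsto_diff)
      show "(\<lambda>k. damped_sine (p (k + k0)) (q (k + k0)) \<delta>) \<longlonglongrightarrow> damped_sine pl (1 - pl) \<delta>"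
        using q by (intro LIMSEQ_ignore_initial_segment[OF tendsto_damped_sine[OF plim qlim]]) (metis less_irrefl)
      show "(\<lambda>k. g (k + k0) \<delta>) \<longlonglongrightarrow> \<delta> powr - \<alpha>" by (rule LIMSEQ_ignore_initial_segment[OF g[OF \<delta>(1)]])
      show "(\<lambda>k. g (k + k0) A) \<longlonglongrightarrow> A powr - \<alpha>" using \<delta> by (intro LIMSEQ_ignore_initial_segment[OF g]) simp
    qed
    moreover have "(\<lambda>k. 2 * g (k + k0) A) \<longlonglongrightarrow> 2 * A powr - \<alpha>"
      using \<delta> by (intro tendsto_mult tendsto_const LIMSEQ_ignore_initial_segment[OF g]) simp
    ultimately have "(\<lambda>k. damped_sine (p (k + k0)) (q (k + k0)) \<delta> * (g (k + k0) \<delta> - g (k + k0) A) +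
        integral {\<delta>..A} (f k) - 2 * g (k + k0) A) \<longlonglongrightarrow>
      damped_sine pl (1 - pl) \<delta> * (\<delta> powr - \<alpha> - A powr - \<alpha>) +
        integral {\<delta>..A} (\<lambda>x. damped_sine' pl (1 - pl) x * (x powr - \<alpha> - A powr - \<alpha>)) - 2 * A powr - \<alpha>"
      by (intro tendsto_diff tendsto_add)
    moreover have "damped_sine (p (k + k0)) (q (k + k0)) \<delta> * (g (k + k0) \<delta> - g (k + k0) A) +
        integral {\<delta>..A} (f k) - 2 * g (k + k0) A \<le> 0" for k
    proof -
      let ?k = "k + k0" let ?T = "tail K (nat \<lfloor>1 / t ?k\<rfloor>)"
      have T: "?T > 0" using k0[of ?k] by simp
      have "damped_sine (p ?k) (q ?k) \<delta> * (g ?k \<delta> - g ?k A) + integral {\<delta>..A} (f k) - 2 * g ?k A =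
        (damped_sine (p ?k) (q ?k) \<delta> * (tail K (nat \<lfloor>\<delta> / t ?k\<rfloor>) - tail K (nat \<lfloor>A / t ?k\<rfloor>)) +
        integral {\<delta>..A} (\<lambda>x. damped_sine' (p ?k) (q ?k) x * (tail K (nat \<lfloor>x / t ?k\<rfloor>) - tail K (nat \<lfloor>A / t ?k\<rfloor>)))
        - 2 * tail K (nat \<lfloor>A / t ?k\<rfloor>)) / ?T"
        unfolding f_eq integral_divide
        by (simp only: g_def diff_divide_distrib add_divide_distrib times_divide_eq_right right_diff_distrib)
      also have "\<dots> \<le> 0"
        using order.trans[OF sum_damped_sine_ge(1)[OF K pq t \<delta>(1,2) \<delta>A, of ?k ?k] le0[of ?k]] T
        by (simp add: divide_nonpos_pos)
      finally show ?thesis .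
    qed
    \<comment> \<open>Before the limit the expression is a lower bound for a nonpositive sum divided
      by a positive tail. By parts, its limit is the large integral minus
      \<open>2 * A powr - \<alpha>\<close>, which is positive.\<close>
    ultimately have "damped_sine pl (1 - pl) \<delta> * (\<delta> powr - \<alpha> - A powr - \<alpha>) +
        integral {\<delta>..A} (\<lambda>x. damped_sine' pl (1 - pl) x * (x powr - \<alpha> - A powr - \<alpha>)) - 2 * A powr - \<alpha> \<le> 0"
      by (intro LIMSEQ_le_const2) auto
    then show False
      using big unfolding integral_damped_sine_by_parts[OF \<delta>(1) \<delta>A] by linarith
  qed
  then show thesis using that by blast
qed

section \<open>The transform of the tilted renewal sequence\<close>

lemma discrete_densityD:
  assumes "discrete_density K"
  shows "K 0 = 0" "\<And>n. 0 \<le> K n" "summable K" "suminf K = 1"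
  using assms by (auto simp: discrete_density_def sums_iff)

lemma norm_fps_of_density:
  assumes "discrete_density K"
  shows "summable (\<lambda>n. norm (fps_nth (Abs_fps (\<lambda>n. complex_of_real (K n))) n))"
  using discrete_densityD[OF assms] by simp

lemma ztrans_eq_eval_fps: "ztrans K z = eval_fps (Abs_fps (\<lambda>n. complex_of_real (K n))) z"
  by (simp add: ztrans_def eval_fps_def)

lemma ztrans_sums:
  assumes "discrete_density K" "norm z \<le> 1"
  shows "(\<lambda>n. complex_of_real (K n) * z ^ n) sums ztrans K z"
  using summable_norm_cancel[OF abs_summable_fps_eval[OF norm_fps_of_density[OF assms(1)] assms(2)]]
  unfolding ztrans_def by (intro summable_sums) simp

text \<open>The order \<open>d\<close> of \<open>z\<close> divides every exponent in
  \<open>A\<close>, hence the gcd. A positive exponent exists because a subset of \<open>{0}\<close>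
  has gcd 0.\<close>

lemma eq_one_if_powers_eq_one:
  fixes z :: complex
  assumes "Gcd A = (1 :: nat)" "\<And>n. n \<in> A \<Longrightarrow> z ^ n = 1"
  shows "z = 1"
proof -
  obtain m where m: "m \<in> A" "m \<noteq> 0"
    using assms(1) by (metis Gcd_0_iff One_nat_def all_not_in_conv insertCI nat.distinct(1) subsetI singleton_iff)
  define d where "d = (LEAST d. 0 < d \<and> z ^ d = 1)"
  have d: "0 < d" "z ^ d = 1"
    unfolding d_def using LeastI[of "\<lambda>d. 0 < d \<and> z ^ d = 1" m] m assms(2) by auto
  have "d dvd n" if "n \<in> A" for n
  proof -
    have "z ^ n = z ^ (d * (n div d) + n mod d)" by simp
    also have "\<dots> = z ^ (n mod d)" unfolding power_add power_mult d(2) by simp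
    finally have "z ^ (n mod d) = 1" using assms(2)[OF that] by simp
    moreover have "n mod d < d" using d by simp
    ultimately have "n mod d = 0"
      using not_less_Least[of "n mod d" "\<lambda>d. 0 < d \<and> z ^ d = 1"] unfolding d_def by auto
    then show ?thesis by auto
  qed
  then have "d dvd Gcd A" by (rule Gcd_greatest)
  then show ?thesis using assms(1) d by simp
qed

text \<open>The number 1 becomes an average, with weights \<open>K n\<close>, of real parts that are
  at most 1; this forces \<open>Re (z ^ n) = 1\<close> wherever \<open>K n > 0\<close>, and in the
  closed disc that means \<open>z ^ n = 1\<close>. Aperiodicity does the rest.\<close>

lemma ztrans_eq_one_imp:
  assumes K: "discrete_density K" "aperiodic K" and z: "norm z \<le> 1" "ztrans K z = 1"
  shows "z = 1"
proof (rule eq_one_if_powers_eq_one)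
  note Kd = discrete_densityD[OF K(1)]
  show "Gcd {n. K n > 0} = 1" using K(2) by (simp add: aperiodic_def)
  fix n assume "n \<in> {n. K n > 0}"
  then have n: "K n > 0" by simp
  have nz: "norm (z ^ m) \<le> 1" for m using z(1) by (simp add: norm_power power_le_one)
  have Re_le: "Re (z ^ m) \<le> 1" for m using complex_Re_le_cmod[of "z ^ m"] nz[of m] by linarith
  have "(\<lambda>n. Re (complex_of_real (K n) * z ^ n)) sums Re 1"
    using sums_Re[OF ztrans_sums[OF K(1) z(1)]] z(2) by simp
  then have "(\<lambda>n. K n * Re (z ^ n)) sums 1" by simp
  then have "(\<lambda>n. K n - K n * Re (z ^ n)) sums (1 - 1)"
    using Kd by (intro sums_diff) (auto simp: sums_iff)
  then have "(\<lambda>n. K n * (1 - Re (z ^ n))) sums 0" by (simp add: algebra_simps)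
  then have "K n * (1 - Re (z ^ n)) = 0"
    using Kd Re_le by (metis (no_types, lifting) diff_ge_0_iff_ge mult_nonneg_nonneg sums_summable sums_unique suminf_eq_zero_iff)
  then have "Re (z ^ n) = 1" using n by simp
  moreover have "(Re (z ^ n))\<^sup>2 + (Im (z ^ n))\<^sup>2 \<le> 1"
    using nz[of n] by (simp add: cmod_def)
  ultimately show "z ^ n = 1" by (simp add: complex_eq_iff)
qed

lemma tilted_mass:
  assumes "discrete_density K" "b > 0"
  shows "summable (\<lambda>n. K n * exp (- b * real n))" "0 < (\<Sum>n. K n * exp (- b * real n))"
    "(\<Sum>n. K n * exp (- b * real n)) < 1"
    "ztrans K (of_real (exp (- b))) = of_real (\<Sum>n. K n * exp (- b * real n))"
    "tilt_const K b > 1" "tilt_const K b * (\<Sum>n. K n * exp (- b * real n)) = 1"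
proof -
  note Kd = discrete_densityD[OF assms(1)]
  have le: "K n * exp (- b * real n) \<le> K n" for n
    using Kd(2)[of n] assms(2) by (auto intro!: mult_left_le)
  show s: "summable (\<lambda>n. K n * exp (- b * real n))"
    by (rule summable_comparison_test'[OF Kd(3), of 0]) (use le Kd in auto)
  obtain m where m: "K m > 0"
  proof (rule ccontr)
    assume "\<not> thesis"
    then have "K n \<le> 0" for n using that by (meson not_le)
    then have "K n = 0" for n using Kd(2)[of n] by (simp add: order.antisym)
    then have "K = (\<lambda>_. 0)" by (rule ext)
    then show False using Kd(4) by simp
  qed
  show pos: "0 < (\<Sum>n. K n * exp (- b * real n))"
    using m Kd by (intro suminf_pos2[OF s, of m]) auto
  have "m \<noteq> 0" using m Kd(1) by (metis less_irrefl)
  then have "0 < (\<Sum>n. K n - K n * exp (- b * real n))"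
    using m Kd le assms(2) by (intro suminf_pos2[OF summable_diff[OF Kd(3) s], of m]) auto
  then show l1: "(\<Sum>n. K n * exp (- b * real n)) < 1"
    using suminf_diff[OF Kd(3) s] Kd(4) by simp
  have "ztrans K (of_real (exp (- b))) = (\<Sum>n. of_real (K n * exp (- b * real n)))"
  proof -
    have e: "exp (- b) ^ n = exp (- b * real n)" for n
      by (simp add: mult.commute flip: exp_of_nat_mult)
    show ?thesis unfolding ztrans_def of_real_power[symmetric] e of_real_mult[symmetric] ..
  qed
  also have "\<dots> = of_real (\<Sum>n. K n * exp (- b * real n))"
    by (rule suminf_of_real[OF s, symmetric])
  finally show "ztrans K (of_real (exp (- b))) = of_real (\<Sum>n. K n * exp (- b * real n))" .
  show "tilt_const K b > 1" using pos l1 unfolding tilt_const_def by (subst less_divide_eq_1_pos) auto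
  show "tilt_const K b * (\<Sum>n. K n * exp (- b * real n)) = 1"
    unfolding tilt_const_def using pos by simp
qed

lemma ztrans_tilted:
  "ztrans (tilted K b) (of_real (exp b) * w) = of_real (tilt_const K b) * ztrans K w"
  if "discrete_density K" "norm w \<le> 1"
proof -
  have "ztrans (tilted K b) (of_real (exp b) * w) =
      (\<Sum>n. of_real (tilt_const K b) * (of_real (K n) * w ^ n))"
    unfolding ztrans_def
  proof (rule suminf_cong)
    fix n
    have "exp (- b * real n) * exp b ^ n = 1"
      by (simp add: mult.commute flip: exp_of_nat_mult exp_add)
    then have "complex_of_real (exp (- b * real n)) * of_real (exp b) ^ n = 1"
      by (metis of_real_1 of_real_mult of_real_power)
    then show "complex_of_real (tilted K b n) * (of_real (exp b) * w) ^ n = of_real (tilt_const K b) * (of_real (K n) * w ^ n)"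
      by (simp add: tilted_def power_mult_distrib algebra_simps)
  qed
  also have "\<dots> = of_real (tilt_const K b) * ztrans K w"
    using sums_mult[OF ztrans_sums[OF that]] by (simp add: sums_iff)
  finally show ?thesis .
qed

section \<open>The critical tilt as an equation for the untilted transform\<close>

definition critical_set :: "(nat \<Rightarrow> real) \<Rightarrow> real set" where
  "critical_set K = {b. b > 0 \<and> (\<exists>z. 1 < cmod z \<and> cmod z \<le> exp b \<and> ztrans (tilted K b) z = 1)}"

text \<open>After rescaling the tilt constant cancels and one fixed function \<open>ztrans K\<close>
  remains; \<open>b\<close> enters through the point \<open>exp (- b)\<close> alone. This form
  allows solutions for different \<open>b\<close> to be compared.\<close>

lemma critical_set_iff:
  assumes K: "discrete_density K"
  shows "b \<in> critical_set K \<longleftrightarrow> b > 0 \<and>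
    (\<exists>w. exp (- b) < norm w \<and> norm w \<le> 1 \<and> ztrans K w = ztrans K (of_real (exp (- b))))"
proof (cases "b > 0")
  case True
  define c where "c = tilt_const K b"
  note m = tilted_mass[OF K True, folded c_def]
  have eq: "of_real c * ztrans K w = 1 \<longleftrightarrow> ztrans K w = ztrans K (of_real (exp (- b)))" for w
  proof -
    have "of_real c * ztrans K (of_real (exp (- b))) = 1"
      unfolding m(4) by (metis m(6) of_real_1 of_real_mult)
    moreover have "complex_of_real c \<noteq> 0" using m(5) by simp
    ultimately show ?thesis by (metis mult_cancel_left)
  qed
  have "(\<exists>z. 1 < cmod z \<and> cmod z \<le> exp b \<and> ztrans (tilted K b) z = 1) \<longleftrightarrow>
     (\<exists>w. exp (- b) < norm w \<and> norm w \<le> 1 \<and> ztrans K w = ztrans K (of_real (exp (- b))))"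
  proof safe
    fix z assume z: "1 < cmod z" "cmod z \<le> exp b" "ztrans (tilted K b) z = 1"
    define w where "w = of_real (exp (- b)) * z"
    have "complex_of_real (exp b) * of_real (exp (- b)) = 1"
      by (simp flip: of_real_mult exp_add)
    then have w: "norm w = exp (- b) * cmod z" "z = of_real (exp b) * w"
      unfolding w_def mult.assoc[symmetric] by (simp_all add: norm_mult)
    have "norm w \<le> exp (- b) * exp b" "exp (- b) * 1 < norm w" unfolding w(1) using z by auto
    then have n: "exp (- b) < norm w" "norm w \<le> 1" by (simp_all flip: exp_add)
    have "of_real c * ztrans K w = 1"
      using ztrans_tilted[OF K n(2), of b] z(3) by (simp add: c_def w(2))
    then show "\<exists>w. exp (- b) < norm w \<and> norm w \<le> 1 \<and> ztrans K w = ztrans K (of_real (exp (- b)))"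
      using n eq by blast
  next
    fix w assume w: "exp (- b) < norm w" "norm w \<le> 1" "ztrans K w = ztrans K (of_real (exp (- b)))"
    have "exp b * exp (- b) < exp b * norm w" using w by simp
    then have "1 < cmod (of_real (exp b) * w)" by (simp add: norm_mult flip: exp_add)
    moreover have "cmod (of_real (exp b) * w) \<le> exp b" using w by (simp add: norm_mult mult_left_le)
    moreover have "ztrans (tilted K b) (of_real (exp b) * w) = 1"
      using ztrans_tilted[OF K w(2), of b] w(3) eq by (simp add: c_def)
    ultimately show "\<exists>z. 1 < cmod z \<and> cmod z \<le> exp b \<and> ztrans (tilted K b) z = 1" by blast
  qed
  then show ?thesis by (simp add: critical_set_def)
qed (simp add: critical_set_def)

lemma not_in_critical_set:
  assumes "ereal b < critical_b K"
  shows "b \<notin> critical_set K"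
proof
  assume "b \<in> critical_set K"
  then have "critical_b K \<le> ereal b"
    unfolding critical_b_def critical_set_def[symmetric] by (intro Inf_lower) auto
  with assms show False by simp
qed

lemma continuous_on_ztrans:
  assumes "discrete_density K"
  shows "continuous_on (cball 0 1) (ztrans K)"
  using continuous_on_eval_fps_closed_disc[OF norm_fps_of_density[OF assms]]
  by (simp add: ztrans_eq_eval_fps[abs_def])

lemma holomorphic_on_ztrans:
  assumes "discrete_density K"
  shows "ztrans K holomorphic_on (ball 0 1)"
proof -
  have "summable (\<lambda>n. fps_nth (Abs_fps (\<lambda>n. complex_of_real (K n))) n * 1 ^ n)"
    using summable_norm_cancel[OF norm_fps_of_density[OF assms]] by simp
  then have rad: "ereal (norm (1 :: complex)) \<le> fps_conv_radius (Abs_fps (\<lambda>n. complex_of_real (K n)))"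
    unfolding fps_conv_radius_def by (rule conv_radius_geI)
  have "ball (0 :: complex) 1 \<subseteq> eball 0 (fps_conv_radius (Abs_fps (\<lambda>n. complex_of_real (K n))))"
  proof
    fix x :: complex assume "x \<in> ball 0 1"
    then have "ereal (norm x) < ereal (norm (1 :: complex))" by simp
    from less_le_trans[OF this rad] show "x \<in> eball 0 (fps_conv_radius (Abs_fps (\<lambda>n. complex_of_real (K n))))"
      by simp
  qed
  then show ?thesis
    unfolding ztrans_eq_eval_fps[abs_def] by (rule holomorphic_on_eval_fps)
qed

lemma no_interior_critical_point:
  assumes K: "discrete_density K" and b: "b > 0" "ereal b \<le> critical_b K"
    and w: "exp (- b) < norm w" "norm w < 1"
  shows "ztrans K w \<noteq> ztrans K (of_real (exp (- b)))"
proof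
  assume eq: "ztrans K w = ztrans K (of_real (exp (- b)))"
  \<comment> \<open>The midpoint separates the two moduli: solutions near \<open>w\<close> keep
    modulus above \<open>m\<close>, while \<open>exp (- t)\<close> stays below \<open>m\<close> for
    \<open>t\<close> slightly less than \<open>b\<close>.\<close>
  define m where "m = (norm w + exp (- b)) / 2"
  define U where "U = ball 0 1 \<inter> {z :: complex. m < norm z}"
  have wU: "w \<in> U" using w by (auto simp: U_def m_def)
  have oU: "open U" unfolding U_def by (intro open_Int open_ball open_Collect_less continuous_intros)
  have "\<not> ztrans K constant_on ball 0 1"
  proof
    assume "ztrans K constant_on ball 0 1"
    then have "ztrans K w = ztrans K 0" using w by (auto simp: constant_on_def)
    moreover have "ztrans K 0 = 0"
      using discrete_densityD(1)[OF K] by (simp add: ztrans_eq_eval_fps eval_fps_at_0)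
    ultimately show False using eq tilted_mass(2,4)[OF K b(1)] by simp
  qed
  then have "open (ztrans K ` U)"
    using open_mapping_thm[OF holomorphic_on_ztrans[OF K] open_ball _ oU] U_def by auto
  moreover have "isCont (\<lambda>t. ztrans K (of_real (exp (- t)))) b"
  proof -
    have 1: "isCont (ztrans K) (of_real (exp (- b)))"
      using b by (intro continuous_on_interior[OF continuous_on_ztrans[OF K]]) auto
    have 2: "isCont (\<lambda>t. complex_of_real (exp (- t))) b" by (intro continuous_intros)
    show ?thesis by (rule isCont_o2[OF 2 1])
  qed
  then have "((\<lambda>t. ztrans K (of_real (exp (- t)))) \<longlongrightarrow> ztrans K w) (at_left b)"
    unfolding eq isCont_def by (rule tendsto_within_subset) auto
  ultimately have "eventually (\<lambda>t. ztrans K (of_real (exp (- t))) \<in> ztrans K ` U) (at_left b)"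
    using wU by (intro topological_tendstoD) auto
  moreover have "((\<lambda>t. exp (- t)) \<longlongrightarrow> exp (- b)) (at_left b)" by (intro tendsto_intros)
  then have "eventually (\<lambda>t. exp (- t) < m) (at_left b)"
    by (rule order_tendstoD) (use w in \<open>simp add: m_def\<close>)
  moreover have "eventually (\<lambda>t. t \<in> {0<..<b}) (at_left b)"
    by (rule eventually_at_left_real[OF b(1)])
  ultimately have "eventually (\<lambda>t. t \<in> critical_set K \<and> t < b) (at_left b)"
  proof eventually_elim
    case (elim t)
    then obtain w' where "w' \<in> U" "ztrans K w' = ztrans K (of_real (exp (- t)))" by (metis imageE)
    then have "exp (- t) < norm w' \<and> norm w' \<le> 1 \<and> ztrans K w' = ztrans K (of_real (exp (- t)))"
      using elim by (auto simp: U_def)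
    then show ?case using elim unfolding critical_set_iff[OF K] by auto
  qed
  then obtain t where t: "t \<in> critical_set K" "t < b"
    using eventually_happens[of _ "at_left b"] by (auto simp: trivial_limit_at_left_real)
  have "ereal t < critical_b K" using t b by (metis less_ereal.simps(1) order_less_le_trans)
  then show False using not_in_critical_set t by blast
qed

section \<open>Generating functions for one fixed tilt\<close>

locale tilted_renewal =
  fixes K :: "nat \<Rightarrow> real" and b :: real
  assumes dens: "discrete_density K" and aper: "aperiodic K" and b_pos: "b > 0"
begin

definition "c = tilt_const K b"

lemma c_gt_1: "c > 1" unfolding c_def by (rule tilted_mass(5)[OF dens b_pos])

lemmas Kd = discrete_densityD[OF dens]

text \<open>\<open>q n\<close> is \<open>exp (b n)\<close> times the tail at \<open>n\<close> of the tilted density; all generating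
  functions are rescaled so that the radius \<open>exp b\<close> becomes 1.\<close>

definition q :: "nat \<Rightarrow> real" where
  "q n = c * (\<Sum>i. K (n + 1 + i) * exp (- b * real (Suc i)))"

lemma q_summable: "summable (\<lambda>i. K (n + i) * exp (- b * real i))"
proof (rule summable_comparison_test'[of "\<lambda>i. K (n + i)" 0])
  show "summable (\<lambda>i. K (n + i))"
    using summable_ignore_initial_segment[OF Kd(3), of n] by (simp add: add.commute)
  show "norm (K (n + i) * exp (- b * real i)) \<le> K (n + i)" for i
    using Kd(2)[of "n + i"] b_pos by (simp add: mult_left_le)
qed

lemma q_eq: "q n = c * ((\<Sum>i. K (n + i) * exp (- b * real i)) - K n)"
  using suminf_split_head[OF q_summable[of n]] by (simp add: q_def)

lemma q_nonneg: "0 \<le> q n"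
  unfolding q_eq using suminf_split_head[OF q_summable[of n]] c_gt_1 Kd(2)
    suminf_nonneg[OF summable_Suc_iff[THEN iffD2, OF q_summable[of n]]]
  by (intro mult_nonneg_nonneg) auto

lemma q_0: "q 0 = 1"
  using tilted_mass(6)[OF dens b_pos] Kd(1) by (simp add: q_eq c_def)

lemma q_rec: "exp b * q n = c * K (Suc n) + q (Suc n)"
proof -
  have "exp b * (K (n + 1 + i) * exp (- b * real (Suc i))) = K (Suc n + i) * exp (- b * real i)" for i
  proof -
    have "exp b * exp (- b * real (Suc i)) = exp (- b * real i)"
      by (simp add: algebra_simps flip: exp_add)
    then show ?thesis by (simp add: mult.left_commute)
  qed
  moreover have "summable (\<lambda>i. K (n + 1 + i) * exp (- b * real (Suc i)))"
    using summable_Suc_iff[THEN iffD2, OF q_summable[of n]] by simp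
  note suminf_mult[OF this, of "exp b"]
  ultimately have "exp b * (\<Sum>i. K (n + 1 + i) * exp (- b * real (Suc i))) = (\<Sum>i. K (Suc n + i) * exp (- b * real i))"
    by (simp only:)
  then have "exp b * q n = c * (\<Sum>i. K (Suc n + i) * exp (- b * real i))"
    by (simp add: q_def mult.left_commute)
  then show ?thesis by (simp add: q_eq[of "Suc n"] algebra_simps)
qed

lemma K_le_q: "c * K (Suc n) \<le> exp b * q n"
  using q_rec[of n] q_nonneg[of "Suc n"] by simp

lemma q_le: "q n \<le> c"
proof -
  have "(\<Sum>i. K (n + i) * exp (- b * real i)) \<le> (\<Sum>i. K (n + i))"
    using Kd(2) b_pos summable_ignore_initial_segment[OF Kd(3), of n]
    by (intro suminf_le q_summable) (auto simp: add.commute mult_left_le)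
  also have "\<dots> \<le> 1"
    using suminf_split_initial_segment[OF Kd(3), of n] Kd(4) sum_nonneg[of "{..<n}" K] Kd(2)
    by (simp add: add.commute)
  finally have "c * ((\<Sum>i. K (n + i) * exp (- b * real i)) - K n) \<le> c * 1"
    using c_gt_1 Kd(2)[of n] by (intro mult_left_mono) auto
  then show ?thesis by (simp add: q_eq)
qed

text \<open>Summing \<open>q_rec\<close> over \<open>n < N\<close> bounds \<open>exp b\<close> times
  the partial sum by the partial sum plus \<open>2 * c\<close>: one \<open>c\<close> for the mass of
  \<open>K\<close>, the other for the end term \<open>q N\<close>. Since \<open>exp b > 1\<close>
  this can be solved for the partial sum, whether or not \<open>K\<close> has a finite mean.\<close>

lemma summable_q: "summable q"
proof (rule summableI_nonneg_bounded)
  fix N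
  have "exp b * (\<Sum>n<N. q n) = (\<Sum>n<N. c * K (Suc n)) + (\<Sum>n<N. q (Suc n))"
    by (simp add: sum_distrib_left q_rec sum.distrib)
  moreover have "(\<Sum>n<N. q (Suc n)) \<le> (\<Sum>n<N. q n) + c"
    using sum.lessThan_Suc_shift[of q N] q_le[of N] q_0 by simp
  moreover have "(\<Sum>n<N. c * K (Suc n)) \<le> c * 1"
  proof -
    have "(\<Sum>n<N. K (Suc n)) \<le> (\<Sum>n<Suc N. K n)" by (subst sum.lessThan_Suc_shift) (simp add: Kd)
    also have "\<dots> \<le> 1" using sum_le_suminf[OF Kd(3), of "{..<Suc N}"] Kd by simp
    finally show ?thesis unfolding sum_distrib_left[symmetric] using c_gt_1 by (intro mult_left_mono) auto
  qed
  ultimately have "(exp b - 1) * (\<Sum>n<N. q n) \<le> 2 * c"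
    unfolding left_diff_distrib by linarith
  then show "(\<Sum>n<N. q n) \<le> 2 * c / (exp b - 1)"
    using b_pos by (simp add: field_simps)
qed (rule q_nonneg)

definition Q :: "complex fps" where "Q = Abs_fps (\<lambda>n. of_real (q n))"

definition u :: "nat \<Rightarrow> real" where "u = renewal_mass (tilted K b)"

definition v :: "nat \<Rightarrow> real" where
  "v n = exp (b * real n) * (u n - (if n = 0 then 0 else u (n - 1)))"

definition V :: "complex fps" where "V = Abs_fps (\<lambda>n. of_real (v n))"

lemma Q_abs_summable: "summable (\<lambda>n. norm (fps_nth Q n))"
  using summable_q q_nonneg by (simp add: Q_def)

abbreviation "lin \<equiv> 1 - fps_const (of_real (exp b)) * fps_X :: complex fps"
abbreviation "Kf \<equiv> Abs_fps (\<lambda>n. complex_of_real (K n))"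

lemma fps_lin_mult_nth: "fps_nth (lin * f) n = fps_nth f n - (if n = 0 then 0 else of_real (exp b) * fps_nth f (n - 1))"
  by (simp add: algebra_simps)

lemma Q_fps_eq: "lin * Q = 1 - fps_const (of_real c) * Kf"
proof (rule fps_ext)
  fix n
  show "fps_nth (lin * Q) n = fps_nth (1 - fps_const (of_real c) * Kf) n"
  proof (cases n)
    case 0
    then show ?thesis using q_0 Kd(1) by (simp add: Q_def)
  next
    case (Suc m)
    have "q (Suc m) - exp b * q m = - (c * K (Suc m))" using q_rec[of m] by simp
    then show ?thesis unfolding fps_lin_mult_nth
      by (simp add: Q_def Suc) (metis of_real_diff of_real_minus of_real_mult)
  qed
qed

lemma renewal_fps_eq:
  "Abs_fps (\<lambda>n. complex_of_real (exp (b * real n) * u n)) * (1 - fps_const (of_real c) * Kf) = 1"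
proof (rule fps_ext)
  fix n
  let ?p = "\<lambda>n. exp (b * real n) * u n"
  have d: "discrete_density (tilted K b)" using dens b_pos by (intro discrete_density_tilted) auto
  have p0: "?p 0 = 1" by (simp add: u_def renewal_mass_0)
  have rec: "?p n = (\<Sum>j\<le>n. ?p j * (c * K (n - j)))" if "n \<ge> 1"
  proof -
    have "?p n = (\<Sum>j<n. exp (b * real n) * (u j * tilted K b (n - j)))"
      unfolding u_def renewal_mass_rec[OF d that] by (simp add: sum_distrib_left)
    also have "\<dots> = (\<Sum>j<n. ?p j * (c * K (n - j)))"
    proof (rule sum.cong[OF refl])
      fix j assume "j \<in> {..<n}"
      then have "exp (b * real n) * exp (- b * real (n - j)) = exp (b * real j)"
        by (simp add: of_nat_diff algebra_simps flip: exp_add)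
      then show "exp (b * real n) * (u j * tilted K b (n - j)) = ?p j * (c * K (n - j))"
        by (simp add: tilted_def c_def[symmetric] algebra_simps)
    qed
    also have "\<dots> = (\<Sum>j\<le>n. ?p j * (c * K (n - j)))"
      by (simp add: Kd lessThan_Suc_atMost[symmetric])
    finally show ?thesis .
  qed
  have "fps_nth (Abs_fps (\<lambda>n. complex_of_real (?p n)) * (1 - fps_const (of_real c) * Kf)) n =
      of_real (?p n) - (\<Sum>j\<le>n. of_real (?p j) * (of_real c * of_real (K (n - j))))"
    by (simp add: right_diff_distrib fps_mult_nth[of _ "fps_const _ * _"] atLeast0AtMost)
  also have "\<dots> = of_real (?p n - (\<Sum>j\<le>n. ?p j * (c * K (n - j))))" by simp
  also have "?p n - (\<Sum>j\<le>n. ?p j * (c * K (n - j))) = (if n = 0 then 1 else 0)"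
    using rec p0 Kd(1) by (cases "n = 0") auto
  finally show "fps_nth (Abs_fps (\<lambda>n. complex_of_real (?p n)) * (1 - fps_const (of_real c) * Kf)) n = fps_nth 1 n"
    by simp
qed

text \<open>The generating function of \<open>exp (b n) u n\<close> has a pole at
  \<open>exp (- b)\<close>, reflecting the nonzero limit of \<open>u\<close>. Differencing
  \<open>u\<close> multiplies it by \<open>lin\<close>, which vanishes there, and passing from
  \<open>1 - c K\<close> to \<open>Q\<close> divides by the same factor, so it cancels in the
  product.\<close>

lemma V_mult_Q: "V * Q = 1"
proof -
  let ?P = "Abs_fps (\<lambda>n. complex_of_real (exp (b * real n) * u n))"
  have "V = lin * ?P"
  proof (rule fps_ext)
    fix n
    have "v n = exp (b * real n) * u n - (if n = 0 then 0 else exp b * (exp (b * real (n - 1)) * u (n - 1)))"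
      by (cases n) (auto simp: v_def algebra_simps exp_add)
    then show "fps_nth V n = fps_nth (lin * ?P) n"
      unfolding fps_lin_mult_nth by (cases n) (simp_all add: V_def)
  qed
  then have "V * Q = ?P * (lin * Q)" by (simp only: mult_ac)
  then show ?thesis unfolding Q_fps_eq renewal_fps_eq .
qed

lemma Q_nth_0: "fps_nth Q 0 = 1" by (simp add: Q_def q_0)

lemma V_eq: "V = inverse Q"
  using fps_inverse_unique[of Q V] V_mult_Q by (simp add: mult.commute)

lemma eval_Q:
  assumes "norm w \<le> 1"
  shows "(1 - of_real (exp b) * w) * eval_fps Q w = 1 - of_real c * ztrans K w"
proof -
  have slin: "summable (\<lambda>n. norm (fps_nth lin n))"
    by (rule summable_finite[of "{..1}"]) (auto simp: not_le)
  have "eval_fps (lin * Q) w = eval_fps lin w * eval_fps Q w"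
    by (rule eval_fps_mult_closed_disc[OF slin Q_abs_summable assms])
  moreover have "eval_fps lin w = 1 - of_real (exp b) * w"
    unfolding eval_fps_def by (subst suminf_finite[of "{..1}"]) (auto simp: not_le)
  moreover have "eval_fps (1 - fps_const (of_real c) * Kf) w = 1 - of_real c * ztrans K w"
  proof -
    have "(\<lambda>n. fps_nth 1 n * w ^ n) sums 1"
      using sums_If_finite_set[of "{0::nat}" "\<lambda>n. 1 :: complex"] by (simp add: if_distrib[of "\<lambda>x. x * _"] cong: if_cong)
    from sums_diff[OF this sums_mult[OF ztrans_sums[OF dens assms], of "of_real c"]]
    have "(\<lambda>n. fps_nth (1 - fps_const (of_real c) * Kf) n * w ^ n) sums (1 - of_real c * ztrans K w)"
      by (simp add: algebra_simps)
    then show ?thesis unfolding eval_fps_def by (rule sums_unique[symmetric])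
  qed
  ultimately show ?thesis unfolding Q_fps_eq by simp
qed

text \<open>At \<open>w = 1\<close> the right-hand side of \<open>eval_Q\<close> is explicit because
  \<open>K\<close> has mass 1. The factor \<open>c - 1\<close> of the final constant originates
  here.\<close>

lemma eval_Q_1: "eval_fps Q 1 = of_real ((c - 1) / (exp b - 1))"
proof -
  have "ztrans K 1 = 1" using suminf_of_real[OF Kd(3)] Kd(4) by (simp add: ztrans_def)
  then have "(1 - of_real (exp b)) * eval_fps Q 1 = 1 - of_real c" using eval_Q[of 1] by simp
  moreover have "complex_of_real (exp b) \<noteq> 1" using b_pos by (metis exp_eq_one_iff less_irrefl of_real_eq_1_iff)
  ultimately show ?thesis by (simp add: field_simps)
qed

text \<open>A zero of \<open>Q\<close> solves \<open>c * ztrans K w = 1\<close>, an equation also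
  satisfied by \<open>exp (- b)\<close>. If the modulus were at most \<open>exp (- b)\<close>, then
  \<open>exp b * w\<close> would lie in the closed unit disc and be sent to 1 by the transform of an
  aperiodic density, so \<open>w\<close> would be \<open>exp (- b)\<close> itself.\<close>

lemma eval_Q_zero:
  assumes w: "norm w \<le> 1" "eval_fps Q w = 0"
  shows "exp (- b) < norm w \<and> ztrans K w = ztrans K (of_real (exp (- b)))"
proof -
  have 1: "of_real c * ztrans K w = 1" using eval_Q[OF w(1)] w(2) by simp
  have "complex_of_real c * ztrans K (of_real (exp (- b))) = 1"
    unfolding tilted_mass(4)[OF dens b_pos] c_def
    by (metis tilted_mass(6)[OF dens b_pos] of_real_1 of_real_mult)
  with 1 have eq: "ztrans K w = ztrans K (of_real (exp (- b)))"
    by (metis mult_cancel_left mult_zero_left zero_neq_one)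
  have "exp (- b) < norm w"
  proof (rule ccontr)
    assume "\<not> exp (- b) < norm w"
    then have "exp b * norm w \<le> exp b * exp (- b)" by simp
    then have nz: "norm (of_real (exp b) * w) \<le> 1" by (simp add: norm_mult flip: exp_add)
    have "discrete_density (tilted K b)" using dens b_pos by (intro discrete_density_tilted) auto
    moreover have "aperiodic (tilted K b)"
    proof -
      have "tilted K b n > 0 \<longleftrightarrow> K n > 0" for n
        using c_gt_1 by (simp add: tilted_def c_def[symmetric] zero_less_mult_iff)
      then show ?thesis using aper by (simp add: aperiodic_def)
    qed
    moreover have "ztrans (tilted K b) (of_real (exp b) * w) = 1"
      using ztrans_tilted[OF dens w(1), of b] 1 by (simp only: c_def)
    ultimately have "of_real (exp b) * w = 1"
      using ztrans_eq_one_imp nz by blast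
    moreover have "complex_of_real (exp (- b)) * of_real (exp b) = 1"
      by (simp flip: of_real_mult exp_add)
    ultimately have w_eq: "w = of_real (exp (- b))"
      by (metis mult.assoc mult.left_neutral mult.right_neutral)
    \<comment> \<open>At \<open>exp (- b)\<close> both sides of \<open>eval_Q\<close> vanish and
      decide nothing, so \<open>Q\<close> is inspected directly: nonnegative coefficients,
      \<open>q 0 = 1\<close>, and a positive argument.\<close>
    have s: "summable (\<lambda>n. q n * exp (- b) ^ n)"
      using q_nonneg b_pos by (intro summable_comparison_test'[OF summable_q, of 0]) (auto simp: power_le_one intro!: mult_left_le)
    have "eval_fps Q w = of_real (\<Sum>n. q n * exp (- b) ^ n)"
      unfolding suminf_of_real[OF s] eval_fps_def by (simp add: Q_def w_eq)
    moreover have "(\<Sum>n. q n * exp (- b) ^ n) > 0"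
      using q_nonneg q_0 by (intro suminf_pos2[OF s, of 0]) auto
    ultimately show False using w(2) by simp
  qed
  with eq show ?thesis by simp
qed

lemma eval_Q_nonzero_closed:
  assumes "ereal b < critical_b K" "norm w \<le> 1"
  shows "eval_fps Q w \<noteq> 0"
  using eval_Q_zero[OF assms(2)] not_in_critical_set[OF assms(1)] assms(2) b_pos
  unfolding critical_set_iff[OF dens] by blast

lemma eval_Q_nonzero_open:
  assumes "ereal b \<le> critical_b K" "norm w < 1"
  shows "eval_fps Q w \<noteq> 0"
  using eval_Q_zero[of w] no_interior_critical_point[OF dens b_pos assms(1), of w] assms(2) by auto

end

section \<open>Exponential rates\<close>

lemma Im_ztrans:
  assumes "discrete_density K" "norm z \<le> 1"
  shows "Im (ztrans K z) = (\<Sum>n. K n * Im (z ^ n))"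
proof -
  have "(\<lambda>n. Im (complex_of_real (K n) * z ^ n)) sums Im (ztrans K z)"
    by (rule sums_Im[OF ztrans_sums[OF assms]])
  then show ?thesis by (simp add: sums_iff)
qed

text \<open>If critical values tended to 0, the solutions \<open>w k\<close> would accumulate at a
  point where the transform equals 1, and by aperiodicity this is the point 1. Write such a solution
  near 1 as \<open>exp (Ln z)\<close> with modulus \<open>exp (- s)\<close> and argument \<theta>.
  Its transform is real, so \<theta> > 0 contradicts the positive imaginary part, \<theta> < 0 does
  so because the sine is odd, and \<theta> = 0 contradicts strict monotonicity of the transform on
  the positive reals, since \<open>s < b\<close>.\<close>

theorem critical_b_pos:
  assumes K: "discrete_density K" "aperiodic K" and \<alpha>: "\<alpha> > 0"
    and pos: "eventually (\<lambda>t. tail K (nat \<lfloor>t::real\<rfloor>) > 0) at_top"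
    and lim: "\<And>c. c > 0 \<Longrightarrow> ((\<lambda>t. tail K (nat \<lfloor>c * t\<rfloor>) / tail K (nat \<lfloor>t\<rfloor>)) \<longlongrightarrow> c powr - \<alpha>) at_top"
  shows "critical_b K > 0"
proof -
  note Kd = discrete_densityD[OF K(1)]
  obtain \<epsilon> where \<epsilon>: "\<epsilon> > 0"
    "\<And>s \<theta>. 0 \<le> s \<Longrightarrow> s < \<epsilon> \<Longrightarrow> 0 < \<theta> \<Longrightarrow> \<theta> < \<epsilon> \<Longrightarrow> 0 < (\<Sum>n. K n * (exp (- s * real n) * sin (real n * \<theta>)))"
    by (rule ztrans_imaginary_part_pos[OF K(1) \<alpha> pos lim]) (assumption | rule that)+
  have "\<exists>\<beta>>0. \<forall>b\<in>critical_set K. \<beta> \<le> b"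
  proof (rule ccontr)
    assume neg: "\<not> ?thesis"
    have "\<forall>k. \<exists>b. b \<in> critical_set K \<and> b < 1 / real (Suc k)"
    proof
      fix k
      have "1 / real (Suc k) > 0" by simp
      then show "\<exists>b. b \<in> critical_set K \<and> b < 1 / real (Suc k)" using neg by (meson not_le)
    qed
    from choice[OF this] obtain b where b: "\<forall>k. b k \<in> critical_set K \<and> b k < 1 / real (Suc k)" ..
    have "\<forall>k. \<exists>w. exp (- b k) < norm w \<and> norm w \<le> 1 \<and> ztrans K w = ztrans K (of_real (exp (- b k)))"
      using b critical_set_iff[OF K(1)] by blast
    from choice[OF this] obtain w
      where w: "\<forall>k. exp (- b k) < norm (w k) \<and> norm (w k) \<le> 1 \<and> ztrans K (w k) = ztrans K (of_real (exp (- b k)))" ..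
    have b0: "b k > 0" for k using b critical_set_iff[OF K(1)] by blast
    have blim: "b \<longlonglongrightarrow> 0"
    proof (rule tendsto_sandwich[of "\<lambda>_. 0" b _ "\<lambda>k. 1 / real (Suc k)"])
      show "(\<lambda>k. 1 / real (Suc k)) \<longlonglongrightarrow> 0"
        using LIMSEQ_inverse_real_of_nat by (simp add: inverse_eq_divide)
    qed (use b b0 in \<open>simp_all add: less_imp_le\<close>)
    have "\<forall>k. w k \<in> cball 0 1" using w by simp
    then obtain l r where l: "l \<in> cball 0 1" and r: "strict_mono r" "(w \<circ> r) \<longlonglongrightarrow> l"
      using compact_cball[of "0 :: complex" 1] unfolding compact_def by metis
    have "(\<lambda>k. ztrans K ((w \<circ> r) k)) \<longlonglongrightarrow> ztrans K l"
      by (rule continuous_on_tendsto_compose[OF continuous_on_ztrans[OF K(1)] r(2) l]) (use w in simp)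
    moreover have "(\<lambda>k. ztrans K (of_real (exp (- b (r k))))) \<longlonglongrightarrow> ztrans K (of_real (exp (- 0)))"
    proof (rule continuous_on_tendsto_compose[OF continuous_on_ztrans[OF K(1)]])
      have "(\<lambda>k. b (r k)) \<longlonglongrightarrow> 0" using LIMSEQ_subseq_LIMSEQ[OF blim r(1)] by (simp add: comp_def)
      then show "(\<lambda>k. complex_of_real (exp (- b (r k)))) \<longlonglongrightarrow> of_real (exp (- 0))" by (intro tendsto_intros)
    qed (use b0 in \<open>auto simp: less_imp_le\<close>)
    moreover have "ztrans K ((w \<circ> r) k) = ztrans K (of_real (exp (- b (r k))))" for k using w by simp
    ultimately have "ztrans K l = ztrans K (of_real (exp (- 0)))" using LIMSEQ_unique by simp
    also have "\<dots> = 1" using suminf_of_real[OF Kd(3)] Kd(4) by (simp add: ztrans_def)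
    finally have z1: "ztrans K l = 1" .
    have "l = 1" by (rule ztrans_eq_one_imp[OF K _ z1]) (use l in simp)
    then have wl: "(\<lambda>k. w (r k)) \<longlonglongrightarrow> 1" using r(2) by (simp add: comp_def)
    then have "(\<lambda>k. Ln (w (r k))) \<longlonglongrightarrow> Ln 1" by (intro tendsto_intros) auto
    then have "eventually (\<lambda>k. dist (Ln (w (r k))) (Ln 1) < \<epsilon>) sequentially" using \<epsilon>(1) by (rule tendstoD)
    then obtain k where k: "norm (Ln (w (r k))) < \<epsilon>" by (auto dest: eventually_happens)
    define z where "z = w (r k)"
    have z: "exp (- b (r k)) < norm z" "norm z \<le> 1" "ztrans K z = ztrans K (of_real (exp (- b (r k))))"
      using w by (auto simp: z_def)
    define \<beta> where "\<beta> = b (r k)"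
    have \<beta>: "\<beta> > 0" by (simp add: \<beta>_def b0)
    have "z \<noteq> 0" using z(1) by (metis exp_gt_zero norm_zero not_less_iff_gr_or_eq)
    then have exp_z: "exp (Ln z) = z" by simp
    define s \<theta> where "s = - Re (Ln z)" and "\<theta> = Im (Ln z)"
    have "norm z = exp (- s)" using \<open>z \<noteq> 0\<close> by (simp add: s_def)
    then have s: "s \<ge> 0" using z(2) by simp
    have s\<theta>: "s < \<epsilon>" "\<bar>\<theta>\<bar> < \<epsilon>"
      using k abs_Re_le_cmod[of "Ln z"] abs_Im_le_cmod[of "Ln z"] unfolding s_def \<theta>_def z_def by linarith+
    have pow: "z ^ n = exp (of_nat n * Ln z)" for n using exp_z by (simp add: exp_of_nat_mult)
    have Im_pow: "Im (z ^ n) = exp (- s * real n) * sin (real n * \<theta>)" for n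
      unfolding pow by (simp add: Im_exp s_def \<theta>_def mult.commute)
    have Im0: "(\<Sum>n. K n * (exp (- s * real n) * sin (real n * \<theta>))) = 0"
    proof -
      have "Im (ztrans K z) = 0"
        unfolding z(3) using tilted_mass(4)[OF K(1), of "b (r k)"] b0 by simp
      then show ?thesis unfolding Im_ztrans[OF K(1) z(2)] Im_pow .
    qed
    consider "\<theta> > 0" | "\<theta> < 0" | "\<theta> = 0" by linarith
    then show False
    proof cases
      case 1
      then show False using \<epsilon>(2)[OF s s\<theta>(1), of \<theta>] s\<theta>(2) Im0 by simp
    next
      case 2
      have "(\<Sum>n. K n * (exp (- s * real n) * sin (real n * (- \<theta>)))) = (\<Sum>n. - (K n * (exp (- s * real n) * sin (real n * \<theta>))))"
        by simp
      also have "\<dots> = - 0"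
      proof -
        have "summable (\<lambda>n. K n * (exp (- s * real n) * sin (real n * \<theta>)))"
          using sums_Im[OF ztrans_sums[OF K(1) z(2)]] Im_pow by (simp add: sums_iff)
        from suminf_minus[OF this] show ?thesis unfolding Im0 .
      qed
      finally show False using \<epsilon>(2)[OF s s\<theta>(1), of "- \<theta>"] s\<theta>(2) 2 by simp
    next
      case 3
      have "Ln z = of_real (- s)" using 3 by (simp add: complex_eq_iff s_def \<theta>_def)
      then have z_eq: "z = of_real (exp (- s))" using exp_z by (metis exp_of_real)
      have s\<beta>: "s < \<beta>" using z(1) \<open>norm z = exp (- s)\<close> by (simp add: \<beta>_def)
      have sm: "summable (\<lambda>n. K n * exp (- s * real n))"
        by (rule summable_comparison_test'[OF Kd(3), of 0]) (use Kd(2) s in \<open>auto intro!: mult_left_le\<close>)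
      have "ztrans K z = (\<Sum>n. of_real (K n * exp (- s * real n)))"
      proof -
        have e: "exp (- s) ^ n = exp (- s * real n)" for n by (simp add: mult.commute flip: exp_of_nat_mult)
        show ?thesis unfolding ztrans_def z_eq of_real_power[symmetric] e of_real_mult[symmetric] ..
      qed
      also have "\<dots> = of_real (\<Sum>n. K n * exp (- s * real n))" by (rule suminf_of_real[OF sm, symmetric])
      finally have "(\<Sum>n. K n * exp (- s * real n)) = (\<Sum>n. K n * exp (- \<beta> * real n))"
        using z(3) tilted_mass(4)[OF K(1) \<beta>] by (simp add: \<beta>_def)
      moreover obtain m where m: "K m > 0" "m \<noteq> 0"
      proof -
        have "K m = 0" if "\<And>m. K m > 0 \<Longrightarrow> m = 0" for m
          using that[of m] Kd(1) Kd(2)[of m] by (cases "K m > 0") auto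
        moreover have "K \<noteq> (\<lambda>_. 0)" using Kd(4) by auto
        ultimately show thesis using that by (metis ext)
      qed
      have "0 < (\<Sum>n. K n * exp (- s * real n) - K n * exp (- \<beta> * real n))"
      proof (rule suminf_pos2[OF summable_diff[OF sm tilted_mass(1)[OF K(1) \<beta>]], of m])
        show "0 \<le> K n * exp (- s * real n) - K n * exp (- \<beta> * real n)" for n
          using s\<beta> Kd(2)[of n] by (auto intro!: mult_left_mono mult_right_mono)
        show "0 < K m * exp (- s * real m) - K m * exp (- \<beta> * real m)" using m s\<beta> by simp
      qed
      ultimately show False using suminf_diff[OF sm tilted_mass(1)[OF K(1) \<beta>]] by simp
    qed
  qed
  then obtain \<beta> where \<beta>: "\<beta> > 0" "\<forall>b\<in>critical_set K. \<beta> \<le> b" by blast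
  have "ereal \<beta> \<le> critical_b K"
    unfolding critical_b_def critical_set_def[symmetric] by (intro Inf_greatest) (use \<beta> in auto)
  moreover have "0 < ereal \<beta>" using \<beta> by simp
  ultimately show ?thesis by (rule less_le_trans[rotated])
qed

section \<open>Exponential rates of real sequences\<close>

lemma limsup_elog_le:
  assumes C: "C > 0" and \<rho>: "\<rho> > 0" and le: "\<And>n. x n \<le> C * \<rho> ^ n"
  shows "limsup (\<lambda>n. ereal (1 / real n) * elog (x n)) \<le> ereal (ln \<rho>)"
proof -
  have "limsup (\<lambda>n. ereal (1 / real n) * elog (x n)) \<le> limsup (\<lambda>n. ereal (ln C * (1 / real n) + ln \<rho>))"
  proof (rule Limsup_mono)
    show "eventually (\<lambda>n. ereal (1 / real n) * elog (x n) \<le> ereal (ln C * (1 / real n) + ln \<rho>)) sequentially"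
      using eventually_gt_at_top[of 0]
    proof eventually_elim
      case (elim n)
      show ?case
      proof (cases "x n \<le> 0")
        case True
        then show ?thesis using elim by (simp add: elog_def)
      next
        case False
        then have "ln (x n) \<le> ln (C * \<rho> ^ n)" using le[of n] C \<rho> by (subst ln_le_cancel_iff) auto
        also have "\<dots> = ln C + real n * ln \<rho>" using C \<rho> by (simp add: ln_mult ln_realpow)
        finally have "1 / real n * ln (x n) \<le> 1 / real n * (ln C + real n * ln \<rho>)"
          by (intro mult_left_mono) auto
        then show ?thesis using False elim by (simp add: elog_def field_simps)
      qed
    qed
  qed
  also have "(\<lambda>n. ln C * (1 / real n) + ln \<rho>) \<longlonglongrightarrow> ln C * 0 + ln \<rho>"
    by (intro tendsto_intros lim_1_over_n)
  then have "limsup (\<lambda>n. ereal (ln C * (1 / real n) + ln \<rho>)) = ereal (ln \<rho>)"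
    by (intro lim_imp_Limsup) auto
  finally show ?thesis .
qed

lemma limsup_elog_lessD:
  assumes "limsup (\<lambda>n. ereal (1 / real n) * elog (x n)) < ereal (- b)"
  obtains b' where "b' > b" "eventually (\<lambda>n. x n \<le> exp (- b' * real n)) sequentially"
proof -
  obtain a where a: "limsup (\<lambda>n. ereal (1 / real n) * elog (x n)) < ereal a" "ereal a < ereal (- b)"
    using ereal_dense2[OF assms] by auto
  have "eventually (\<lambda>n. x n \<le> exp (- (- a) * real n)) sequentially"
    using Limsup_lessD[OF a(1)] eventually_gt_at_top[of 0]
  proof eventually_elim
    case (elim n)
    show ?case
    proof (cases "x n \<le> 0")
      case True
      then show ?thesis using exp_gt_zero[of "- (- a) * real n"] by linarith
    next
      case False
      then have "1 / real n * ln (x n) < a" using elim by (simp add: elog_def)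
      then have "ln (x n) < a * real n" using elim by (simp add: field_simps)
      then have "exp (ln (x n)) < exp (a * real n)" by simp
      then show ?thesis using False by simp
    qed
  qed
  then show thesis using a(2) by (intro that[of "- a"]) auto
qed

lemma geometric_increments_converge:
  fixes x :: "nat \<Rightarrow> real"
  assumes \<rho>: "0 < \<rho>" "\<rho> < 1" and C: "C > 0" and le: "\<And>n. \<bar>x (Suc n) - x n\<bar> \<le> C * \<rho> ^ n"
  shows "convergent x" "\<And>n. \<bar>x n - lim x\<bar> \<le> C / (1 - \<rho>) * \<rho> ^ n"
proof -
  have geo: "(\<lambda>i. C * \<rho> ^ n * \<rho> ^ i) sums (C * \<rho> ^ n * (1 / (1 - \<rho>)))" for n
    using \<rho> by (intro sums_mult geometric_sums) auto
  have s: "summable (\<lambda>i. \<bar>x (Suc (i + n)) - x (i + n)\<bar>)" for n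
    by (rule summable_comparison_test'[OF sums_summable[OF geo[of n]], of 0])
       (use le[of "_ + n"] in \<open>simp add: power_add mult_ac\<close>)
  have "convergent (\<lambda>n. \<Sum>i<n. x (Suc i) - x i)"
    using summable_norm_cancel[of "\<lambda>i. x (Suc i) - x i"] s[of 0] by (simp add: summable_iff_convergent)
  then have "convergent (\<lambda>n. x n - x 0)" by (simp add: sum_lessThan_telescope)
  then have "convergent (\<lambda>n. (x n - x 0) + x 0)" by (intro convergent_add convergent_const)
  then show c: "convergent x" by simp
  then have l: "x \<longlonglongrightarrow> lim x" by (simp add: convergent_LIMSEQ_iff)
  fix n
  have "(\<lambda>i. x (Suc (i + n)) - x (i + n)) sums (lim x - x (0 + n))"
    using telescope_sums[of "\<lambda>i. x (i + n)" "lim x"] LIMSEQ_ignore_initial_segment[OF l, of n] by simp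
  then have "\<bar>x n - lim x\<bar> = \<bar>\<Sum>i. x (Suc (i + n)) - x (i + n)\<bar>" by (simp add: sums_iff abs_minus_commute)
  also have "\<dots> \<le> (\<Sum>i. \<bar>x (Suc (i + n)) - x (i + n)\<bar>)" by (rule summable_rabs[OF s])
  also have "\<dots> \<le> (\<Sum>i. C * \<rho> ^ n * \<rho> ^ i)"
    using le[of "_ + n"] by (intro suminf_le s sums_summable[OF geo]) (simp add: power_add mult_ac)
  also have "\<dots> = C / (1 - \<rho>) * \<rho> ^ n" using sums_unique[OF geo[of n]] by simp
  finally show "\<bar>x n - lim x\<bar> \<le> C / (1 - \<rho>) * \<rho> ^ n" .
qed

text \<open>From \<open>n\<close> to \<open>2 * n\<close> the tail loses at most the factor
  \<open>a\<close>, while the power of \<open>s\<close> gains another \<open>s ^ n\<close>. Once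
  \<open>s ^ n \<ge> 2 / a\<close>, the product therefore at least doubles, and iteration along
  \<open>2 ^ k * N\<close> exceeds any bound.\<close>

lemma tail_not_exponentially_small:
  assumes \<alpha>: "\<alpha> > 0" and s: "s > 1" and bd: "\<And>N. tail K N * s ^ N \<le> C"
    and pos: "eventually (\<lambda>t. tail K (nat \<lfloor>t::real\<rfloor>) > 0) at_top"
    and lim: "((\<lambda>t. tail K (nat \<lfloor>2 * (t::real)\<rfloor>) / tail K (nat \<lfloor>t\<rfloor>)) \<longlongrightarrow> 2 powr - \<alpha>) at_top"
  shows False
proof -
  define a :: real where "a = 2 powr - \<alpha> / 2"
  have a: "a > 0" "a < 2 powr - \<alpha>" by (auto simp: a_def)
  have 1: "eventually (\<lambda>n. tail K n > 0) sequentially"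
    using eventually_compose_filterlim[OF pos filterlim_real_sequentially] by simp
  have "eventually (\<lambda>n. a < tail K (nat \<lfloor>2 * real n\<rfloor>) / tail K (nat \<lfloor>real n\<rfloor>)) sequentially"
    by (rule order_tendstoD(1)[OF filterlim_compose[OF lim filterlim_real_sequentially] a(2)])
  moreover have "nat \<lfloor>2 * real n\<rfloor> = 2 * n" for n
    by (metis floor_of_nat nat_int of_nat_mult of_nat_numeral)
  ultimately have 2: "eventually (\<lambda>n. a < tail K (2 * n) / tail K n) sequentially" by simp
  obtain k where k: "2 / a < s ^ k" using real_arch_pow[OF s] by blast
  have "2 / a \<le> s ^ n" if "n \<ge> k" for n
    using k power_increasing[OF that, of s] s by linarith
  then have "eventually (\<lambda>n. s ^ n \<ge> 2 / a) sequentially" by (auto simp: eventually_sequentially)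
  with 1 2 have "eventually (\<lambda>n. tail K n > 0 \<and> a < tail K (2 * n) / tail K n \<and> s ^ n \<ge> 2 / a \<and> n > 0) sequentially"
    using eventually_gt_at_top[of 0] by eventually_elim auto
  then obtain N where N: "\<And>n. n \<ge> N \<Longrightarrow> tail K n > 0 \<and> a < tail K (2 * n) / tail K n \<and> s ^ n \<ge> 2 / a \<and> n > 0"
    by (auto simp: eventually_sequentially)
  define h where "h = (\<lambda>n. tail K n * s ^ n)"
  have step: "2 * h n \<le> h (2 * n)" if "n \<ge> N" for n
  proof -
    note Nn = N[OF that]
    have "a * tail K n < tail K (2 * n)"
      using conjunct1[OF Nn] conjunct1[OF conjunct2[OF Nn]] by (simp only: pos_less_divide_eq)
    then have 1: "(a * tail K n) * (s ^ n * s ^ n) \<le> tail K (2 * n) * (s ^ n * s ^ n)"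
      using s by (intro mult_right_mono) auto
    have "2 \<le> a * s ^ n" using Nn a by (simp add: field_simps)
    then have 2: "2 * (tail K n * s ^ n) \<le> (a * s ^ n) * (tail K n * s ^ n)"
      using Nn s by (intro mult_right_mono) auto
    have 3: "(a * s ^ n) * (tail K n * s ^ n) = (a * tail K n) * (s ^ n * s ^ n)" by (simp only: mult_ac)
    have 4: "s ^ (2 * n) = s ^ n * s ^ n" by (simp add: mult_2 power_add)
    show ?thesis unfolding h_def 4 using 1 2 unfolding 3 by linarith
  qed
  have ge: "2 ^ k * h N \<le> h (2 ^ k * N)" for k
  proof (induction k)
    case (Suc k)
    have "2 ^ k * N \<ge> 1 * N" by (intro mult_right_mono) auto
    then have "2 * h (2 ^ k * N) \<le> h (2 * (2 ^ k * N))" by (intro step) simp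
    then show ?case using Suc by (simp add: mult.assoc)
  qed simp
  have hN: "h N > 0" using N[of N] s by (simp add: h_def)
  obtain k where "C / h N < 2 ^ k" using real_arch_pow[of 2 "C / h N"] by auto
  then have "C < 2 ^ k * h N" using hN by (simp add: field_simps)
  then show False using ge[of k] bd[of "2 ^ k * N"] by (simp add: h_def)
qed

section \<open>Upper and lower rate for a fixed tilt\<close>

context tilted_renewal
begin

lemma radius_Q: "fps_conv_radius Q \<ge> 1"
proof -
  have "summable (\<lambda>n. fps_nth Q n * 1 ^ n)"
    using summable_norm_cancel[OF Q_abs_summable] by simp
  then have "fps_conv_radius Q \<ge> ereal (norm (1 :: complex))"
    unfolding fps_conv_radius_def by (rule conv_radius_geI)
  then show ?thesis by (simp add: one_ereal_def)
qed

lemma u_diff: "u (Suc n) - u n = exp (- b * real (Suc n)) * v (Suc n)"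
  by (simp add: v_def mult.assoc[symmetric] exp_minus)

lemma u_converges_geometrically:
  assumes "ereal b \<le> critical_b K" "0 < b'" "b' < b"
  shows "convergent u" "\<exists>C>0. \<forall>n. \<bar>u n - lim u\<bar> \<le> C * exp (- b') ^ n"
proof -
  have "fps_conv_radius V \<ge> 1"
    unfolding V_eq by (rule fps_conv_radius_inverse_ge[OF _ radius_Q])
      (use eval_Q_nonzero_open[OF assms(1)] in \<open>auto simp: one_ereal_def\<close>)
  \<comment> \<open>Chosen with \<open>r * exp (- b') = exp (- b)\<close>: boundedness of
    \<open>v n * r ^ n\<close>, available for every \<open>r < 1\<close> inside the unit disc, is
    then a bound of order \<open>exp (- b' n)\<close> on the increments of \<open>u\<close>.\<close>
  define r where "r = exp (- (b - b'))"
  have r: "0 < r" "r < 1" using assms by (auto simp: r_def)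
  have "summable (\<lambda>n. norm (fps_nth V n * of_real r ^ n))"
  proof (rule norm_summable_fps)
    have "ereal (norm (complex_of_real r)) < 1" using r by (simp add: one_ereal_def)
    then show "ereal (norm (complex_of_real r)) < fps_conv_radius V" using \<open>fps_conv_radius V \<ge> 1\<close> by (rule less_le_trans)
  qed
  then have s: "summable (\<lambda>n. \<bar>v n\<bar> * r ^ n)" using r by (simp add: V_def norm_mult norm_power)
  obtain C where C: "C > 0" "\<And>n. \<bar>v n\<bar> * r ^ n \<le> C"
  proof -
    have "Bseq (\<lambda>n. \<bar>v n\<bar> * r ^ n)" using summable_imp_Bseq[OF s] .
    then obtain C where "C > 0" "\<And>n. norm (\<bar>v n\<bar> * r ^ n) \<le> C" by (auto elim: BseqE)
    then show thesis using r by (intro that[of C]) (auto simp: abs_mult)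
  qed
  define \<rho> where "\<rho> = exp (- b')"
  have \<rho>: "0 < \<rho>" "\<rho> < 1" using assms by (auto simp: \<rho>_def)
  have "\<bar>u (Suc n) - u n\<bar> \<le> C * \<rho> ^ n" for n
  proof -
    have "exp (- b * real (Suc n)) = (r * \<rho>) ^ Suc n"
      unfolding r_def \<rho>_def by (simp add: mult.commute flip: exp_add exp_of_nat_mult del: power_Suc)
    then have "\<bar>u (Suc n) - u n\<bar> = (\<bar>v (Suc n)\<bar> * r ^ Suc n) * \<rho> ^ Suc n"
      unfolding u_diff abs_mult using r \<rho> by (simp add: power_mult_distrib)
    also have "\<dots> \<le> C * \<rho> ^ Suc n" using \<rho> by (intro mult_right_mono C(2)) auto
    also have "\<dots> \<le> C * \<rho> ^ n" using C \<rho> by (intro mult_left_mono power_decreasing) auto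
    finally show ?thesis .
  qed
  note geo = geometric_increments_converge[OF \<rho> C(1) this]
  show "convergent u" by (rule geo(1))
  show "\<exists>C>0. \<forall>n. \<bar>u n - lim u\<bar> \<le> C * exp (- b') ^ n"
    using geo(2) C \<rho> by (intro exI[of _ "C / (1 - \<rho>)"]) (auto simp: \<rho>_def)
qed

lemma limsup_le:
  assumes "ereal b \<le> critical_b K"
  shows "limsup (\<lambda>n. ereal (1 / real n) * elog \<bar>u n - lim u\<bar>) \<le> ereal (- b)"
proof (rule dense_ge)
  fix y assume y: "ereal (- b) < y"
  \<comment> \<open>The geometric bound needs a rate \<open>- a\<close> strictly between 0 and
    \<open>b\<close>; staying below \<open>min y 0\<close> ensures its positivity as well as
    \<open>a < y\<close>.\<close>
  obtain a where a: "ereal (- b) < ereal a" "ereal a < min y 0"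
    using ereal_dense2[of "ereal (- b)" "min y 0"] y b_pos by auto
  then have a': "0 < - a" "- a < b" by auto
  obtain C where C: "C > 0" "\<And>n. \<bar>u n - lim u\<bar> \<le> C * exp a ^ n"
    using u_converges_geometrically(2)[OF assms a'] by auto
  have "limsup (\<lambda>n. ereal (1 / real n) * elog \<bar>u n - lim u\<bar>) \<le> ereal (ln (exp a))"
    by (rule limsup_elog_le[OF C(1) exp_gt_zero C(2)])
  also have "\<dots> \<le> y" using a(2) by (simp add: less_imp_le)
  finally show "limsup (\<lambda>n. ereal (1 / real n) * elog \<bar>u n - lim u\<bar>) \<le> y" .
qed

text \<open>Faster decay of \<open>u n - l\<close> by itself makes \<open>V\<close> absolutely
  summable beyond the unit circle; then \<open>V * Q = 1\<close> excludes zeros of \<open>V\<close>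
  in the closed disc, and by compactness in a slightly larger one. The argument covers every
  \<open>b > 0\<close>, below and above the critical value, and since it sees only increments of
  \<open>u\<close>, the number \<open>l\<close> may be arbitrary.\<close>

lemma limsup_ge:
  assumes \<alpha>: "\<alpha> > 0"
    and pos: "eventually (\<lambda>t. tail K (nat \<lfloor>t::real\<rfloor>) > 0) at_top"
    and lim: "((\<lambda>t. tail K (nat \<lfloor>2 * (t::real)\<rfloor>) / tail K (nat \<lfloor>t\<rfloor>)) \<longlongrightarrow> 2 powr - \<alpha>) at_top"
  shows "limsup (\<lambda>n. ereal (1 / real n) * elog \<bar>u n - l\<bar>) \<ge> ereal (- b)"
proof (rule ccontr)
  assume "\<not> ?thesis"
  then have "limsup (\<lambda>n. ereal (1 / real n) * elog \<bar>u n - l\<bar>) < ereal (- b)" by simp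
  then obtain b' where b': "b' > b" "eventually (\<lambda>n. \<bar>u n - l\<bar> \<le> exp (- b' * real n)) sequentially"
    by (rule limsup_elog_lessD)
  then obtain N where N: "\<And>n. n \<ge> N \<Longrightarrow> \<bar>u n - l\<bar> \<le> exp (- b' * real n)" by (auto simp: eventually_sequentially)
  \<comment> \<open>Half of the surplus rate: after multiplication by \<open>r ^ n\<close> the
    sequence \<open>v\<close> is still dominated by a geometric series of ratio
    \<open>1 / r\<close>.\<close>
  define d where "d = (b' - b) / 2"
  define r where "r = exp d"
  have r: "r > 1" using b' by (simp add: r_def d_def)
  have vb: "\<bar>v (Suc n)\<bar> * r ^ Suc n \<le> 2 * exp b' * (1 / r) ^ Suc n" if "n \<ge> N" for n
  proof -
    have "exp (- b' * real (Suc n)) \<le> exp (- b' * real n)" using b' b_pos by simp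
    then have "\<bar>u (Suc n) - u n\<bar> \<le> 2 * exp (- b' * real n)"
      using N[OF that] N[of "Suc n"] that by linarith
    then have "exp (b * real (Suc n)) * \<bar>u (Suc n) - u n\<bar> * r ^ Suc n \<le>
        exp (b * real (Suc n)) * (2 * exp (- b' * real n)) * r ^ Suc n"
      using r by (intro mult_left_mono mult_right_mono) auto
    also have "\<bar>v (Suc n)\<bar> = exp (b * real (Suc n)) * \<bar>u (Suc n) - u n\<bar>" by (simp add: v_def abs_mult)
    note this[symmetric]
    also have "exp (b * real (Suc n)) * (2 * exp (- b' * real n)) * r ^ Suc n = 2 * exp b' * (1 / r) ^ Suc n"
    proof -
      have 1: "r ^ Suc n = exp (d * real (Suc n))" unfolding r_def by (simp only: exp_of_nat_mult[symmetric] mult.commute)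
      have 2: "(1 / r) ^ Suc n = exp (- d * real (Suc n))"
        unfolding power_divide 1 by (simp add: exp_minus inverse_eq_divide)
      have "b * real (Suc n) + (- b' * real n + d * real (Suc n)) = b' + - d * real (Suc n)"
        by (simp add: d_def field_simps)
      then have "exp (b * real (Suc n)) * (exp (- b' * real n) * exp (d * real (Suc n))) = exp b' * exp (- d * real (Suc n))"
        by (simp only: exp_add[symmetric])
      then show ?thesis unfolding 1 2 by (simp only: mult_ac)
    qed
    finally show ?thesis .
  qed
  have sv: "summable (\<lambda>n. \<bar>v n\<bar> * r ^ n)"
  proof -
    have "summable (\<lambda>n. \<bar>v (Suc n)\<bar> * r ^ Suc n)"
    proof (rule summable_comparison_test'[of _ N])
      show "summable (\<lambda>n. 2 * exp b' * (1 / r) ^ Suc n)"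
        using r by (intro summable_mult) (simp add: summable_geometric summable_mult del: power_Suc add: summable_Suc_iff)
      show "norm (\<bar>v (Suc n)\<bar> * r ^ Suc n) \<le> 2 * exp b' * (1 / r) ^ Suc n" if "N \<le> n" for n
        using vb[OF that] r by (simp add: abs_mult)
    qed
    then show ?thesis using summable_Suc_iff[of "\<lambda>n. \<bar>v n\<bar> * r ^ n"] by blast
  qed
  have "summable (\<lambda>n. norm (fps_nth V n * of_real r ^ n))"
    using sv r by (simp add: V_def norm_mult norm_power)
  then have "summable (\<lambda>n. fps_nth V n * of_real r ^ n)" by (rule summable_norm_cancel)
  then have "fps_conv_radius V \<ge> ereal (norm (complex_of_real r))"
    unfolding fps_conv_radius_def by (rule conv_radius_geI)
  then have radV: "fps_conv_radius V \<ge> ereal r" using r by simp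
  have V_abs: "summable (\<lambda>n. norm (fps_nth V n))"
  proof (rule summable_comparison_test'[OF sv, of 0])
    fix n
    have "\<bar>v n\<bar> * 1 \<le> \<bar>v n\<bar> * r ^ n" using r by (intro mult_left_mono one_le_power) auto
    then show "norm (norm (fps_nth V n)) \<le> \<bar>v n\<bar> * r ^ n" by (simp add: V_def)
  qed
  have Vnz: "eval_fps V w \<noteq> 0" if "norm w \<le> 1" for w
    using eval_fps_mult_closed_disc[OF V_abs Q_abs_summable that] V_mult_Q by auto
  have sub: "ball (0 :: complex) r \<subseteq> eball 0 (fps_conv_radius V)"
  proof
    fix x :: complex assume "x \<in> ball 0 r"
    then have "ereal (norm x) < ereal r" by simp
    from less_le_trans[OF this radV] show "x \<in> eball 0 (fps_conv_radius V)" by simp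
  qed
  define U where "U = ball 0 r \<inter> eval_fps V -` (- {0})"
  have "open U" unfolding U_def
    by (rule continuous_open_preimage[OF continuous_on_subset[OF continuous_on_eval_fps sub]]) auto
  moreover have "cball 0 1 \<subseteq> U" using Vnz r by (auto simp: U_def)
  ultimately obtain R where R: "R > 1" "cball 0 R \<subseteq> U" by (rule open_superset_cball_enlarge)
  have "fps_conv_radius (inverse V) \<ge> ereal R"
  proof (rule fps_conv_radius_inverse_ge)
    have "complex_of_real R \<in> cball 0 R" using R by simp
    then have "complex_of_real R \<in> ball 0 r" using R(2) unfolding U_def by blast
    then have "ereal R \<le> ereal r" using R by simp
    then show "ereal R \<le> fps_conv_radius V" using radV by (rule order.trans)
    fix z :: complex assume "ereal (norm z) < ereal R"
    then have "z \<in> cball 0 R" by simp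
    then show "eval_fps V z \<noteq> 0" using R(2) unfolding U_def by blast
  qed (use R in simp)
  moreover have "inverse V = Q" using fps_inverse_unique[OF V_mult_Q] .
  ultimately have radQ: "fps_conv_radius Q \<ge> ereal R" by simp
  define s where "s = (1 + R) / 2"
  have s: "1 < s" "s < R" using R by (auto simp: s_def)
  have "summable (\<lambda>n. norm (fps_nth Q n * of_real s ^ n))"
  proof (rule norm_summable_fps)
    have "ereal (norm (complex_of_real s)) < ereal R" using s by simp
    then show "ereal (norm (complex_of_real s)) < fps_conv_radius Q" using radQ by (rule less_le_trans)
  qed
  then have sq: "summable (\<lambda>n. q n * s ^ n)" using s q_nonneg by (simp add: Q_def norm_mult norm_power)
  \<comment> \<open>\<open>K_le_q\<close> carries the convergence of \<open>Q\<close> at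
    \<open>s > 1\<close> back to \<open>K\<close>, giving an exponential bound on its tail.\<close>
  have "tail K N * s ^ N \<le> exp b / c * (\<Sum>n. q n * s ^ n)" for N
  proof -
    have Ks: "summable (\<lambda>i. K (N + 1 + i))"
      using summable_ignore_initial_segment[OF Kd(3), of "N + 1"] by (simp add: add.commute)
    have "s ^ N * tail K N = (\<Sum>i. s ^ N * K (N + 1 + i))" unfolding tail_def by (rule suminf_mult[OF Ks, symmetric])
    also have "\<dots> \<le> (\<Sum>i. exp b / c * (q (i + N) * s ^ (i + N)))"
    proof (rule suminf_le)
      fix i
      have "K (Suc (N + i)) \<le> exp b / c * q (N + i)" using K_le_q[of "N + i"] c_gt_1 by (simp add: field_simps)
      then have "s ^ N * K (Suc (N + i)) \<le> s ^ (N + i) * (exp b / c * q (N + i))"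
        using s Kd(2) by (intro mult_mono power_increasing) auto
      then show "s ^ N * K (N + 1 + i) \<le> exp b / c * (q (i + N) * s ^ (i + N))"
        by (simp add: mult_ac add_ac)
    qed (rule summable_mult[OF Ks], rule summable_mult[OF summable_ignore_initial_segment[OF sq]])
    also have "\<dots> = exp b / c * (\<Sum>i. q (i + N) * s ^ (i + N))"
      by (rule suminf_mult[OF summable_ignore_initial_segment[OF sq]])
    also have "\<dots> \<le> exp b / c * (\<Sum>n. q n * s ^ n)"
    proof (rule mult_left_mono)
      have "0 \<le> (\<Sum>n<N. q n * s ^ n)" using q_nonneg s by (intro sum_nonneg) auto
      then show "(\<Sum>i. q (i + N) * s ^ (i + N)) \<le> (\<Sum>n. q n * s ^ n)"
        using suminf_split_initial_segment[OF sq, of N] by linarith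
    qed (use c_gt_1 in simp)
    finally show ?thesis by (simp add: mult.commute)
  qed
  from tail_not_exponentially_small[OF \<alpha> s(1) this pos lim] show False .
qed

end

section \<open>Sharp asymptotics\<close>

lemma tannery_sequence:
  fixes a :: "nat \<Rightarrow> nat \<Rightarrow> real"
  assumes "\<And>k. (\<lambda>n. a k n) \<longlonglongrightarrow> l k" "\<And>n k. n \<ge> N \<Longrightarrow> \<bar>a k n\<bar> \<le> M k" "summable M"
  shows "(\<lambda>n. \<Sum>k. a k n) \<longlonglongrightarrow> suminf l"
proof -
  have "eventually (\<lambda>(k, n). norm (a k n) \<le> M k) (sequentially \<times>\<^sub>F sequentially)"
    unfolding eventually_prod_sequentially using assms(2) by (intro exI[of _ N]) auto
  from tannerys_theorem[OF assms(1) this assms(3)] show ?thesis by simp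
qed

lemma ratio_shift_tendsto:
  fixes f :: "nat \<Rightarrow> real"
  assumes "eventually (\<lambda>n. f n > 0) sequentially" "(\<lambda>n. f (Suc n) / f n) \<longlonglongrightarrow> 1"
  shows "(\<lambda>n. f (n + k) / f n) \<longlonglongrightarrow> 1"
proof (induction k)
  case 0
  show ?case by (rule tendsto_eventually) (use assms(1) in eventually_elim, simp)
next
  case (Suc k)
  have "(\<lambda>n. f (Suc (n + k)) / f (n + k) * (f (n + k) / f n)) \<longlonglongrightarrow> 1 * 1"
    by (intro tendsto_mult Suc LIMSEQ_ignore_initial_segment[OF assms(2)])
  moreover have "eventually (\<lambda>n. f (n + k) > 0) sequentially"
    using assms(1) by (rule sequentially_offset)
  then have "eventually (\<lambda>n. f (Suc (n + k)) / f (n + k) * (f (n + k) / f n) = f (n + Suc k) / f n) sequentially"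
    by eventually_elim simp
  ultimately have "(\<lambda>n. f (n + Suc k) / f n) \<longlonglongrightarrow> 1 * 1" by (rule Lim_transform_eventually)
  then show ?case by (simp only: mult_1_right)
qed

text \<open>Eventually \<open>f\<close> grows by less than \<open>exp (b / 2)\<close> per step, so
  half of the discount dominates the sum and the other half makes it converge. In the limit the
  summand is \<open>A\<close> times a power of \<open>exp (- b)\<close>, with geometric sum
  \<open>A / (exp b - 1)\<close>. Used with \<open>a = K\<close> to obtain \<open>q\<close>, and
  with \<open>a = v\<close> to obtain \<open>lim u - u n\<close>.\<close>

lemma discounted_tail_asymp:
  fixes a f :: "nat \<Rightarrow> real"
  assumes fpos: "eventually (\<lambda>n. f n > 0) sequentially" and step: "(\<lambda>n. f (Suc n) / f n) \<longlonglongrightarrow> 1"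
    and a: "(\<lambda>n. a n / f n) \<longlonglongrightarrow> A" and b: "b > 0"
  shows "(\<lambda>n. (\<Sum>i. a (n + 1 + i) * exp (- b * real (Suc i))) / f n) \<longlonglongrightarrow> A / (exp b - 1)"
proof -
  have e1: "exp (b / 2) > 1" using b by simp
  have "eventually (\<lambda>n. \<bar>a n / f n\<bar> < \<bar>A\<bar> + 1) sequentially"
    by (rule order_tendstoD(2)[OF tendsto_rabs[OF a]]) simp
  then have "eventually (\<lambda>n. f n > 0 \<and> f (Suc n) / f n < exp (b / 2) \<and> \<bar>a n / f n\<bar> < \<bar>A\<bar> + 1) sequentially"
    using fpos order_tendstoD(2)[OF step e1] by eventually_elim auto
  then obtain N where N: "\<And>n. n \<ge> N \<Longrightarrow> f n > 0 \<and> f (Suc n) / f n < exp (b / 2) \<and> \<bar>a n / f n\<bar> < \<bar>A\<bar> + 1"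
    by (auto simp: eventually_sequentially)
  have grow: "f (n + k) \<le> exp (b / 2) ^ k * f n" if "n \<ge> N" for n k
  proof (induction k)
    case (Suc k)
    have "n + k \<ge> N" using that by simp
    then have "f (n + k) > 0" "f (Suc (n + k)) / f (n + k) < exp (b / 2)" using N by blast+
    then have "f (Suc (n + k)) \<le> exp (b / 2) * f (n + k)" by (simp add: pos_divide_less_eq less_imp_le)
    also have "\<dots> \<le> exp (b / 2) * (exp (b / 2) ^ k * f n)" using Suc by simp
    finally show ?case by (simp add: mult.assoc)
  qed simp
  define g where "g = (\<lambda>i n. a (n + 1 + i) * exp (- b * real (Suc i)) / f n)"
  define M where "M = (\<lambda>i. (\<bar>A\<bar> + 1) * exp (- (b / 2)) ^ Suc i)"
  have sM: "summable M"
    unfolding M_def using b by (intro summable_mult) (simp add: summable_Suc_iff summable_geometric del: power_Suc)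
  have bound: "\<bar>g i n\<bar> \<le> M i" if n: "n \<ge> N" for n i
  proof -
    have fn: "f n > 0" using N n by blast
    have "n + 1 + i \<ge> N" using n by simp
    then have fp: "f (n + 1 + i) > 0" and "\<bar>a (n + 1 + i) / f (n + 1 + i)\<bar> < \<bar>A\<bar> + 1" using N by blast+
    then have "\<bar>a (n + 1 + i)\<bar> / f (n + 1 + i) < \<bar>A\<bar> + 1" by (simp add: abs_divide)
    then have "\<bar>a (n + 1 + i)\<bar> \<le> (\<bar>A\<bar> + 1) * f (n + 1 + i)" using fp by (simp add: pos_divide_less_eq less_imp_le)
    also have "\<dots> \<le> (\<bar>A\<bar> + 1) * (exp (b / 2) ^ Suc i * f n)"
      using grow[OF n, of "Suc i"] by (intro mult_left_mono) auto
    finally have "\<bar>a (n + 1 + i)\<bar> * exp (- b * real (Suc i)) \<le> (\<bar>A\<bar> + 1) * (exp (b / 2) ^ Suc i * f n) * exp (- b * real (Suc i))"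
      by (intro mult_right_mono) auto
    also have "\<dots> = (\<bar>A\<bar> + 1) * (exp (b / 2) ^ Suc i * exp (- b * real (Suc i))) * f n" by (simp only: mult_ac)
    also have "exp (b / 2) ^ Suc i * exp (- b * real (Suc i)) = exp (- (b / 2)) ^ Suc i"
      unfolding exp_of_nat_mult[symmetric] exp_add[symmetric] by (simp add: field_simps)
    finally have "\<bar>a (n + 1 + i) * exp (- b * real (Suc i))\<bar> \<le> M i * f n" unfolding M_def abs_mult by simp
    then show ?thesis unfolding g_def abs_divide using fn by (simp add: pos_divide_le_eq)
  qed
  have lim: "(\<lambda>n. g i n) \<longlonglongrightarrow> A * exp (- b) ^ Suc i" for i
  proof -
    have "(\<lambda>n. a (n + (1 + i)) / f (n + (1 + i)) * (f (n + (1 + i)) / f n) * exp (- b * real (Suc i))) \<longlonglongrightarrow> A * 1 * exp (- b * real (Suc i))"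
      by (intro tendsto_mult tendsto_const ratio_shift_tendsto[OF fpos step] LIMSEQ_ignore_initial_segment[OF a])
    moreover have "eventually (\<lambda>n. f (n + (1 + i)) > 0) sequentially"
      using fpos by (rule sequentially_offset)
    then have "eventually (\<lambda>n. a (n + (1 + i)) / f (n + (1 + i)) * (f (n + (1 + i)) / f n) * exp (- b * real (Suc i)) = g i n) sequentially"
      by eventually_elim (simp add: g_def add.assoc)
    ultimately have "(\<lambda>n. g i n) \<longlonglongrightarrow> A * 1 * exp (- b * real (Suc i))" by (rule Lim_transform_eventually)
    moreover have "exp (- b * real (Suc i)) = exp (- b) ^ Suc i"
      by (simp only: exp_of_nat_mult[symmetric] mult.commute)
    ultimately show ?thesis by (simp only: mult_1_right)
  qed
  have "(\<lambda>n. \<Sum>i. g i n) \<longlonglongrightarrow> (\<Sum>i. A * exp (- b) ^ Suc i)"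
    by (rule tannery_sequence[OF lim bound sM])
  also have "(\<Sum>i. A * exp (- b) ^ Suc i) = A / (exp b - 1)"
  proof -
    have "(\<lambda>i. A * exp (- b) * exp (- b) ^ i) sums (A * exp (- b) * (1 / (1 - exp (- b))))"
      using b by (intro sums_mult geometric_sums) auto
    moreover have "A * exp (- b) * (1 / (1 - exp (- b))) = A / (exp b - 1)"
      using b by (simp add: exp_minus field_simps)
    ultimately show ?thesis by (simp add: sums_iff mult.assoc)
  qed
  finally have 1: "(\<lambda>n. \<Sum>i. g i n) \<longlonglongrightarrow> A / (exp b - 1)" .
  have "(\<Sum>i. g i n) = (\<Sum>i. a (n + 1 + i) * exp (- b * real (Suc i))) / f n" if n: "n \<ge> N" for n
  proof -
    have s: "summable (\<lambda>i. g i n)"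
      by (rule summable_comparison_test'[OF sM, of 0]) (use bound[OF n] in auto)
    have fn: "f n > 0" using N[OF n] by simp
    have "(\<lambda>i. a (n + 1 + i) * exp (- b * real (Suc i))) = (\<lambda>i. g i n * f n)" using fn by (simp add: g_def)
    then have "(\<Sum>i. a (n + 1 + i) * exp (- b * real (Suc i))) = (\<Sum>i. g i n) * f n"
      using suminf_mult2[OF s, of "f n"] by simp
    then show ?thesis using fn by simp
  qed
  then have "eventually (\<lambda>n. (\<Sum>i. g i n) = (\<Sum>i. a (n + 1 + i) * exp (- b * real (Suc i))) / f n) sequentially"
    by (auto simp: eventually_sequentially)
  with 1 show ?thesis by (rule Lim_transform_eventually)
qed

text \<open>The analytic input is the identity \<open>n v n = - \<Sum> j q j (v * v) (n - j)\<close>, which is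
  \<open>V' = - Q' V\<^sup>2\<close> for \<open>V = 1 / Q\<close>.  Its factor \<open>n\<close> makes the terms with small \<open>j\<close>
  negligible, so that no smallness of \<open>Q - 1\<close> is needed.\<close>

lemma reciprocal_series_asymp:
  fixes q v :: "nat \<Rightarrow> real"
  assumes qpos: "\<And>n. q n > 0" and qs: "summable q" and step: "(\<lambda>n. q (Suc n) / q n) \<longlonglongrightarrow> 1"
    and D: "\<And>n m. n \<le> m \<Longrightarrow> m \<le> 2 * n \<Longrightarrow> q n \<le> D * q m"
    and vs: "summable (\<lambda>n. \<bar>v n\<bar>)"
    and w: "\<And>n. w n = (\<Sum>i\<le>n. v i * v (n - i))"
    and rec: "\<And>n. real n * v n = - (\<Sum>j\<le>n. real j * q j * w (n - j))"
  shows "(\<lambda>n. v n / q n) \<longlonglongrightarrow> - (suminf v)\<^sup>2"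
proof -
  have D1: "D \<ge> 1" using D[of 0 0] qpos[of 0] by simp
  define S where "S = (\<Sum>n. \<bar>v n\<bar>)"
  have S0: "S \<ge> 0" unfolding S_def by (intro suminf_nonneg vs) auto
  have sumv: "(\<Sum>i\<le>m. \<bar>v i\<bar>) \<le> S" for m unfolding S_def by (intro sum_le_suminf vs) auto
  have sumv': "(\<Sum>i\<le>m. \<bar>v (m - i)\<bar>) \<le> S" for m
    using sumv[of m] sum.nat_diff_reindex[of "\<lambda>i. \<bar>v i\<bar>" "Suc m"] by (simp add: lessThan_Suc_atMost)
  define w' where "w' = (\<lambda>n. \<Sum>i\<le>n. \<bar>v i\<bar> * \<bar>v (n - i)\<bar>)"
  have ww': "\<bar>w n\<bar> \<le> w' n" for n unfolding w w'_def by (rule order.trans[OF sum_abs]) (simp add: abs_mult)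
  have w'_sums: "w' sums (S * S)"
    unfolding w'_def S_def using vs by (intro Cauchy_product_sums) auto
  have w's: "summable w'" using w'_sums by (rule sums_summable)
  have ws: "summable (\<lambda>n. \<bar>w n\<bar>)" by (rule summable_comparison_test'[OF w's, of 0]) (use ww' in auto)
  have sumw: "(\<Sum>i\<le>m. \<bar>w (m - i)\<bar>) \<le> S * S" for m
  proof -
    have "(\<Sum>i\<le>m. \<bar>w (m - i)\<bar>) = (\<Sum>i\<le>m. \<bar>w i\<bar>)"
      using sum.nat_diff_reindex[of "\<lambda>i. \<bar>w i\<bar>" "Suc m"] by (simp add: lessThan_Suc_atMost)
    also have "\<dots> \<le> (\<Sum>i\<le>m. w' i)" by (intro sum_mono ww')
    also have "\<dots> \<le> suminf w'" by (intro sum_le_suminf w's) (auto simp: w'_def intro!: sum_nonneg)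
    also have "\<dots> = S * S" using w'_sums by (simp add: sums_iff)
    finally show ?thesis .
  qed
  have suminf_w: "suminf w = (suminf v)\<^sup>2"
    using Cauchy_product[of v v] vs by (simp add: w[abs_def] power2_eq_square)
  \<comment> \<open>One of \<open>i\<close> and \<open>m - i\<close> is at least
    \<open>m / 2\<close>; there \<open>D\<close> compares \<open>q\<close> with \<open>q m\<close>,
    and the other factor is summed to at most \<open>S\<close>.\<close>
  have w_bound: "\<bar>w m\<bar> \<le> 2 * M * D * S * q m" if M: "\<And>i. i \<le> m \<Longrightarrow> \<bar>v i\<bar> \<le> M * q i" and M0: "M \<ge> 0" for M m
  proof -
    have "\<bar>v i\<bar> * \<bar>v (m - i)\<bar> \<le> M * D * q m * (\<bar>v (m - i)\<bar> + \<bar>v i\<bar>)" if i: "i \<le> m" for i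
    proof (cases "m \<le> 2 * i")
      case True
      have "\<bar>v i\<bar> \<le> M * q i" using i by (rule M)
      also have "\<dots> \<le> M * (D * q m)" using i True M0 by (intro mult_left_mono D)
      finally have "\<bar>v i\<bar> * \<bar>v (m - i)\<bar> \<le> M * (D * q m) * \<bar>v (m - i)\<bar>" by (intro mult_right_mono) auto
      moreover have "0 \<le> M * (D * q m) * \<bar>v i\<bar>" using M0 D1 qpos[of m] by simp
      ultimately show ?thesis by (simp add: algebra_simps)
    next
      case False
      have "\<bar>v (m - i)\<bar> \<le> M * q (m - i)" by (rule M) simp
      also have "\<dots> \<le> M * (D * q m)" using False M0 by (intro mult_left_mono D) auto
      finally have "\<bar>v i\<bar> * \<bar>v (m - i)\<bar> \<le> \<bar>v i\<bar> * (M * (D * q m))" by (intro mult_left_mono) auto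
      moreover have "0 \<le> M * (D * q m) * \<bar>v (m - i)\<bar>" using M0 D1 qpos[of m] by simp
      ultimately show ?thesis by (simp add: algebra_simps)
    qed
    then have "w' m \<le> (\<Sum>i\<le>m. M * D * q m * (\<bar>v (m - i)\<bar> + \<bar>v i\<bar>))"
      unfolding w'_def by (intro sum_mono) auto
    also have "\<dots> = M * D * q m * ((\<Sum>i\<le>m. \<bar>v (m - i)\<bar>) + (\<Sum>i\<le>m. \<bar>v i\<bar>))"
      by (simp only: sum_distrib_left[symmetric] sum.distrib)
    also have "\<dots> \<le> M * D * q m * (S + S)"
      using sumv[of m] sumv'[of m] M0 D1 qpos[of m] by (intro mult_left_mono add_mono) auto
    finally show ?thesis using ww'[of m] by (simp add: algebra_simps)
  qed
  define T where "T = (\<lambda>n. \<Sum>j\<le>n. real j * q j)"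
  have T0: "T n \<ge> 0" for n unfolding T_def using qpos by (intro sum_nonneg) (auto simp: less_imp_le)
  \<comment> \<open>Dominated convergence: \<open>j q j / n\<close> is at most \<open>q j\<close>
    for \<open>j \<le> n\<close> and tends to 0 for fixed \<open>j\<close>. The series of
    \<open>j q j\<close> itself may diverge.\<close>
  have Tn: "(\<lambda>n. T n / real n) \<longlonglongrightarrow> 0"
  proof -
    define h where "h = (\<lambda>j n. if j \<le> n then real j * q j / real n else 0)"
    have "(\<lambda>n. \<Sum>j. h j n) \<longlonglongrightarrow> (\<Sum>j::nat. 0)"
    proof (rule tannery_sequence[where M = q and N = 0])
      fix j
      have "(\<lambda>n. real j * q j * (1 / real n)) \<longlonglongrightarrow> real j * q j * 0"
        by (intro tendsto_mult tendsto_const lim_1_over_n)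
      then have "(\<lambda>n. real j * q j / real n) \<longlonglongrightarrow> 0" by simp
      moreover have "eventually (\<lambda>n. real j * q j / real n = h j n) sequentially"
        using eventually_ge_at_top[of j] by eventually_elim (simp add: h_def)
      ultimately show "(\<lambda>n. h j n) \<longlonglongrightarrow> 0" by (rule Lim_transform_eventually)
      fix n
      show "\<bar>h j n\<bar> \<le> q j"
      proof (cases "j \<le> n \<and> n > 0")
        case True
        then have "real j * q j \<le> real n * q j" using qpos[of j] by (intro mult_right_mono) auto
        then show ?thesis using True qpos[of j] by (simp add: h_def pos_divide_le_eq mult.commute)
      qed (use qpos[of j] in \<open>auto simp: h_def\<close>)
    qed (rule qs)
    moreover have "(\<Sum>j. h j n) = T n / real n" for n
    proof -
      have "(\<Sum>j. h j n) = (\<Sum>j\<le>n. h j n)" by (rule suminf_finite) (auto simp: h_def)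
      then show ?thesis by (simp add: h_def T_def sum_divide_distrib)
    qed
    ultimately show ?thesis by simp
  qed
  \<comment> \<open>The split is at \<open>n / 2\<close>. For smaller \<open>j\<close> the index
    \<open>n - j\<close> is large, so \<open>w (n - j)\<close> is controlled by \<open>q n\<close>;
    for larger \<open>j\<close> it is \<open>q j\<close> that is controlled by
    \<open>q n\<close>.\<close>
  define Sm where "Sm = (\<lambda>n. \<Sum>j | j \<le> n \<and> 2 * j < n. real j * q j * w (n - j))"
  define Lg where "Lg = (\<lambda>n. \<Sum>j | j \<le> n \<and> n \<le> 2 * j. real j * q j * w (n - j))"
  have split: "real n * v n = - Sm n - Lg n" for n
  proof -
    have "{..n} = {j. j \<le> n \<and> 2 * j < n} \<union> {j. j \<le> n \<and> n \<le> 2 * j}" by auto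
    moreover have "(\<Sum>j\<in>{j. j \<le> n \<and> 2 * j < n} \<union> {j. j \<le> n \<and> n \<le> 2 * j}. real j * q j * w (n - j)) = Sm n + Lg n"
      unfolding Sm_def Lg_def by (rule sum.union_disjoint) auto
    ultimately show ?thesis using rec[of n] by simp
  qed
  have Lg_bound: "\<bar>Lg n\<bar> \<le> real n * D * (S * S) * q n" for n
  proof -
    have "\<bar>Lg n\<bar> \<le> (\<Sum>j | j \<le> n \<and> n \<le> 2 * j. real n * (D * q n) * \<bar>w (n - j)\<bar>)"
      unfolding Lg_def
    proof (rule order.trans[OF sum_abs sum_mono])
      fix j assume "j \<in> {j. j \<le> n \<and> n \<le> 2 * j}"
      then have "real j * q j \<le> real n * (D * q n)" using qpos[of j] by (intro mult_mono D) (auto simp: less_imp_le)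
      then show "\<bar>real j * q j * w (n - j)\<bar> \<le> real n * (D * q n) * \<bar>w (n - j)\<bar>"
        using qpos[of j] by (simp add: abs_mult mult_right_mono)
    qed
    also have "\<dots> \<le> (\<Sum>j\<le>n. real n * (D * q n) * \<bar>w (n - j)\<bar>)"
      using D1 qpos[of n] by (intro sum_mono2) auto
    also have "\<dots> = real n * (D * q n) * (\<Sum>j\<le>n. \<bar>w (n - j)\<bar>)" by (simp add: sum_distrib_left)
    also have "\<dots> \<le> real n * (D * q n) * (S * S)" using D1 qpos[of n] by (intro mult_left_mono sumw) auto
    finally show ?thesis by (simp only: mult_ac)
  qed
  have Sm_bound: "\<bar>Sm n\<bar> \<le> 2 * M * D * D * S * T n * q n" if M: "\<And>i. i \<le> n \<Longrightarrow> \<bar>v i\<bar> \<le> M * q i" and M0: "M \<ge> 0" for M n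
  proof -
    have "\<bar>Sm n\<bar> \<le> (\<Sum>j | j \<le> n \<and> 2 * j < n. real j * q j * (2 * M * D * S * (D * q n)))"
      unfolding Sm_def
    proof (rule order.trans[OF sum_abs sum_mono])
      fix j assume j: "j \<in> {j. j \<le> n \<and> 2 * j < n}"
      have "\<bar>w (n - j)\<bar> \<le> 2 * M * D * S * q (n - j)" using M M0 by (intro w_bound) auto
      also have "\<dots> \<le> 2 * M * D * S * (D * q n)"
        using j M0 D1 S0 by (intro mult_left_mono D) auto
      finally show "\<bar>real j * q j * w (n - j)\<bar> \<le> real j * q j * (2 * M * D * S * (D * q n))"
        using qpos[of j] by (simp add: abs_mult mult_left_mono)
    qed
    also have "\<dots> \<le> (\<Sum>j\<le>n. real j * q j * (2 * M * D * S * (D * q n)))"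
      using qpos M0 D1 S0 by (intro sum_mono2) (auto simp: less_imp_le)
    also have "\<dots> = T n * (2 * M * D * S * (D * q n))" unfolding T_def by (simp only: sum_distrib_right)
    finally show ?thesis by (simp only: mult_ac)
  qed
  \<comment> \<open>Chosen with \<open>4 * D * D * S * e \<le> 1\<close>, so that the terms with
    small index account for at most half of the quotient to be bounded; the summand 1 keeps the
    denominator positive.\<close>
  define e where "e = 1 / (4 * D * D * S + 1)"
  have e: "e > 0" using D1 S0 by (simp add: e_def add_nonneg_pos)
  have "eventually (\<lambda>n. T n / real n < e) sequentially" using order_tendstoD(2)[OF Tn e] .
  then obtain n0 where n0: "\<And>n. n \<ge> n0 \<Longrightarrow> T n / real n < e" by (auto simp: eventually_sequentially)
  \<comment> \<open>\<open>2 * D * (S * S)\<close> is the solution of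
    \<open>x = x / 2 + D * (S * S)\<close>, the equality case of the inequality derived beyond
    \<open>n0\<close>; the remaining entries cover the indices up to \<open>n0\<close>.\<close>
  define B where "B = Max (insert (2 * D * (S * S)) ((\<lambda>i. \<bar>v i\<bar> / q i) ` {..n0}))"
  have B0: "2 * D * (S * S) \<le> B" unfolding B_def by (intro Max_ge) auto
  have B1: "\<bar>v i\<bar> / q i \<le> B" if "i \<le> n0" for i unfolding B_def using that by (intro Max_ge) auto
  have Bnn: "B \<ge> 0" using B0 D1 S0 by (meson mult_nonneg_nonneg order.trans zero_le_one zero_le_numeral)
  have v_bound: "\<bar>v n\<bar> \<le> B * q n" for n
  proof (induction n rule: less_induct)
    case (less n)
    show ?case
    proof (cases "n \<le> n0")
      case True
      then show ?thesis using B1[of n] qpos[of n] by (simp add: pos_divide_le_eq)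
    next
      case False
      \<comment> \<open>\<open>Sm_bound\<close> asks for a constant valid for all
        \<open>i \<le> n\<close>, including \<open>n\<close> itself. If \<open>x\<close> exceeded
        \<open>B\<close>, then \<open>x\<close> would be such a constant by induction, and the
        inequality it has to satisfy would force \<open>x \<le> B\<close>.\<close>
      define x where "x = \<bar>v n\<bar> / q n"
      have vx: "\<bar>v n\<bar> = x * q n" using qpos[of n] by (simp add: x_def)
      have n: "n > 0" "n \<ge> n0" using False by auto
      have "x \<le> B"
      proof (rule ccontr)
        assume "\<not> x \<le> B"
        then have xB: "B < x" by simp
        have "\<bar>v i\<bar> \<le> x * q i" if "i \<le> n" for i
        proof (cases "i = n")
          case False
          then have "\<bar>v i\<bar> \<le> B * q i" using that by (intro less) simp
          also have "\<dots> \<le> x * q i" using xB qpos[of i] by (intro mult_right_mono) auto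
          finally show ?thesis .
        qed (simp add: vx)
        moreover have x0: "x \<ge> 0" using xB Bnn by simp
        ultimately have "\<bar>Sm n\<bar> \<le> 2 * x * D * D * S * T n * q n" by (rule Sm_bound)
        moreover have "real n * (x * q n) = \<bar>Sm n + Lg n\<bar>"
        proof -
          have "real n * (x * q n) = \<bar>real n * v n\<bar>" by (simp add: abs_mult vx)
          then show ?thesis unfolding split by linarith
        qed
        ultimately have "real n * (x * q n) \<le> 2 * x * D * D * S * T n * q n + real n * D * (S * S) * q n"
          using Lg_bound[of n] by linarith
        also have "\<dots> = (2 * x * D * D * S * T n + real n * D * (S * S)) * q n" by (simp only: distrib_right)
        finally have "(real n * x) * q n \<le> (2 * x * D * D * S * T n + real n * D * (S * S)) * q n" by (simp only: mult.assoc)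
        then have main: "real n * x \<le> 2 * x * D * D * S * T n + real n * D * (S * S)" using qpos[of n] by simp
        have "T n \<le> e * real n" using n0[OF n(2)] n by (simp add: pos_divide_less_eq less_imp_le)
        then have "(2 * x * D * D * S) * T n \<le> (2 * x * D * D * S) * (e * real n)"
          using x0 D1 S0 by (intro mult_left_mono) auto
        also have "\<dots> = real n * (x / 2) * (4 * D * D * S * e)" by (simp add: field_simps)
        also have "\<dots> \<le> real n * (x / 2) * 1"
          using x0 D1 S0 by (intro mult_left_mono) (auto simp: e_def divide_simps add_nonneg_pos)
        finally have "real n * x \<le> real n * (x / 2) + real n * D * (S * S)" using main by linarith
        then have "real n * x \<le> real n * (x / 2 + D * (S * S))" by (simp only: distrib_left mult.assoc)
        then have "x \<le> x / 2 + D * (S * S)" using n by simp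
        then show False using xB B0 by linarith
      qed
      then show ?thesis unfolding vx using qpos[of n] by (intro mult_right_mono) auto
    qed
  qed
  have "(\<lambda>n. Sm n / (real n * q n)) \<longlonglongrightarrow> 0"
  proof (rule Lim_null_comparison)
    have "(\<lambda>n. 2 * B * D * D * S * (T n / real n)) \<longlonglongrightarrow> 2 * B * D * D * S * 0"
      by (intro tendsto_mult tendsto_const Tn)
    then show "(\<lambda>n. 2 * B * D * D * S * (T n / real n)) \<longlonglongrightarrow> 0" by simp
    show "eventually (\<lambda>n. norm (Sm n / (real n * q n)) \<le> 2 * B * D * D * S * (T n / real n)) sequentially"
      using eventually_gt_at_top[of 0]
    proof eventually_elim
      case (elim n)
      have "\<bar>Sm n\<bar> \<le> 2 * B * D * D * S * T n * q n" using v_bound Bnn by (intro Sm_bound) auto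
      then show ?case using elim qpos[of n] by (simp add: abs_mult field_simps)
    qed
  qed
  moreover have "(\<lambda>n. Lg n / (real n * q n)) \<longlonglongrightarrow> suminf w"
  proof -
    \<comment> \<open>The large-index terms after substituting \<open>i = n - j\<close>: for fixed
      \<open>i\<close> the coefficient of \<open>w i\<close> tends to 1, and it never exceeds
      \<open>D\<close>.\<close>
    define h where "h = (\<lambda>i n. if 2 * i \<le> n then real (n - i) * q (n - i) * w i / (real n * q n) else 0)"
    have "(\<lambda>n. \<Sum>i. h i n) \<longlonglongrightarrow> suminf w"
    proof (rule tannery_sequence[where M = "\<lambda>i. D * \<bar>w i\<bar>" and N = 0])
      fix i
      have "(\<lambda>k. real k / real (k + i)) \<longlonglongrightarrow> 1"
        by real_asymp
      moreover have "(\<lambda>k. q (k + i) / q k) \<longlonglongrightarrow> 1"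
        using qpos by (intro ratio_shift_tendsto step) auto
      then have "(\<lambda>k. inverse (q (k + i) / q k)) \<longlonglongrightarrow> inverse 1" by (intro tendsto_inverse) auto
      ultimately have "(\<lambda>k. real k / real (k + i) * inverse (q (k + i) / q k) * w i) \<longlonglongrightarrow> 1 * inverse 1 * w i"
        by (intro tendsto_mult tendsto_const)
      moreover have "eventually (\<lambda>k. real k / real (k + i) * inverse (q (k + i) / q k) * w i = h i (k + i)) sequentially"
        using eventually_ge_at_top[of i] by eventually_elim (simp add: h_def)
      ultimately have "(\<lambda>k. h i (k + i)) \<longlonglongrightarrow> 1 * inverse 1 * w i" by (rule Lim_transform_eventually)
      then show "(\<lambda>n. h i n) \<longlonglongrightarrow> w i" using LIMSEQ_offset[of "h i" i "w i"] by simp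
      fix n
      show "\<bar>h i n\<bar> \<le> D * \<bar>w i\<bar>"
      proof (cases "2 * i \<le> n \<and> n > 0")
        case True
        have "q (n - i) \<le> D * q n" using True by (intro D) auto
        then have "real (n - i) * q (n - i) \<le> real n * (D * q n)"
          using qpos[of "n - i"] by (intro mult_mono) (auto simp: less_imp_le)
        then have "real (n - i) * q (n - i) * \<bar>w i\<bar> \<le> real n * (D * q n) * \<bar>w i\<bar>" by (intro mult_right_mono) auto
        then show ?thesis using True qpos[of n] qpos[of "n - i"]
          by (simp add: h_def abs_mult pos_divide_le_eq mult_ac)
      qed (use D1 in \<open>auto simp: h_def\<close>)
    qed (intro summable_mult ws)
    moreover have "(\<Sum>i. h i n) = Lg n / (real n * q n)" for n
    proof -
      have "(\<Sum>i. h i n) = (\<Sum>i | 2 * i \<le> n. h i n)"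
      proof (rule suminf_finite)
        show "finite {i. 2 * i \<le> n}" by (rule finite_subset[of _ "{..n}"]) auto
      qed (auto simp: h_def)
      also have "\<dots> = (\<Sum>i | 2 * i \<le> n. real (n - i) * q (n - i) * w i) / (real n * q n)"
        by (simp add: h_def sum_divide_distrib)
      also have "(\<Sum>i | 2 * i \<le> n. real (n - i) * q (n - i) * w i) = Lg n"
        unfolding Lg_def by (rule sum.reindex_bij_witness[of _ "\<lambda>j. n - j" "\<lambda>i. n - i"]) auto
      finally show ?thesis .
    qed
    ultimately show ?thesis by simp
  qed
  ultimately have "(\<lambda>n. - (Sm n / (real n * q n)) - Lg n / (real n * q n)) \<longlonglongrightarrow> - 0 - suminf w"
    by (intro tendsto_diff tendsto_minus)
  moreover have "eventually (\<lambda>n. - (Sm n / (real n * q n)) - Lg n / (real n * q n) = v n / q n) sequentially"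
    using eventually_gt_at_top[of 0]
  proof eventually_elim
    case (elim n)
    have "- (Sm n / (real n * q n)) - Lg n / (real n * q n) = (- Sm n - Lg n) / (real n * q n)"
      by (simp add: diff_divide_distrib)
    also have "\<dots> = v n / q n" unfolding split[symmetric] using elim by simp
    finally show ?case .
  qed
  ultimately show ?thesis unfolding suminf_w by (simp add: Lim_transform_eventually)
qed


text \<open>From some \<open>N\<close> on each step adds at most \<open>e / 2\<close>, and the
  initial value is negligible after division. Applied to \<open>ln (K n)\<close>, it shows that
  \<open>K\<close> contributes nothing to the exponential rate.\<close>

lemma increments_null_imp_div_null:
  fixes x :: "nat \<Rightarrow> real"
  assumes "(\<lambda>n. x (Suc n) - x n) \<longlonglongrightarrow> 0"
  shows "(\<lambda>n. x n / real n) \<longlonglongrightarrow> 0"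
proof (rule tendstoI)
  fix e :: real assume e: "e > 0"
  have "eventually (\<lambda>n. dist (x (Suc n) - x n) 0 < e / 2) sequentially"
    using tendstoD[OF assms, of "e / 2"] e by simp
  then obtain N where N: "\<And>n. n \<ge> N \<Longrightarrow> \<bar>x (Suc n) - x n\<bar> < e / 2"
    by (auto simp: eventually_sequentially dist_real_def)
  have le: "\<bar>x (N + k)\<bar> \<le> \<bar>x N\<bar> + real k * (e / 2)" for k
  proof (induction k)
    case (Suc k)
    have "\<bar>x (N + Suc k)\<bar> \<le> \<bar>x (N + k)\<bar> + e / 2"
      using N[OF le_add1, of k] unfolding add_Suc_right by linarith
    also have "\<dots> \<le> \<bar>x N\<bar> + real k * (e / 2) + e / 2" using Suc by simp
    finally show ?case by (simp add: field_simps)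
  qed simp
  have "(\<lambda>n. \<bar>x N\<bar> * (1 / real n)) \<longlonglongrightarrow> \<bar>x N\<bar> * 0" by (intro tendsto_mult tendsto_const lim_1_over_n)
  then have "eventually (\<lambda>n. \<bar>x N\<bar> * (1 / real n) < e / 2) sequentially"
    using e by (intro order_tendstoD(2)) auto
  then show "eventually (\<lambda>n. dist (x n / real n) 0 < e) sequentially"
    using eventually_gt_at_top[of N]
  proof eventually_elim
    case (elim n)
    have "\<bar>x n\<bar> \<le> \<bar>x N\<bar> + real (n - N) * (e / 2)" using le[of "n - N"] elim by simp
    also have "real (n - N) * (e / 2) \<le> real n * (e / 2)" using e by (intro mult_right_mono) auto
    finally have "\<bar>x n\<bar> / real n \<le> (\<bar>x N\<bar> + real n * (e / 2)) / real n" by (intro divide_right_mono) auto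
    also have "\<dots> = \<bar>x N\<bar> * (1 / real n) + e / 2" using elim by (simp add: add_divide_distrib)
    also have "\<dots> < e" using elim(1) by linarith
    finally show ?case by (simp add: abs_divide)
  qed
qed

section \<open>From \<open>K\<close> to the tail, the increments and the renewal mass\<close>

context tilted_renewal
begin

lemma q_pos:
  assumes "eventually (\<lambda>n. K n > 0) sequentially"
  shows "q n > 0"
proof -
  obtain N where N: "\<And>m. m \<ge> N \<Longrightarrow> K m > 0" using assms by (auto simp: eventually_sequentially)
  have s: "summable (\<lambda>i. K (n + 1 + i) * exp (- b * real (Suc i)))"
    using summable_Suc_iff[THEN iffD2, OF q_summable[of n]] by simp
  have "0 < (\<Sum>i. K (n + 1 + i) * exp (- b * real (Suc i)))"
    by (rule suminf_pos2[OF s, of N]) (use Kd(2) N in auto)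
  then show ?thesis using c_gt_1 by (simp add: q_def)
qed

lemma q_asymp:
  assumes "eventually (\<lambda>n. K n > 0) sequentially" "(\<lambda>n. K (Suc n) / K n) \<longlonglongrightarrow> 1"
  shows "(\<lambda>n. q n / K n) \<longlonglongrightarrow> c / (exp b - 1)"
proof -
  have "(\<lambda>n. K n / K n) \<longlonglongrightarrow> 1"
    by (rule tendsto_eventually) (use assms(1) in eventually_elim, simp)
  from tendsto_mult[OF tendsto_const[of c] discounted_tail_asymp[OF assms this b_pos]]
  show ?thesis by (simp add: q_def)
qed

lemma q_step:
  assumes "eventually (\<lambda>n. K n > 0) sequentially" "(\<lambda>n. K (Suc n) / K n) \<longlonglongrightarrow> 1"
  shows "(\<lambda>n. q (Suc n) / q n) \<longlonglongrightarrow> 1"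
proof -
  note qa = q_asymp[OF assms]
  have B: "c / (exp b - 1) \<noteq> 0" using c_gt_1 b_pos by simp
  have "(\<lambda>n. q (Suc n) / K (Suc n) * (K (Suc n) / K n) / (q n / K n)) \<longlonglongrightarrow> c / (exp b - 1) * 1 / (c / (exp b - 1))"
    by (rule tendsto_divide[OF tendsto_mult[OF LIMSEQ_Suc[OF qa] assms(2)] qa B])
  moreover have "eventually (\<lambda>n. K (Suc n) > 0) sequentially"
    using sequentially_offset[OF assms(1), of 1] by simp
  then have "eventually (\<lambda>n. q (Suc n) / K (Suc n) * (K (Suc n) / K n) / (q n / K n) = q (Suc n) / q n) sequentially"
    using assms(1) by eventually_elim simp
  ultimately have "(\<lambda>n. q (Suc n) / q n) \<longlonglongrightarrow> c / (exp b - 1) * 1 / (c / (exp b - 1))"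
    by (rule Lim_transform_eventually)
  then show ?thesis using B by simp
qed

text \<open>For large \<open>n\<close> the comparison passes from \<open>K\<close> to
  \<open>q\<close> because \<open>q n / K n\<close> has a positive limit. For small \<open>n\<close>
  the index \<open>m \<le> 2 * n\<close> stays in a finite range, on which \<open>q\<close> has a
  positive minimum, while \<open>q n \<le> c\<close>. The reciprocal lemma asks for a comparison at
  all indices, 0 included.\<close>

lemma q_doubling:
  assumes Kpos: "eventually (\<lambda>n. K n > 0) sequentially" and step: "(\<lambda>n. K (Suc n) / K n) \<longlonglongrightarrow> 1"
    and dbl: "C > 0" "\<And>n m. n \<ge> N \<Longrightarrow> n \<le> m \<Longrightarrow> m \<le> 2 * n \<Longrightarrow> K n \<le> C * K m"
  obtains D where "\<And>n m. n \<le> m \<Longrightarrow> m \<le> 2 * n \<Longrightarrow> q n \<le> D * q m"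
proof -
  define B where "B = c / (exp b - 1)"
  have B: "B > 0" using c_gt_1 b_pos by (simp add: B_def)
  note qa = q_asymp[OF Kpos step, folded B_def]
  have "eventually (\<lambda>n. K n > 0 \<and> q n / K n < 2 * B \<and> B / 2 < q n / K n) sequentially"
    using Kpos order_tendstoD(2)[OF qa, of "2 * B"] order_tendstoD(1)[OF qa, of "B / 2"] B
    by (simp add: eventually_conj_iff)
  then obtain N1 where N1: "\<And>n. n \<ge> N1 \<Longrightarrow> K n > 0 \<and> q n / K n < 2 * B \<and> B / 2 < q n / K n"
    by (auto simp: eventually_sequentially)
  define N2 where "N2 = max N N1"
  define \<mu> where "\<mu> = Min (q ` {..2 * N2})"
  have "\<mu> \<in> q ` {..2 * N2}" unfolding \<mu>_def by (rule Min_in) auto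
  then have \<mu>0: "\<mu> > 0" using q_pos[OF Kpos] by auto
  have \<mu>: "\<mu> \<le> q m" if "m \<le> 2 * N2" for m unfolding \<mu>_def using that by (intro Min_le) auto
  \<comment> \<open>The 4 is the quotient of the bounds \<open>2 * B\<close> and
    \<open>B / 2\<close> for \<open>q n / K n\<close>.\<close>
  define D where "D = max (4 * C) (c / \<mu>)"
  have "q n \<le> D * q m" if nm: "n \<le> m" "m \<le> 2 * n" for n m
  proof (cases "n \<ge> N2")
    case True
    then have n: "N \<le> n" "N1 \<le> n" "N1 \<le> m" using nm by (auto simp: N2_def)
    have Kn: "K n > 0" "q n / K n < 2 * B" and Km: "K m > 0" "B / 2 < q m / K m" using N1 n by blast+
    have "q n \<le> 2 * B * K n" using Kn by (simp add: pos_divide_less_eq less_imp_le)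
    also have "\<dots> \<le> 2 * B * (C * K m)" using B dbl(2)[OF n(1) nm] by simp
    also have "\<dots> = 4 * C * (B / 2 * K m)" by simp
    also have "\<dots> \<le> 4 * C * q m"
      using Km dbl(1) by (intro mult_left_mono) (auto simp: pos_less_divide_eq less_imp_le)
    also have "\<dots> \<le> D * q m" using q_pos[OF Kpos, of m] by (intro mult_right_mono) (auto simp: D_def)
    finally show ?thesis .
  next
    case False
    have "q n \<le> c / \<mu> * \<mu>" using q_le[of n] \<mu>0 by simp
    also have "\<dots> \<le> D * q m"
      using \<mu>[of m] \<mu>0 nm False c_gt_1 by (intro mult_mono) (auto simp: D_def le_max_iff_disj)
    finally show ?thesis .
  qed
  then show thesis by (rule that)
qed

lemma V_abs_summable:
  assumes "ereal b < critical_b K"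
  shows "summable (\<lambda>n. norm (fps_nth V n))"
  unfolding V_eq by (rule Wiener_fps_inverse[OF Q_abs_summable eval_Q_nonzero_closed[OF assms]])

lemma v_abs_summable:
  assumes "ereal b < critical_b K"
  shows "summable (\<lambda>n. \<bar>v n\<bar>)"
  using V_abs_summable[OF assms] by (simp add: V_def)

lemma suminf_v:
  assumes "ereal b < critical_b K"
  shows "suminf v = (exp b - 1) / (c - 1)"
proof -
  have "eval_fps V 1 * eval_fps Q 1 = 1"
    using eval_fps_mult_closed_disc[OF V_abs_summable[OF assms] Q_abs_summable, of 1] V_mult_Q by simp
  moreover have "eval_fps V 1 = (\<Sum>n. of_real (v n))" by (simp add: eval_fps_def V_def)
  also have "\<dots> = of_real (suminf v)"
    by (rule suminf_of_real[OF summable_rabs_cancel[OF v_abs_summable[OF assms]], symmetric])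
  ultimately have "complex_of_real (suminf v * ((c - 1) / (exp b - 1))) = of_real 1"
    unfolding eval_Q_1 of_real_mult by simp
  then have "suminf v * ((c - 1) / (exp b - 1)) = 1" by (simp only: of_real_eq_iff)
  then show ?thesis using c_gt_1 b_pos by (simp add: field_simps)
qed

lemma v_derivative_rec:
  "real n * v n = - (\<Sum>j\<le>n. real j * q j * (\<Sum>i\<le>n - j. v i * v (n - j - i)))"
proof (cases n)
  case (Suc m)
  define w where "w = (\<lambda>n. \<Sum>i\<le>n. v i * v (n - i))"
  have V2: "fps_nth (V\<^sup>2) k = of_real (w k)" for k
    by (simp add: power2_eq_square fps_mult_nth V_def w_def atLeast0AtMost)
  have "fps_deriv V = - fps_deriv Q * V\<^sup>2"
    unfolding V_eq using Q_nth_0 by (intro fps_inverse_deriv) simp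
  then have "fps_nth (fps_deriv V) m = - fps_nth (fps_deriv Q * V\<^sup>2) m" by simp
  also have "fps_nth (fps_deriv V) m = of_real (real (Suc m) * v (Suc m))" by (simp add: V_def)
  also have "fps_nth (fps_deriv Q * V\<^sup>2) m = of_real (\<Sum>j\<le>m. real (Suc j) * q (Suc j) * w (m - j))"
    unfolding fps_mult_nth V2 atLeast0AtMost by (simp add: Q_def)
  finally have "complex_of_real (real (Suc m) * v (Suc m)) = of_real (- (\<Sum>j\<le>m. real (Suc j) * q (Suc j) * w (m - j)))"
    by simp
  then have "real (Suc m) * v (Suc m) = - (\<Sum>j\<le>m. real (Suc j) * q (Suc j) * w (m - j))"
    by (simp only: of_real_eq_iff)
  \<comment> \<open>Differentiation shifts the index by one; the term with \<open>j = 0\<close>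
    gained by shifting back is zero because of its factor \<open>j\<close>.\<close>
  also have "(\<Sum>j\<le>m. real (Suc j) * q (Suc j) * w (m - j)) = (\<Sum>j\<le>Suc m. real j * q j * w (Suc m - j))"
    by (subst sum.atMost_Suc_shift) simp
  finally show ?thesis unfolding Suc w_def .
qed simp

text \<open>The constant is minus the square of \<open>suminf v = (exp b - 1) / (c - 1)\<close>,
  times the limit \<open>c / (exp b - 1)\<close> of \<open>q n / K n\<close>.\<close>

lemma v_asymp:
  assumes crit: "ereal b < critical_b K"
    and Kpos: "eventually (\<lambda>n. K n > 0) sequentially" and step: "(\<lambda>n. K (Suc n) / K n) \<longlonglongrightarrow> 1"
    and dbl: "C > 0" "\<And>n m. n \<ge> N \<Longrightarrow> n \<le> m \<Longrightarrow> m \<le> 2 * n \<Longrightarrow> K n \<le> C * K m"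
  shows "(\<lambda>n. v n / K n) \<longlonglongrightarrow> - c * (exp b - 1) / (c - 1)\<^sup>2"
proof -
  obtain D where D: "\<And>n m. n \<le> m \<Longrightarrow> m \<le> 2 * n \<Longrightarrow> q n \<le> D * q m"
    using q_doubling[OF Kpos step dbl] by blast
  have "(\<lambda>n. v n / q n) \<longlonglongrightarrow> - (suminf v)\<^sup>2"
    by (rule reciprocal_series_asymp[OF q_pos[OF Kpos] summable_q q_step[OF Kpos step] D
          v_abs_summable[OF crit] refl v_derivative_rec])
  from tendsto_mult[OF this q_asymp[OF Kpos step]]
  have "(\<lambda>n. v n / q n * (q n / K n)) \<longlonglongrightarrow> - (suminf v)\<^sup>2 * (c / (exp b - 1))" .
  moreover have "v n / q n * (q n / K n) = v n / K n" for n using q_pos[OF Kpos, of n] by simp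
  moreover have "- (suminf v)\<^sup>2 * (c / (exp b - 1)) = - c * (exp b - 1) / (c - 1)\<^sup>2"
  proof -
    have "- (E / d)\<^sup>2 * (c / E) = - c * E / d\<^sup>2" if "E \<noteq> 0" "d \<noteq> 0" for E d :: real
      using that by (simp add: power2_eq_square field_simps)
    then show ?thesis unfolding suminf_v[OF crit] using c_gt_1 b_pos by simp
  qed
  ultimately show ?thesis by (simp only:)
qed

text \<open>\<open>lim u - u n\<close> is the sum of all later increments, and multiplied by
  \<open>exp (b n)\<close> it is the discounted tail of \<open>v\<close>. Discounting divides by
  \<open>exp b - 1\<close>, which cancels that factor in the constant of \<open>v_asymp\<close>. As
  \<open>v\<close> is eventually negative, \<open>u\<close> approaches its limit from above.\<close>

lemma u_asymp:
  assumes crit: "ereal b < critical_b K"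
    and Kpos: "eventually (\<lambda>n. K n > 0) sequentially" and step: "(\<lambda>n. K (Suc n) / K n) \<longlonglongrightarrow> 1"
    and dbl: "C > 0" "\<And>n m. n \<ge> N \<Longrightarrow> n \<le> m \<Longrightarrow> m \<le> 2 * n \<Longrightarrow> K n \<le> C * K m"
  shows "(\<lambda>n. (u n - lim u) / (K n * exp (- b * real n))) \<longlonglongrightarrow> c / (c - 1)\<^sup>2"
proof -
  define R where "R = (\<lambda>n. \<Sum>i. v (n + 1 + i) * exp (- b * real (Suc i)))"
  have "(\<lambda>n. R n / K n) \<longlonglongrightarrow> - c * (exp b - 1) / (c - 1)\<^sup>2 / (exp b - 1)"
    unfolding R_def by (rule discounted_tail_asymp[OF Kpos step v_asymp[OF assms] b_pos])
  from tendsto_minus[OF this] have "(\<lambda>n. - (R n / K n)) \<longlonglongrightarrow> c / (c - 1)\<^sup>2"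
    using b_pos by simp
  moreover have "- (R n / K n) = (u n - lim u) / (K n * exp (- b * real n))" for n
  proof -
    have "convergent u" using crit b_pos by (intro u_converges_geometrically(1)[of "b / 2"]) auto
    then have l: "u \<longlonglongrightarrow> lim u" by (simp add: convergent_LIMSEQ_iff)
    have "(\<lambda>i. u (Suc (i + n)) - u (i + n)) sums (lim u - u (0 + n))"
      using telescope_sums[of "\<lambda>i. u (i + n)" "lim u"] LIMSEQ_ignore_initial_segment[OF l, of n] by simp
    moreover have "u (Suc (i + n)) - u (i + n) = exp (- b * real n) * (v (n + 1 + i) * exp (- b * real (Suc i)))" for i
    proof -
      have "exp (- b * real (Suc (i + n))) = exp (- b * real n) * exp (- b * real (Suc i))"
        by (simp add: algebra_simps flip: exp_add)
      then show ?thesis unfolding u_diff by (simp add: add_ac mult_ac)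
    qed
    ultimately have s: "(\<lambda>i. exp (- b * real n) * (v (n + 1 + i) * exp (- b * real (Suc i)))) sums (lim u - u n)" by simp
    have "(\<lambda>i. exp (b * real n) * (exp (- b * real n) * (v (n + 1 + i) * exp (- b * real (Suc i))))) sums (exp (b * real n) * (lim u - u n))"
      by (rule sums_mult[OF s])
    moreover have "exp (b * real n) * (exp (- b * real n) * x) = x" for x
      by (simp add: mult.assoc[symmetric] flip: exp_add)
    ultimately have "(\<lambda>i. v (n + 1 + i) * exp (- b * real (Suc i))) sums (exp (b * real n) * (lim u - u n))"
      by (simp only:)
    then have "R n = exp (b * real n) * (lim u - u n)" unfolding R_def by (rule sums_unique[symmetric])
    then have "- R n = exp (b * real n) * (u n - lim u)" by (simp add: algebra_simps)
    then have "- (R n / K n) = exp (b * real n) * (u n - lim u) / K n"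
      by (metis minus_divide_left)
    then show ?thesis by (simp add: exp_minus divide_inverse mult_ac)
  qed
  ultimately show ?thesis by simp
qed

lemma u_asymp_equiv:
  assumes crit: "ereal b < critical_b K"
    and Kpos: "eventually (\<lambda>n. K n > 0) sequentially" and step: "(\<lambda>n. K (Suc n) / K n) \<longlonglongrightarrow> 1"
    and dbl: "C > 0" "\<And>n m. n \<ge> N \<Longrightarrow> n \<le> m \<Longrightarrow> m \<le> 2 * n \<Longrightarrow> K n \<le> C * K m"
  shows "(\<lambda>n. u n - lim u) \<sim>[at_top] (\<lambda>n. tilted K b n / (c - 1)\<^sup>2)"
    and "(\<lambda>n. ereal (1 / real n) * elog (u n - lim u)) \<longlonglongrightarrow> ereal (- b)"
proof -
  note r = u_asymp[OF assms]
  define A where "A = c / (c - 1)\<^sup>2"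
  have A: "A > 0" using c_gt_1 by (simp add: A_def)
  define \<rho> where "\<rho> = (\<lambda>n. (u n - lim u) / (K n * exp (- b * real n)))"
  have \<rho>: "\<rho> \<longlonglongrightarrow> A" using r by (simp add: \<rho>_def A_def)
  have "(\<lambda>n. \<rho> n / A) \<longlonglongrightarrow> A / A" using \<rho> A by (intro tendsto_divide tendsto_const) auto
  moreover have "\<rho> n / A = (u n - lim u) / (tilted K b n / (c - 1)\<^sup>2)" for n
    by (simp add: \<rho>_def A_def tilted_def c_def[symmetric] mult_ac)
  ultimately show "(\<lambda>n. u n - lim u) \<sim>[at_top] (\<lambda>n. tilted K b n / (c - 1)\<^sup>2)"
    using A by (intro asymp_equivI') simp
  \<comment> \<open>Since \<open>ln (K n) / n\<close> tends to 0, the rate comes from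
    \<open>exp (- b n)\<close> alone. Eventual positivity of \<rho> and of \<open>K\<close> makes
    \<open>elog\<close> an ordinary logarithm.\<close>
  have "(\<lambda>n. ln (K (Suc n) / K n)) \<longlonglongrightarrow> ln 1" using step by (intro tendsto_ln) auto
  moreover have "eventually (\<lambda>n. K (Suc n) > 0) sequentially"
    using sequentially_offset[OF Kpos, of 1] by simp
  then have "eventually (\<lambda>n. ln (K (Suc n) / K n) = ln (K (Suc n)) - ln (K n)) sequentially"
    using Kpos by eventually_elim (simp add: ln_div)
  ultimately have "(\<lambda>n. ln (K (Suc n)) - ln (K n)) \<longlonglongrightarrow> ln 1" by (rule Lim_transform_eventually)
  then have lnK: "(\<lambda>n. ln (K n) / real n) \<longlonglongrightarrow> 0" by (intro increments_null_imp_div_null) simp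
  have "(\<lambda>n. ln (\<rho> n) * (1 / real n) + ln (K n) / real n - b) \<longlonglongrightarrow> ln A * 0 + 0 - b"
    using \<rho> A lnK by (intro tendsto_intros lim_1_over_n) auto
  then have "(\<lambda>n. ereal (ln (\<rho> n) * (1 / real n) + ln (K n) / real n - b)) \<longlonglongrightarrow> ereal (- b)" by simp
  moreover have "eventually (\<lambda>n. \<rho> n > 0) sequentially" using order_tendstoD(1)[OF \<rho> A] .
  then have "eventually (\<lambda>n. ereal (ln (\<rho> n) * (1 / real n) + ln (K n) / real n - b) =
      ereal (1 / real n) * elog (u n - lim u)) sequentially"
    using Kpos eventually_gt_at_top[of 0]
  proof eventually_elim
    case (elim n)
    have eq: "u n - lim u = \<rho> n * (K n * exp (- b * real n))" using elim by (simp add: \<rho>_def)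
    have pos: "u n - lim u > 0" unfolding eq using elim by simp
    have "ln (u n - lim u) = ln (\<rho> n) + (ln (K n) + - b * real n)"
      unfolding eq using elim by (simp add: ln_mult)
    then have "1 / real n * ln (u n - lim u) = ln (\<rho> n) * (1 / real n) + ln (K n) / real n - b"
      using elim by (simp add: field_simps)
    then show ?case using pos by (simp add: elog_def)
  qed
  ultimately show "(\<lambda>n. ereal (1 / real n) * elog (u n - lim u)) \<longlonglongrightarrow> ereal (- b)"
    by (rule Lim_transform_eventually)
qed

end

theorem theorem1p1:
  fixes K :: "nat \<Rightarrow> real"
  assumes "discrete_density K" and "aperiodic K"
  shows
    "(\<forall>\<alpha> > 0. \<forall>L. slowly_varying L \<longrightarrow>
        tail K \<sim>[at_top] (\<lambda>N. L (real N) / (\<alpha> * real N powr \<alpha>)) \<longrightarrow>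
          critical_b K > 0 \<and>
          (\<forall>b > 0. ereal b \<le> critical_b K \<longrightarrow>
             limsup (\<lambda>n. ereal (1 / real n) *
               elog \<bar>renewal_mass (tilted K b) n - renewal_limit (tilted K b)\<bar>) = ereal (- b)) \<and>
          (\<forall>b > 0. ereal b > critical_b K \<longrightarrow>
             limsup (\<lambda>n. ereal (1 / real n) *
               elog \<bar>renewal_mass (tilted K b) n - renewal_limit (tilted K b)\<bar>) \<ge> ereal (- b))) \<and>
     (\<forall>\<alpha> > 0. \<forall>L. slowly_varying L \<longrightarrow>
        K \<sim>[at_top] (\<lambda>n. L (real n) / real n powr (1 + \<alpha>)) \<longrightarrow>
          (\<forall>b > 0. ereal b < critical_b K \<longrightarrow>
             (\<lambda>n. renewal_mass (tilted K b) n - renewal_limit (tilted K b))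
               \<sim>[at_top] (\<lambda>n. tilted K b n / (tilt_const K b - 1)\<^sup>2) \<and>
             (\<lambda>n. ereal (1 / real n) *
               elog (renewal_mass (tilted K b) n - renewal_limit (tilted K b)))
               \<longlonglongrightarrow> ereal (- b)))"
proof (rule conjI; intro allI impI)
  fix \<alpha> :: real and L :: "real \<Rightarrow> real"
  assume \<alpha>: "\<alpha> > 0" and L: "slowly_varying L"
    and tail: "tail K \<sim>[at_top] (\<lambda>N. L (real N) / (\<alpha> * real N powr \<alpha>))"
  note pos = regularly_varying_floor(1)[OF L \<alpha> tail]
  note lim = regularly_varying_floor(2)[OF L \<alpha> tail]
  \<comment> \<open>The lower bound holds for every \<open>b > 0\<close> and serves both ranges of
    \<open>b\<close>; the upper bound is confined to \<open>b\<close> up to the critical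
    value.\<close>
  have ge: "limsup (\<lambda>n. ereal (1 / real n) *
      elog \<bar>renewal_mass (tilted K b) n - renewal_limit (tilted K b)\<bar>) \<ge> ereal (- b)" if "b > 0" for b
  proof -
    interpret tilted_renewal K b using assms that by unfold_locales
    show ?thesis using limsup_ge[OF \<alpha> pos lim, of "lim u"] unfolding u_def renewal_limit_def by simp
  qed
  have le: "limsup (\<lambda>n. ereal (1 / real n) *
      elog \<bar>renewal_mass (tilted K b) n - renewal_limit (tilted K b)\<bar>) \<le> ereal (- b)"
    if "b > 0" "ereal b \<le> critical_b K" for b
  proof -
    interpret tilted_renewal K b using assms that by unfold_locales
    show ?thesis using limsup_le[OF that(2)] unfolding u_def renewal_limit_def .
  qed
  show "critical_b K > 0 \<and>
      (\<forall>b > 0. ereal b \<le> critical_b K \<longrightarrow>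
         limsup (\<lambda>n. ereal (1 / real n) *
           elog \<bar>renewal_mass (tilted K b) n - renewal_limit (tilted K b)\<bar>) = ereal (- b)) \<and>
      (\<forall>b > 0. ereal b > critical_b K \<longrightarrow>
         limsup (\<lambda>n. ereal (1 / real n) *
           elog \<bar>renewal_mass (tilted K b) n - renewal_limit (tilted K b)\<bar>) \<ge> ereal (- b))"
  proof (intro conjI allI impI)
    show "critical_b K > 0" by (rule critical_b_pos[OF assms \<alpha> pos lim])
  qed (auto intro!: antisym le ge)
next
  fix \<alpha> :: real and L :: "real \<Rightarrow> real" and b :: real
  assume \<alpha>: "\<alpha> > 0" and L: "slowly_varying L"
    and K: "K \<sim>[at_top] (\<lambda>n. L (real n) / real n powr (1 + \<alpha>))"
    and b: "b > 0" "ereal b < critical_b K"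
  interpret tilted_renewal K b using assms b by unfold_locales
  obtain C N where dbl: "C > 0" "\<And>n m. n \<ge> N \<Longrightarrow> n \<le> m \<Longrightarrow> m \<le> 2 * n \<Longrightarrow> K n \<le> C * K m"
    using regularly_varying_step(3)[OF L K] \<alpha> by auto
  note res = u_asymp_equiv[OF b(2) regularly_varying_step(1)[OF L K] regularly_varying_step(2)[OF L K] dbl]
  show "(\<lambda>n. renewal_mass (tilted K b) n - renewal_limit (tilted K b))
        \<sim>[at_top] (\<lambda>n. tilted K b n / (tilt_const K b - 1)\<^sup>2) \<and>
      (\<lambda>n. ereal (1 / real n) * elog (renewal_mass (tilted K b) n - renewal_limit (tilted K b)))
        \<longlonglongrightarrow> ereal (- b)"
    using res unfolding u_def renewal_limit_def c_def by blast
qed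

end
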